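(* Let $e_1,e_2,e_3$ be nonzero integers with $e_1+e_2+e_3=0$, $2\,\|\,e_1$, $2\,\|\,e_2$, $4\mid e_3$. Let $n=p_1\cdots p_k$ be an odd positive square-free integer coprime with $e_1e_2e_3$, whose prime factors are quadratic residues modulo each odd prime factor of $e_1e_2e_3$. Assume that - neither $E$ nor $E^{(n)}$ has a rational point of order $4$; - $e_3>0$ and $e_1<0$; - $\left(\frac{p^*}{q}\right)=1$ for all odd primes $p\mid n$, $q\mid e_1e_3$. If $\mathrm{Sel}_2(E/\mathbb{Q})\cong(\mathbb{Z}/2\mathbb{Z})^2$, then every class of $\mathrm{Sel}_2'(E^{(n)})$ has a unique representative $(d_1,d_2,d_3)$ with $d_i$ (possibly negative) divisors of $n$, $d_2>0$ and $d_3\equiv1\pmod 4$, and the map $(d_1,d_2,d_3)\mapsto\begin{pmatrix}\mathbf{y}\\ \mathbf{z}\end{pmatrix}$, where $\mathbf{y}=(v_{p_i}(d_2))_i^{\mathrm T}$, $\mathbf{z}=(v_{p_i}(d_3))_i^{\mathrm T}\in\mathbb{F}_2^k$, induces an isomorphism $$\mathrm{Sel}_2'(E^{(n)})\xrightarrow{\sim}\ker\begin{pmatrix}\mathbf{A}+\mathbf{D}_{-e_1}&\mathbf{D}_{-e_1e_3}\\ \mathbf{D}_{-e_1e_2}&\mathbf{A}^{\mathrm T}+\mathbf{D}_{-e_1}\end{pmatrix}.$$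
   Context: For a nonzero integer $m$, $E^{(m)}$ is $y^2=x(x-e_1m)(x+e_2m)$, $E=E^{(1)}$. For $\Lambda=(d_1,d_2,d_3)$ of nonzero square-free integers with $d_1d_2d_3$ a square, $D^{(m)}_\Lambda\subset\mathbb{P}^3$ is defined by $e_1mt^2+d_2u_2^2-d_3u_3^2=0$, $e_2mt^2+d_3u_3^2-d_1u_1^2=0$, $e_3mt^2+d_1u_1^2-d_2u_2^2=0$. $\mathrm{Sel}_2(E^{(m)}/\mathbb{Q})$ is identified with the group (componentwise multiplication) of $\Lambda\in(\mathbb{Q}^\times/\mathbb{Q}^{\times2})^3$ with $d_1d_2d_3\in\mathbb{Q}^{\times2}$ and $D^{(m)}_\Lambda(\mathbb{A}_{\mathbb{Q}})\ne\emptyset$; rational 2-torsion points correspond to $(1,1,1)$, $(-e_3m,-e_1e_3,e_1m)$, $(-e_2e_3,e_3m,-e_2m)$, $(e_2m,-e_1m,-e_1e_2)$. $\mathrm{Sel}_2'(E^{(m)})=\mathrm{Sel}_2(E^{(m)}/\mathbb{Q})/(E^{(m)}(\mathbb{Q})_{\rm tors}/2E^{(m)}(\mathbb{Q})_{\rm tors})$. $[\alpha,\beta]_v$ is the additive Hilbert symbol, $(\alpha,\beta)_v=(-1)^{[\alpha,\beta]_v}$. $\mathbf{A}=([p_j,-n]_{p_i})_{i,j}\in M_k(\mathbb{F}_2)$. For $u$ coprime to $n$, $\mathbf{D}_u=\mathrm{diag}([u/p_1],\dots,[u/p_k])$, with $[u/p]\in\mathbb{F}_2$ equal to $0$ if $u$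 is a quadratic residue mod $p$ and $1$ otherwise. For an odd integer $m$, $m^*=(-1)^{(m-1)/2}m\equiv1\pmod 4$. $2\,\|\,m$ means $2\mid m$, $4\nmid m$. *)

theory Defs
  imports "HOL-Number_Theory.Number_Theory" "HOL-Computational_Algebra.Squarefree" "HOL-Library.Z2"
begin

text \<open>Elements of Q^x/Q^x2 are represented by their unique square-free integer
  representative (sign included).  sqf x is the square-free part of a nonzero integer x.\<close>
definition sqf :: "int \<Rightarrow> int" where
  "sqf x = (THE d. squarefree d \<and> (\<exists>s. x = d * s^2))"

type_synonym triple = "int \<times> int \<times> int"

definition tsqf :: "triple \<Rightarrow> triple" where
  "tsqf a = (case a of (a1, a2, a3) \<Rightarrow> (sqf a1, sqf a2, sqf a3))"

definition tmul :: "triple \<Rightarrow> triple \<Rightarrow> triple" where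
  "tmul a b = (case a of (a1, a2, a3) \<Rightarrow> case b of (b1, b2, b3) \<Rightarrow>
      (sqf (a1 * b1), sqf (a2 * b2), sqf (a3 * b3)))"

text \<open>A system of homogeneous integral forms in nv variables has a nontrivial
  Q_p-point iff for every N it has a primitive integral solution modulo p^N
  (compactness of the primitive vectors of Z_p^nv).\<close>
definition padic_sol :: "nat \<Rightarrow> nat \<Rightarrow> ((nat \<Rightarrow> int) \<Rightarrow> int list) \<Rightarrow> bool" where
  "padic_sol p nv F = (\<forall>N::nat. \<exists>x::nat \<Rightarrow> int.
      (\<exists>i<nv. \<not> int p dvd x i) \<and> (\<forall>v\<in>set (F x). (int p ^ N) dvd v))"

definition real_sol :: "nat \<Rightarrow> ((nat \<Rightarrow> real) \<Rightarrow> real list) \<Rightarrow> bool" where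
  "real_sol nv F = (\<exists>x::nat \<Rightarrow> real. (\<exists>i<nv. x i \<noteq> 0) \<and> (\<forall>v\<in>set (F x). v = 0))"

text \<open>Variables: x 0 = t, x 1 = u1, x 2 = u2, x 3 = u3.\<close>
definition D_eqs :: "int \<Rightarrow> int \<Rightarrow> int \<Rightarrow> int \<Rightarrow> triple \<Rightarrow> (nat \<Rightarrow> 'a::comm_ring_1) \<Rightarrow> 'a list" where
  "D_eqs e1 e2 e3 m L x = (case L of (d1, d2, d3) \<Rightarrow>
     [of_int (e1 * m) * (x 0)^2 + of_int d2 * (x 2)^2 - of_int d3 * (x 3)^2,
      of_int (e2 * m) * (x 0)^2 + of_int d3 * (x 3)^2 - of_int d1 * (x 1)^2,
      of_int (e3 * m) * (x 0)^2 + of_int d1 * (x 1)^2 - of_int d2 * (x 2)^2])"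

definition D_adelic :: "int \<Rightarrow> int \<Rightarrow> int \<Rightarrow> int \<Rightarrow> triple \<Rightarrow> bool" where
  "D_adelic e1 e2 e3 m L =
     (real_sol 4 (D_eqs e1 e2 e3 m L) \<and> (\<forall>p. prime p \<longrightarrow> padic_sol p 4 (D_eqs e1 e2 e3 m L)))"

definition Sel2 :: "int \<Rightarrow> int \<Rightarrow> int \<Rightarrow> int \<Rightarrow> triple set" where
  "Sel2 e1 e2 e3 m = {(d1, d2, d3). d1 \<noteq> 0 \<and> d2 \<noteq> 0 \<and> d3 \<noteq> 0 \<and>
      squarefree d1 \<and> squarefree d2 \<and> squarefree d3 \<and>
      (\<exists>s::int. d1 * d2 * d3 = s^2) \<and> D_adelic e1 e2 e3 m (d1, d2, d3)}"

text \<open>Image of the rational 2-torsion of E^(m) in Sel_2.\<close>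
definition Tors :: "int \<Rightarrow> int \<Rightarrow> int \<Rightarrow> int \<Rightarrow> triple set" where
  "Tors e1 e2 e3 m = {(1, 1, 1), tsqf (-e3 * m, -e1 * e3, e1 * m),
      tsqf (-e2 * e3, e3 * m, -e2 * m), tsqf (e2 * m, -e1 * m, -e1 * e2)}"

definition sel_class :: "int \<Rightarrow> int \<Rightarrow> int \<Rightarrow> int \<Rightarrow> triple \<Rightarrow> triple set" where
  "sel_class e1 e2 e3 m L = tmul L ` Tors e1 e2 e3 m"

section \<open>Rational points of order 4 on E^(m): y^2 = x(x - e1 m)(x + e2 m)\<close>

text \<open>The curve is y^2 = x^3 + a x^2 + b x with a = (e2 - e1) m, b = - e1 e2 m^2.
  For an affine point P = (x,y) with y \<noteq> 0, 2P is given by the tangent formula;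
  P has order 4 iff 2P is a point of order 2, i.e. an affine point with y-coordinate 0.\<close>
definition ec_double :: "rat \<Rightarrow> rat \<Rightarrow> rat \<times> rat \<Rightarrow> rat \<times> rat" where
  "ec_double a b P = (case P of (x, y) \<Rightarrow>
     let l = (3 * x^2 + 2 * a * x + b) / (2 * y);
         x3 = l^2 - a - 2 * x
     in (x3, - (y + l * (x3 - x))))"

definition has_order4_point :: "int \<Rightarrow> int \<Rightarrow> int \<Rightarrow> bool" where
  "has_order4_point e1 e2 m = (let a = of_int ((e2 - e1) * m); b = of_int (- e1 * e2 * m^2) in
     \<exists>x y :: rat. y^2 = x^3 + a * x^2 + b * x \<and> y \<noteq> 0 \<and> snd (ec_double a b (x, y)) = 0)"

definition hilb_add :: "nat \<Rightarrow> int \<Rightarrow> int \<Rightarrow> bit" where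
  "hilb_add p a b = (if padic_sol p 3 (\<lambda>x. [a * (x 0)^2 + b * (x 1)^2 - (x 2)^2]) then 0 else 1)"

definition lsym :: "int \<Rightarrow> nat \<Rightarrow> bit" where
  "lsym u p = (if QuadRes (int p) u then 0 else 1)"

definition pstar :: "nat \<Rightarrow> int" where
  "pstar p = (-1) ^ ((p - 1) div 2) * int p"

definition matA :: "nat \<Rightarrow> (nat \<Rightarrow> nat) \<Rightarrow> nat \<Rightarrow> nat \<Rightarrow> bit" where
  "matA n p i j = hilb_add (p i) (int (p j)) (- int n)"

definition Ker :: "int \<Rightarrow> int \<Rightarrow> int \<Rightarrow> nat \<Rightarrow> nat \<Rightarrow> (nat \<Rightarrow> nat) \<Rightarrow> ((nat \<Rightarrow> bit) \<times> (nat \<Rightarrow> bit)) set" where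
  "Ker e1 e2 e3 n k p = {(y, z). (\<forall>i\<ge>k. y i = 0 \<and> z i = 0) \<and>
     (\<forall>i<k. (\<Sum>j<k. matA n p i j * y j) + lsym (- e1) (p i) * y i
              + lsym (- e1 * e3) (p i) * z i = 0 \<and>
           lsym (- e1 * e2) (p i) * y i + (\<Sum>j<k. matA n p j i * z j)
              + lsym (- e1) (p i) * z i = 0)}"

definition Phi :: "nat \<Rightarrow> (nat \<Rightarrow> nat) \<Rightarrow> triple \<Rightarrow> (nat \<Rightarrow> bit) \<times> (nat \<Rightarrow> bit)" where
  "Phi k p L = (case L of (d1, d2, d3) \<Rightarrow>
     ((\<lambda>i. if i < k then of_nat (multiplicity (int (p i)) d2) else 0),
      (\<lambda>i. if i < k then of_nat (multiplicity (int (p i)) d3) else 0)))"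

definition good_rep :: "nat \<Rightarrow> triple \<Rightarrow> bool" where
  "good_rep n L = (case L of (d1, d2, d3) \<Rightarrow>
     d1 dvd int n \<and> d2 dvd int n \<and> d3 dvd int n \<and> d2 > 0 \<and> d3 mod 4 = 1)"

end

theory Submission
  imports Defs "HOL-Computational_Algebra.Nth_Powers"
begin

text \<open>
  The local conditions on a triple \<open>(d1, d2, d3)\<close> are redundant: each equation of the 2-covering is a
  conic, and a conic that is isotropic at every place other than 2 is isotropic at 2 by the product
  formula for Hilbert symbols. For odd \<open>di\<close> with \<open>d3 \<equiv> 1 (mod 4)\<close> this already forces
  solubility over the 2-adic numbers.

  Translating by 2-torsion makes any Selmer triple of the twist odd, in exactly one way, since the four
  torsion classes are told apart by the parities of \<open>d2\<close> and \<open>d3\<close>. Split off the part of \<open>di\<close>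
  dividing \<open>n\<close>, with signs such that the factor of \<open>d2\<close> is positive and that of \<open>d3\<close> is 1 modulo 4.
  By the residue conditions on the primes of \<open>n\<close> the remaining triple satisfies the conditions of the
  untwisted curve at every place except possibly 2, hence also at 2. The Selmer group of the untwisted
  curve consists of torsion classes only, so the remaining triple, being odd, is trivial.

  For a triple of divisors of \<open>n\<close> only the conditions at the primes of \<open>n\<close> are left. There the
  local image is generated by the 2-torsion and is its own orthogonal complement under the Hilbert
  pairing, so the condition is orthogonality to two torsion triples, which amounts to the vanishing of
  two rows of the matrix; quadratic reciprocity, applied to the \<open>p*\<close> whose product is \<open>d3\<close>, turns
  the second row into one of the transpose of \<open>A\<close>.
\<close>

subsection \<open>Squares modulo an odd prime\<close>

lemma Legendre_cong:
  assumes "[a = b] (mod q)"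
  shows "Legendre a q = Legendre b q"
proof -
  have "[a = 0] (mod q) \<longleftrightarrow> [b = 0] (mod q)"
    using assms cong_trans cong_sym by blast
  moreover have "QuadRes q a \<longleftrightarrow> QuadRes q b"
    unfolding QuadRes_def using assms cong_trans cong_sym by blast
  ultimately show ?thesis by (simp add: Legendre_def)
qed

lemma Legendre_values: "Legendre a q = -1 \<or> Legendre a q = 0 \<or> Legendre a q = 1"
  by (simp add: Legendre_def)

lemma Legendre_eq_0_iff: "Legendre a q = 0 \<longleftrightarrow> q dvd a"
  by (simp add: Legendre_def cong_0_iff)

lemma Legendre_eq_1_iff: "Legendre a q = 1 \<longleftrightarrow> \<not> q dvd a \<and> QuadRes q a"
  by (simp add: Legendre_def cong_0_iff)

lemma Legendre_of_not_dvd: "\<not> q dvd a \<Longrightarrow> Legendre a q = 1 \<or> Legendre a q = -1"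
  using Legendre_values[of a q] Legendre_eq_0_iff[of a q] by auto

lemma not_dvd_of_Legendre: "Legendre a q = 1 \<or> Legendre a q = -1 \<Longrightarrow> \<not> q dvd a"
  using Legendre_eq_0_iff[of a q] by auto

lemma Legendre_square:
  assumes "prime (q::int)" "\<not> q dvd a"
  shows "Legendre (a^2) q = 1"
  using assms unfolding Legendre_eq_1_iff QuadRes_def by (metis cong_refl prime_dvd_power)

lemma Legendre_1: "prime (q::int) \<Longrightarrow> Legendre 1 q = 1"
  using Legendre_square[of q 1] not_prime_unit by fastforce

lemma prime_imp_coprime_left: "prime (q::int) \<Longrightarrow> \<not> q dvd c \<Longrightarrow> coprime c q"
  using prime_imp_coprime coprime_commute by blast

lemma dvd_mult_square: "(q::int) dvd u \<Longrightarrow> q dvd d * u^2"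
  by (simp add: power2_eq_square)

lemma prime_dvd_mult_square:
  assumes "prime (q::int)" "q dvd d * u^2" "\<not> q dvd d"
  shows "q dvd u"
  using assms by (metis prime_dvd_mult_iff prime_dvd_power)

lemma prime_square_dvd_mult_square:
  assumes "prime (q::int)" "q^2 dvd d * u^2" "\<not> q^2 dvd d"
  shows "q dvd u"
proof (rule ccontr)
  assume "\<not> q dvd u"
  hence "coprime (q^2) (u^2)" using assms(1) by (simp add: prime_imp_coprime)
  thus False using assms coprime_dvd_mult_left_iff by blast
qed

lemma Legendre_eq_1_if_dvd_diff_squares:
  assumes "prime (q::int)" "q dvd b * t^2 - c * u^2" "\<not> q dvd t" "\<not> q dvd b" "\<not> q dvd c"
  shows "Legendre (b * c) q = 1"
proof -
  have "coprime t q" using assms by (intro prime_imp_coprime_left)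
  then obtain t' where t': "[t * t' = 1] (mod q)" using cong_solve_coprime_int by blast
  have "[b * t^2 = c * u^2] (mod q)" using assms(2) by (simp add: cong_iff_dvd_diff)
  hence "[b * t^2 * (c * t'^2) = c * u^2 * (c * t'^2)] (mod q)" by (rule cong_mult[OF _ cong_refl])
  hence "[(c * u * t')^2 = b * c * (t * t')^2] (mod q)"
    by (simp add: power2_eq_square mult_ac cong_sym_eq)
  moreover have "[b * c * (t * t')^2 = b * c * 1^2] (mod q)" by (intro cong_mult cong_pow cong_refl t')
  ultimately have "[(c * u * t')^2 = b * c] (mod q)" using cong_trans by fastforce
  moreover have "\<not> q dvd b * c" using assms by (simp add: prime_dvd_mult_iff)
  ultimately show ?thesis unfolding Legendre_eq_1_iff QuadRes_def by blast
qed

context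
  fixes q :: int
  assumes prime_q: "prime q" and q_gt_2: "2 < q"
begin

lemma odd_prime_int: "odd q"
  using prime_q q_gt_2 primes_dvd_imp_eq[of 2 q] by force

lemma odd_prime_int_natE:
  obtains r where "q = int r" "prime r" "2 < r" "odd r"
proof
  show "q = int (nat q)" "2 < nat q" using q_gt_2 by auto
  show "prime (nat q)" using prime_q by simp
  show "odd (nat q)" using odd_prime_int q_gt_2 by (simp add: even_nat_iff)
qed

lemma not_dvd_one_two: "\<not> q dvd 1" "\<not> q dvd -1" "\<not> q dvd 2"
  using q_gt_2 zdvd_imp_le[of q 2] by auto

lemma eq_if_cong_pm_one:
  fixes x y :: int
  assumes "x = 1 \<or> x = -1" "y = 1 \<or> y = -1" "[x = y] (mod q)"
  shows "x = y"
  using assms not_dvd_one_two by (auto simp: cong_iff_dvd_diff)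

lemma Legendre_mult: "Legendre (a * b) q = Legendre a q * Legendre b q"
proof (cases "q dvd a * b")
  case True
  thus ?thesis using Legendre_eq_0_iff[of _ q] prime_q by (metis mult_eq_0_iff prime_dvd_mult_iff)
next
  case False
  obtain r where r: "q = int r" "prime r" "2 < r" by (rule odd_prime_int_natE)
  note euler = euler_criterion[OF r(2,3), folded r(1)]
  have "[Legendre (a * b) q = a ^ ((r - 1) div 2) * b ^ ((r - 1) div 2)] (mod q)"
    using euler by (simp add: power_mult_distrib[symmetric])
  also have "[a ^ ((r - 1) div 2) * b ^ ((r - 1) div 2) = Legendre a q * Legendre b q] (mod q)"
    by (rule cong_mult[OF cong_sym[OF euler] cong_sym[OF euler]])
  finally have "[Legendre (a * b) q = Legendre a q * Legendre b q] (mod q)" .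
  moreover have "Legendre a q * Legendre b q = 1 \<or> Legendre a q * Legendre b q = -1"
    using False Legendre_of_not_dvd[of q a] Legendre_of_not_dvd[of q b] by fastforce
  ultimately show ?thesis using eq_if_cong_pm_one[OF Legendre_of_not_dvd[OF False]] by blast
qed

lemma Legendre_power: "Legendre (a ^ i) q = Legendre a q ^ i"
  by (induction i) (simp_all add: Legendre_1[OF prime_q] Legendre_mult)

lemma Legendre_prod: "finite A \<Longrightarrow> Legendre (\<Prod>j\<in>A. f j) q = (\<Prod>j\<in>A. Legendre (f j) q)"
  by (induction A rule: finite_induct) (simp_all add: Legendre_1[OF prime_q] Legendre_mult)

lemma Legendre_minus: "Legendre (- a) q = Legendre (-1) q * Legendre a q"
  using Legendre_mult[of "-1" a] by simp

lemma Legendre_mult_self: "\<not> q dvd a \<Longrightarrow> Legendre a q * Legendre a q = 1"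
  using Legendre_of_not_dvd[of q a] by auto

lemma Legendre_triple_eq_1:
  assumes "\<not> q dvd d1" "\<not> q dvd d2" "\<not> q dvd d3" "d1 * d2 * d3 = s^2"
  shows "Legendre d1 q * Legendre d2 q * Legendre d3 q = 1"
proof -
  have "\<not> q dvd d1 * d2 * d3" using prime_q assms(1-3) by (simp add: prime_dvd_mult_iff)
  hence "\<not> q dvd s" unfolding assms(4) power2_eq_square by auto
  hence "Legendre (s^2) q = 1" using Legendre_square prime_q by blast
  thus ?thesis unfolding assms(4)[symmetric] by (simp add: Legendre_mult)
qed

lemma exists_nonresidue: obtains g where "Legendre g q = -1"
proof -
  let ?sq = "\<lambda>x. x^2 mod q"
  have "\<not> {0..<q} \<subseteq> ?sq ` {0..<q}"
  proof
    assume "{0..<q} \<subseteq> ?sq ` {0..<q}"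
    hence "inj_on ?sq {0..<q}" by (intro finite_surj_inj) auto
    moreover have "(q - 1)^2 = 1^2 + q * (q - 2)" by (simp add: power2_eq_square algebra_simps)
    hence "?sq (q - 1) = ?sq 1" by (metis mod_mult_self2)
    ultimately have "q - 1 = 1" by (rule inj_onD) (use q_gt_2 in auto)
    thus False using q_gt_2 by simp
  qed
  then obtain g where g: "0 \<le> g" "g < q" "g \<notin> ?sq ` {0..<q}" by (meson atLeastLessThan_iff subsetI)
  have "\<not> QuadRes q g"
  proof
    assume "QuadRes q g"
    then obtain y where "[y^2 = g] (mod q)" by (auto simp: QuadRes_def)
    hence "?sq (y mod q) = g" using g(1,2) by (simp add: cong_def power_mod)
    moreover have "y mod q \<in> {0..<q}" using q_gt_2 by simp
    ultimately show False using g(3) by blast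
  qed
  moreover have "[g = 0] (mod q) \<Longrightarrow> QuadRes q g"
    unfolding QuadRes_def using cong_sym by (intro exI[of _ 0]) simp
  ultimately have "Legendre g q = -1" by (auto simp: Legendre_def)
  thus ?thesis by (rule that)
qed

lemma inj_on_quadratic_residues:
  assumes "\<not> q dvd a"
  shows "inj_on (\<lambda>x. (a * x^2 + c) mod q) {0..(q - 1) div 2}"
proof (rule inj_onI)
  fix x y assume x: "x \<in> {0..(q - 1) div 2}" and y: "y \<in> {0..(q - 1) div 2}"
    and "(a * x^2 + c) mod q = (a * y^2 + c) mod q"
  hence "q dvd (a * x^2 + c) - (a * y^2 + c)" by (simp add: mod_eq_dvd_iff)
  also have "(a * x^2 + c) - (a * y^2 + c) = a * ((x - y) * (x + y))"
    by (simp add: algebra_simps power2_eq_square)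
  finally have "q dvd x - y \<or> q dvd x + y" using assms prime_q by (simp add: prime_dvd_mult_iff)
  thus "x = y"
  proof
    assume "q dvd x - y"
    moreover have "\<bar>x - y\<bar> < q" using x y q_gt_2 by auto
    ultimately show ?thesis using dvd_imp_le_int[of "x - y" q] by fastforce
  next
    assume dvd: "q dvd x + y"
    have "x + y < q" using x y by auto
    hence "x + y = 0" using dvd x y zdvd_imp_le[of q "x + y"] by fastforce
    thus ?thesis using x y by auto
  qed
qed

text \<open>Pigeonhole: \<open>a x\<^sup>2\<close> and \<open>c - b y\<^sup>2\<close> each take more than half of all residues.\<close>
lemma binary_form_surj_mod:
  assumes "\<not> q dvd a" "\<not> q dvd b"
  obtains x y where "[a * x^2 + b * y^2 = c] (mod q)"
proof -
  let ?I = "{0..(q - 1) div 2}"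
  let ?f = "\<lambda>x. (a * x^2 + 0) mod q" and ?g = "\<lambda>x. (- b * x^2 + c) mod q"
  have "?f ` ?I \<inter> ?g ` ?I \<noteq> {}"
  proof
    assume "?f ` ?I \<inter> ?g ` ?I = {}"
    hence "card (?f ` ?I \<union> ?g ` ?I) = card (?f ` ?I) + card (?g ` ?I)" by (intro card_Un_disjoint) auto
    also have "\<dots> = card ?I + card ?I"
      by (intro arg_cong2[of _ _ _ _ "(+)"] card_image inj_on_quadratic_residues) (use assms in simp_all)
    also have "\<dots> > nat q" using odd_prime_int q_gt_2 by (auto elim!: oddE)
    moreover have "?f ` ?I \<union> ?g ` ?I \<subseteq> {0..<q}" using q_gt_2 by auto
    hence "card (?f ` ?I \<union> ?g ` ?I) \<le> nat q" using card_mono[of "{0..<q}"] by fastforce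
    ultimately show False by linarith
  qed
  then obtain x y where "?f x = ?g y" by auto
  hence "[a * x^2 + b * y^2 = c] (mod q)" by (simp add: mod_eq_dvd_iff cong_iff_dvd_diff algebra_simps)
  thus ?thesis by (rule that)
qed

end

subsection \<open>Character sums over the residue field\<close>

lemma sum_residues_affine:
  fixes q :: int and f :: "int \<Rightarrow> 'a::comm_monoid_add"
  assumes "q > 0" "coprime a q" "\<And>x y. [x = y] (mod q) \<Longrightarrow> f x = f y"
  shows "(\<Sum>x\<in>{0..<q}. f (a * x + b)) = (\<Sum>x\<in>{0..<q}. f x)"
proof -
  let ?h = "\<lambda>x. (a * x + b) mod q"
  have inj: "inj_on ?h {0..<q}"
  proof (rule inj_onI)
    fix x y assume "x \<in> {0..<q}" "y \<in> {0..<q}" "?h x = ?h y"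
    moreover from this have "[x = y] (mod q)"
      using assms(2) by (simp add: cong_def[symmetric] cong_add_rcancel cong_mult_lcancel)
    ultimately show "x = y" by (simp add: cong_def)
  qed
  hence "?h ` {0..<q} = {0..<q}" using assms(1) by (intro endo_inj_surj) auto
  hence "(\<Sum>x\<in>{0..<q}. f (?h x)) = (\<Sum>x\<in>{0..<q}. f x)"
    using inj by (intro sum.reindex_bij_betw) (simp add: bij_betw_def)
  moreover have "f (a * x + b) = f (?h x)" for x by (rule assms(3)) simp
  ultimately show ?thesis by simp
qed

context
  fixes q :: int
  assumes prime_q: "prime q" and q_gt_2: "2 < q"
begin

lemma sum_Legendre_linear:
  assumes "\<not> q dvd a"
  shows "(\<Sum>x\<in>{0..<q}. Legendre (a * x + b) q) = 0"
proof -
  have affine: "(\<Sum>x\<in>{0..<q}. Legendre (c * x + d) q) = (\<Sum>x\<in>{0..<q}. Legendre x q)"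
    if "\<not> q dvd c" for c d
    using q_gt_2 prime_imp_coprime_left[OF prime_q that] Legendre_cong by (intro sum_residues_affine) auto
  obtain g where g: "Legendre g q = -1" using exists_nonresidue[OF prime_q q_gt_2] .
  have "(\<Sum>x\<in>{0..<q}. Legendre x q) = (\<Sum>x\<in>{0..<q}. Legendre (g * x + 0) q)"
    using affine[of g 0] not_dvd_of_Legendre[of g q] g by simp
  also have "\<dots> = - (\<Sum>x\<in>{0..<q}. Legendre x q)"
    by (simp add: Legendre_mult[OF prime_q q_gt_2] g sum_negf)
  finally show ?thesis using affine[OF assms] by simp
qed

text \<open>Substituting the inverse of \<open>x\<close> makes \<open>x (x + c)\<close> linear up to squares.\<close>
lemma sum_Legendre_mult_shift:
  assumes "\<not> q dvd c"
  shows "(\<Sum>x\<in>{0..<q}. Legendre (x * (x + c)) q) = -1"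
proof -
  note mult = Legendre_mult[OF prime_q q_gt_2]
  let ?inv = "modular_inverse q"
  have unit: "\<not> q dvd x" if "x \<in> {1..<q}" for x using that zdvd_imp_le[of q x] by auto
  have inv: "?inv x \<in> {1..<q}" "?inv (?inv x) = x" if x: "x \<in> {1..<q}" for x
  proof -
    have "coprime x q" by (rule prime_imp_coprime_left[OF prime_q unit[OF x]])
    thus "?inv x \<in> {1..<q}"
      using mult_modular_inverse_int_pos[of q x] modular_inverse_int_less[of q x] q_gt_2 by simp
    show "?inv (?inv x) = x"
      using x cong_modular_inverse2[OF \<open>coprime x q\<close>] by (intro modular_inverse_int_eqI) auto
  qed
  have inverted: "Legendre (x * (x + c)) q = Legendre (c * ?inv x + 1) q" if x: "x \<in> {1..<q}" for x
  proof -
    have x': "[x * ?inv x = 1] (mod q)" by (rule cong_modular_inverse1[OF prime_imp_coprime_left[OF prime_q unit[OF x]]])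
    have "Legendre (x * (x + c)) q = Legendre (x * (x + c)) q * Legendre (?inv x ^ 2) q"
      using Legendre_square[OF prime_q unit[OF inv(1)[OF x]]] by simp
    also have "\<dots> = Legendre ((x * ?inv x) * (x * ?inv x + c * ?inv x)) q"
      unfolding mult[symmetric] by (simp add: power2_eq_square algebra_simps)
    also have "\<dots> = Legendre (1 * (1 + c * ?inv x)) q"
      by (intro Legendre_cong cong_mult cong_add x' cong_refl)
    finally show ?thesis by (simp add: add.commute)
  qed
  have split: "{0..<q} = insert 0 {1..<q}" using q_gt_2 by auto
  have "(\<Sum>x\<in>{0..<q}. Legendre (x * (x + c)) q) = (\<Sum>x\<in>{1..<q}. Legendre (c * ?inv x + 1) q)"
    unfolding split using inverted by (simp add: Legendre_eq_0_iff)
  also have "\<dots> = (\<Sum>x\<in>{1..<q}. Legendre (c * x + 1) q)"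
    by (rule sum.reindex_bij_witness[of _ ?inv ?inv]) (use inv in auto)
  also have "\<dots> = (\<Sum>x\<in>{0..<q}. Legendre (c * x + 1) q) - 1"
    unfolding split using Legendre_1[OF prime_q] by simp
  finally show ?thesis using sum_Legendre_linear[OF assms] by simp
qed

lemma sum_Legendre_quadratic:
  assumes "\<not> q dvd a - b"
  shows "(\<Sum>x\<in>{0..<q}. Legendre ((x + a) * (x + b)) q) = -1"
proof -
  let ?f = "\<lambda>x. Legendre (x * (x + (a - b))) q"
  have "(\<Sum>x\<in>{0..<q}. Legendre ((x + a) * (x + b)) q) = (\<Sum>x\<in>{0..<q}. ?f (1 * x + b))"
    by (simp add: algebra_simps)
  also have "\<dots> = (\<Sum>x\<in>{0..<q}. ?f x)"
    using q_gt_2 by (intro sum_residues_affine) (auto intro!: Legendre_cong cong_mult cong_add)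
  finally show ?thesis using sum_Legendre_mult_shift[OF assms] by simp
qed

text \<open>Over the residue field all 2-coverings of the curve have equally many points: the affine
  part of a nontrivial one has four points more than that of the trivial one, which has four
  points at infinity.\<close>
lemma residue_point_on_nontrivial_covering:
  assumes "\<not> q dvd a1 - a2" "\<not> q dvd a2 - a3"
    and "Legendre d1 q = -1" "Legendre d2 q = 1" "Legendre d3 q = -1"
  obtains x where "Legendre (d1 * (x + a1)) q \<noteq> -1" "Legendre (d2 * (x + a2)) q \<noteq> -1"
    "Legendre (d3 * (x + a3)) q \<noteq> -1"
proof -
  note mult = Legendre_mult[OF prime_q q_gt_2]
  define l where "l a x = Legendre (x + a) q" for a x
  have l_values: "l a x = -1 \<or> l a x = 0 \<or> l a x = 1" for a x
    unfolding l_def by (rule Legendre_values)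
  define P where "P x = (1 - l a1 x) * (1 + l a2 x) * (1 - l a3 x)" for x
  define Q where "Q x = (1 + l a1 x) * (1 + l a2 x) * (1 + l a3 x)" for x
  have diff: "P x = Q x + (-2) * l a1 x + (-2) * l a3 x + (-2) * (l a1 x * l a2 x) + (-2) * (l a2 x * l a3 x)" for x
    unfolding P_def Q_def by (simp add: algebra_simps)
  have linear: "(\<Sum>x\<in>{0..<q}. l a x) = 0" for a
    using sum_Legendre_linear[of 1 a] not_dvd_one_two[OF prime_q q_gt_2] by (simp add: l_def)
  have "(\<Sum>x\<in>{0..<q}. l a1 x * l a2 x) = -1" "(\<Sum>x\<in>{0..<q}. l a2 x * l a3 x) = -1"
    unfolding l_def mult[symmetric] using sum_Legendre_quadratic assms(1,2) by blast+
  hence "(\<Sum>x\<in>{0..<q}. P x) = (\<Sum>x\<in>{0..<q}. Q x) + 4"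
    unfolding diff sum.distrib sum_distrib_left[symmetric] using linear by simp
  moreover have "Q x \<ge> 0" for x
    unfolding Q_def using l_values[of a1 x] l_values[of a2 x] l_values[of a3 x] by auto
  hence "(\<Sum>x\<in>{0..<q}. Q x) \<ge> 0" by (intro sum_nonneg) auto
  ultimately have "(\<Sum>x\<in>{0..<q}. P x) \<noteq> 0" by linarith
  then obtain x where "P x \<noteq> 0" by (metis sum.neutral)
  hence "l a1 x \<noteq> 1" "l a2 x \<noteq> -1" "l a3 x \<noteq> 1" unfolding P_def by auto
  thus ?thesis using that[of x] assms(3-5) by (simp add: mult l_def)
qed

end

subsection \<open>Squares modulo prime powers\<close>

text \<open>The modulus \<open>4 q\<close> lets Newton's method with step \<open>2 q\<^sup>N s\<close> treat \<open>q = 2\<close> and odd \<open>q\<close> alike.\<close>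
lemma hensel_square:
  fixes q :: int
  assumes "prime q" "\<not> q dvd d" "\<not> q dvd u0" "[d * u0^2 = w] (mod 4 * q)"
  obtains u where "\<not> q dvd u" "[d * u^2 = w] (mod q^N)"
proof -
  have "\<exists>u. \<not> q dvd u \<and> [d * u^2 = w] (mod 4 * q^Suc N)"
  proof (induction N)
    case 0
    thus ?case using assms by auto
  next
    case (Suc N)
    then obtain u where u: "\<not> q dvd u" "[d * u^2 = w] (mod 4 * q^Suc N)" by blast
    then obtain k where k: "w = d * u^2 + 4 * q^Suc N * k" using cong_iff_lin by blast
    have "coprime (d * u) q"
      using assms(1,2) u(1) by (intro prime_imp_coprime_left) (simp_all add: prime_dvd_mult_iff)
    then obtain s' where "[d * u * s' = 1] (mod q)" using cong_solve_coprime_int by blast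
    hence "[d * u * s' * k = 1 * k] (mod q)" by (rule cong_mult[OF _ cong_refl])
    then obtain l where l: "k = d * u * (s' * k) + q * l" using cong_iff_lin by (metis mult.assoc mult_1)
    define s where "s = s' * k"
    have "w - d * (u + 2 * q^Suc N * s)^2 = 4 * q^Suc N * (k - d * u * s - d * q^Suc N * s^2)"
      unfolding k by (simp add: power2_eq_square algebra_simps)
    also have "k - d * u * s - d * q^Suc N * s^2 = q * (l - d * q^N * s^2)"
      using l by (simp add: s_def algebra_simps)
    finally have "[d * (u + 2 * q^Suc N * s)^2 = w] (mod 4 * q^Suc (Suc N))"
      by (metis cong_iff_dvd_diff cong_sym dvd_triv_left mult.assoc power_Suc2)
    moreover have "\<not> q dvd u + 2 * q^Suc N * s" using u(1) by (simp add: dvd_add_left_iff)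
    ultimately show ?case by blast
  qed
  then obtain u where "\<not> q dvd u" "[d * u^2 = w] (mod 4 * q^Suc N)" by blast
  moreover have "q^N dvd 4 * q^Suc N" by simp
  ultimately show ?thesis using that cong_dvd_modulus by blast
qed

lemma lift_sqrt_2:
  fixes d w :: int
  assumes "odd d" "[d = w] (mod 8)"
  obtains u where "odd u" "[d * u^2 = w] (mod 2^N)"
  using hensel_square[of 2 d 1 w N] assms by auto

context
  fixes q :: int
  assumes prime_q: "prime q" and q_gt_2: "2 < q"
begin

lemma lift_sqrt:
  assumes "Legendre (d * w) q = 1"
  obtains u where "\<not> q dvd u" "[d * u^2 = w] (mod q^N)"
proof -
  have units: "\<not> q dvd d" "\<not> q dvd w" using not_dvd_of_Legendre[of "d * w" q] assms by auto
  note coprime = prime_imp_coprime_left[OF prime_q]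
  obtain y where y: "[y^2 = d * w] (mod q)" using assms by (auto simp: Legendre_eq_1_iff QuadRes_def)
  obtain d' where d': "[d * d' = 1] (mod q)" using cong_solve_coprime_int[OF coprime[OF units(1)]] by blast
  have "[d * (d' * y)^2 = (d * d') * (d' * y^2)] (mod q)" by (simp add: power2_eq_square mult_ac)
  also have "[(d * d') * (d' * y^2) = (d * d') * (d' * (d * w))] (mod q)"
    by (intro cong_mult cong_refl y)
  also have "(d * d') * (d' * (d * w)) = (d * d') * (d * d') * w" by (simp add: mult_ac)
  also have "[\<dots> = 1 * 1 * w] (mod q)" by (intro cong_mult cong_refl d')
  finally have root: "[d * (d' * y)^2 = w] (mod q)" by simp
  hence "\<not> q dvd d' * y" using units(2) cong_dvd_iff[OF root] by (metis dvd_mult dvd_power zero_less_numeral dvd_trans)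
  hence "\<not> q dvd 2 * (d' * y)"
    using not_dvd_one_two(3)[OF prime_q q_gt_2] prime_q by (simp add: prime_dvd_mult_iff)
  moreover have "d * (2 * (d' * y))^2 - 4 * w = 4 * (d * (d' * y)^2 - w)"
    by (simp add: power2_eq_square algebra_simps)
  hence "[d * (2 * (d' * y))^2 = 4 * w] (mod 4 * q)"
    using root mult_dvd_mono[OF dvd_refl[of 4]] by (simp only: cong_iff_dvd_diff)
  ultimately obtain v where v: "\<not> q dvd v" "[d * v^2 = 4 * w] (mod q^N)"
    using hensel_square[OF prime_q units(1)] by blast
  have "coprime 2 (q^Suc N)" using coprime[OF not_dvd_one_two(3)[OF prime_q q_gt_2]] by simp
  then obtain h where h: "[2 * h = 1] (mod q^Suc N)" using cong_solve_coprime_int by blast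
  have "\<not> q dvd h" using cong_dvd_modulus[OF h, of q] not_dvd_one_two(1)[OF prime_q q_gt_2]
    by (metis cong_dvd_iff dvd_mult dvd_triv_left power_Suc)
  hence "\<not> q dvd h * v" using v(1) prime_q by (simp add: prime_dvd_mult_iff)
  moreover have "[d * (h * v)^2 = w] (mod q^N)"
  proof -
    have "[(d * v^2) * h^2 = (4 * w) * h^2] (mod q^N)" by (rule cong_mult[OF v(2) cong_refl])
    also have "(4 * w) * h^2 = w * (2 * h)^2" by (simp add: power2_eq_square)
    also have "[\<dots> = w * 1^2] (mod q^N)"
      using cong_dvd_modulus[OF h, of "q^N"] by (intro cong_mult cong_pow cong_refl) simp
    finally show ?thesis by (simp add: power_mult_distrib mult_ac)
  qed
  ultimately show ?thesis by (rule that)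
qed

lemma unit_represented_by_binary_form:
  assumes "\<not> q dvd a" "\<not> q dvd b" "\<not> q dvd c"
  obtains x y where "[a * x^2 + b * y^2 = c] (mod q^N)"
proof -
  have lift: "\<exists>u. [a * u^2 + b * y^2 = c] (mod q^N)"
    if "[a * x^2 + b * y^2 = c] (mod q)" "\<not> q dvd a" "\<not> q dvd x" for a b x y
  proof -
    have "[a * x^2 = c - b * y^2] (mod q)" using that(1) by (simp add: cong_iff_dvd_diff algebra_simps)
    hence "Legendre (a * (c - b * y^2)) q = Legendre ((a * x)^2) q"
      by (intro Legendre_cong) (simp add: power2_eq_square mult_ac cong_sym_eq cong_mult)
    also have "\<dots> = 1" using that(2,3) prime_q by (intro Legendre_square) (simp_all add: prime_dvd_mult_iff)
    finally obtain u where "[a * u^2 = c - b * y^2] (mod q^N)" by (rule lift_sqrt)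
    hence "[a * u^2 + b * y^2 = c] (mod q^N)" by (simp add: cong_iff_dvd_diff algebra_simps)
    thus ?thesis ..
  qed
  obtain x y where xy: "[a * x^2 + b * y^2 = c] (mod q)"
    using binary_form_surj_mod[OF prime_q q_gt_2 assms(1,2)] .
  hence "\<not> q dvd x \<or> \<not> q dvd y"
    using assms(3) cong_dvd_iff[OF xy] by (metis dvd_add dvd_mult dvd_mult2 power2_eq_square)
  thus ?thesis using lift[OF xy assms(1)] lift[of b y a x] xy assms(2) that by (metis add.commute)
qed

end

subsection \<open>Hilbert symbols and conics at odd primes\<close>

definition unit_part :: "int \<Rightarrow> int \<Rightarrow> int" where
  "unit_part q a = a div q ^ multiplicity q a"

text \<open>Correct for odd \<open>q\<close> and nonzero arguments only.\<close>
definition hilbert :: "int \<Rightarrow> int \<Rightarrow> int \<Rightarrow> int" where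
  "hilbert q a b = Legendre (-1) q ^ (multiplicity q a * multiplicity q b) *
     Legendre (unit_part q a) q ^ multiplicity q b * Legendre (unit_part q b) q ^ multiplicity q a"

lemma prime_multiplicity_mult:
  "prime (q::int) \<Longrightarrow> a \<noteq> 0 \<Longrightarrow> b \<noteq> 0 \<Longrightarrow> multiplicity q (a * b) = multiplicity q a + multiplicity q b"
  by (rule prime_elem_multiplicity_mult_distrib[OF prime_imp_prime_elem])

lemma prime_multiplicity_self: "prime (q::int) \<Longrightarrow> multiplicity q q = 1"
  by (rule multiplicity_prime[OF prime_imp_prime_elem])

lemma not_dvd_unit_part: "prime q \<Longrightarrow> a \<noteq> 0 \<Longrightarrow> \<not> q dvd unit_part q a"
  unfolding unit_part_def using not_prime_unit by (intro multiplicity_decompose) blast+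

lemma unit_part_mult:
  assumes "prime q" "a \<noteq> 0" "b \<noteq> 0"
  shows "unit_part q (a * b) = unit_part q a * unit_part q b"
  unfolding unit_part_def prime_multiplicity_mult[OF assms] power_add
  by (simp add: div_mult_div_if_dvd multiplicity_dvd)

lemma unit_part_of_not_dvd: "\<not> q dvd a \<Longrightarrow> unit_part q a = a"
  by (simp add: unit_part_def not_dvd_imp_multiplicity_0)

lemma unit_part_self: "prime q \<Longrightarrow> unit_part q q = 1"
  by (simp add: unit_part_def prime_multiplicity_self)

lemma hilbert_commute: "hilbert q a b = hilbert q b a"
  by (simp add: hilbert_def mult_ac)

lemma hilbert_unit_right:
  "\<not> q dvd u \<Longrightarrow> hilbert q a u = Legendre u q ^ multiplicity q a"
  by (simp add: hilbert_def unit_part_of_not_dvd not_dvd_imp_multiplicity_0)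

lemma hilbert_units: "\<not> q dvd a \<Longrightarrow> \<not> q dvd b \<Longrightarrow> hilbert q a b = 1"
  by (simp add: hilbert_unit_right not_dvd_imp_multiplicity_0)

context
  fixes q :: int
  assumes prime_q: "prime q" and q_gt_2: "2 < q"
begin

lemma hilbert_mult_left:
  assumes "a \<noteq> 0" "a' \<noteq> 0"
  shows "hilbert q (a * a') b = hilbert q a b * hilbert q a' b"
  using prime_q assms unfolding hilbert_def
  by (simp add: unit_part_mult Legendre_mult[OF prime_q q_gt_2] prime_multiplicity_mult
      power_add power_mult_distrib algebra_simps)

lemma hilbert_mult_right:
  assumes "b \<noteq> 0" "b' \<noteq> 0"
  shows "hilbert q a (b * b') = hilbert q a b * hilbert q a b'"
  using hilbert_mult_left[OF assms] by (simp add: hilbert_commute[of q a])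

lemma hilbert_values:
  assumes "a \<noteq> 0" "b \<noteq> 0"
  shows "hilbert q a b = 1 \<or> hilbert q a b = -1"
proof -
  have "\<bar>Legendre u q\<bar> = 1" if "\<not> q dvd u" for u using Legendre_of_not_dvd[OF that] by auto
  hence "\<bar>hilbert q a b\<bar> = 1"
    using not_dvd_unit_part[OF prime_q] not_dvd_one_two[OF prime_q q_gt_2] assms
    by (simp add: hilbert_def abs_mult power_abs)
  thus ?thesis by linarith
qed

lemma hilbert_mult_self: "a \<noteq> 0 \<Longrightarrow> b \<noteq> 0 \<Longrightarrow> hilbert q a b * hilbert q a b = 1"
  using hilbert_values[of a b] by auto

lemma hilbert_mult_square:
  assumes "b \<noteq> 0" "s \<noteq> 0" "a \<noteq> 0"
  shows "hilbert q a (b * s^2) = hilbert q a b"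
  using assms hilbert_mult_self[of a s] by (simp add: hilbert_mult_right power2_eq_square)

lemma hilbert_squarefree_part_left:
  assumes "a \<noteq> 0" "b \<noteq> 0"
  shows "hilbert q (squarefree_part a) b = hilbert q a b"
proof -
  have "hilbert q b (squarefree_part a * square_part a ^ 2) = hilbert q b (squarefree_part a)"
    using assms by (intro hilbert_mult_square) auto
  thus ?thesis by (simp add: squarefree_decompose[symmetric] hilbert_commute)
qed

lemma hilbert_prod_left:
  assumes "finite A" "\<And>j. j \<in> A \<Longrightarrow> f j \<noteq> 0" "b \<noteq> 0"
  shows "hilbert q (\<Prod>j\<in>A. f j) b = (\<Prod>j\<in>A. hilbert q (f j) b)"
  using assms(1,2)
proof (induction A rule: finite_induct)
  case empty
  show ?case using not_dvd_one_two[OF prime_q q_gt_2] Legendre_1[OF prime_q]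
    by (simp add: hilbert_commute[of q 1] hilbert_unit_right)
qed (simp add: hilbert_mult_left)

lemma hilbert_power_left:
  assumes "a \<noteq> 0" "b \<noteq> 0"
  shows "hilbert q (a ^ i) b = hilbert q a b ^ i"
  using hilbert_prod_left[of "{..<i}" "\<lambda>_. a"] assms by simp

lemma hilbert_neg_self:
  assumes "a \<noteq> 0"
  shows "hilbert q a (- a) = 1"
proof -
  define i where "i = multiplicity q a"
  define u where "u = unit_part q a"
  have "unit_part q (- a) = - u" by (simp add: unit_part_def u_def dvd_neg_div multiplicity_dvd)
  hence "hilbert q a (- a) = Legendre (-1) q ^ (i * i + i) * (Legendre u q * Legendre u q) ^ i"
    by (simp add: hilbert_def i_def[symmetric] u_def[symmetric] Legendre_minus[OF prime_q q_gt_2, of u]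
        power_add power_mult_distrib mult_ac)
  also have "Legendre u q * Legendre u q = 1"
    unfolding u_def by (intro Legendre_mult_self prime_q q_gt_2 not_dvd_unit_part assms)
  also have "Legendre (-1) q ^ (i * i + i) = 1"
    using Legendre_of_not_dvd[of q "-1"] not_dvd_one_two[OF prime_q q_gt_2] by auto
  finally show ?thesis by simp
qed

lemma hilbert_prime_prime: "hilbert q q q = Legendre (-1) q"
  using prime_q by (simp add: hilbert_def unit_part_self Legendre_1 prime_multiplicity_self)

end

definition isotropic :: "int \<Rightarrow> int \<Rightarrow> int \<Rightarrow> bool" where
  "isotropic q a b \<longleftrightarrow> (\<forall>N. \<exists>x y z. \<not> (q dvd x \<and> q dvd y \<and> q dvd z) \<and> q^N dvd a * x^2 + b * y^2 - z^2)"

lemma primitive_part_of_list: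
  fixes xs :: "int list"
  assumes "\<not> (\<forall>x\<in>set xs. q^K dvd x)"
  obtains j ys where "j \<le> K" "xs = map ((*) (q^j)) ys" "\<not> (\<forall>y\<in>set ys. q dvd y)"
  using assms
proof (induction K arbitrary: xs thesis)
  case 0
  thus ?case by simp
next
  case (Suc K)
  show ?case
  proof (cases "\<forall>x\<in>set xs. q dvd x")
    case False
    thus ?thesis using Suc.prems(1)[of 0 xs] by simp
  next
    case True
    then obtain zs where zs: "xs = map ((*) q) zs" by (metis dvdE ex_map_conv)
    hence "\<not> (\<forall>z\<in>set zs. q^K dvd z)" using Suc.prems(2) by (auto intro: mult_dvd_mono)
    then obtain j ys where "j \<le> K" "zs = map ((*) (q^j)) ys" "\<not> (\<forall>y\<in>set ys. q dvd y)"
      using Suc.IH by blast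
    thus ?thesis using Suc.prems(1)[of "Suc j" ys] zs by (simp add: mult_ac)
  qed
qed

lemma power_dvd_of_dvd_mult_even_power:
  assumes "prime (q::int)" "j \<le> K" "q ^ (N + 2 * K) dvd (q^j)^2 * c"
  shows "q^N dvd c"
proof -
  have "q ^ (2 * j) * q^N dvd q ^ (N + 2 * K)"
    using assms(2) by (simp add: power_add[symmetric] le_imp_power_dvd)
  hence "q ^ (2 * j) * q^N dvd q ^ (2 * j) * c"
    using assms(3) dvd_trans by (metis power_mult mult.commute)
  thus ?thesis using assms(1) by auto
qed

lemma prime_dvd_of_power_dvd_mult:
  assumes "prime (q::int)" "c \<noteq> 0" "q^K dvd c * u" "multiplicity q c < K"
  shows "q dvd u"
proof (rule ccontr)
  assume "\<not> q dvd u"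
  hence "coprime (q^K) u" using assms(1) by (simp add: prime_imp_coprime)
  hence "q^K dvd c" using assms(3) coprime_dvd_mult_left_iff by blast
  hence "K \<le> multiplicity q c" using assms by (intro multiplicity_geI) (auto simp: not_prime_unit)
  thus False using assms(4) by simp
qed

lemma isotropicI:
  assumes "prime q"
    and "\<And>N. \<exists>x y z. \<not> (q^K dvd x \<and> q^K dvd y \<and> q^K dvd z) \<and> q^N dvd a * x^2 + b * y^2 - z^2"
  shows "isotropic q a b"
  unfolding isotropic_def
proof
  fix N
  obtain x y z where weak: "\<not> (\<forall>v\<in>set [x, y, z]. q^K dvd v)" and sol: "q ^ (N + 2 * K) dvd a * x^2 + b * y^2 - z^2"
    using assms(2)[of "N + 2 * K"] by auto
  from weak obtain j vs where j: "j \<le> K" and vs: "[x, y, z] = map ((*) (q^j)) vs"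
    and prim: "\<not> (\<forall>v\<in>set vs. q dvd v)" by (rule primitive_part_of_list)
  from vs obtain x' y' z' where v: "vs = [x', y', z']" "x = q^j * x'" "y = q^j * y'" "z = q^j * z'"
    by (auto simp: Cons_eq_map_conv)
  have "a * x^2 + b * y^2 - z^2 = (q^j)^2 * (a * x'^2 + b * y'^2 - z'^2)"
    by (simp add: v power_mult_distrib algebra_simps)
  hence "q^N dvd a * x'^2 + b * y'^2 - z'^2"
    using power_dvd_of_dvd_mult_even_power[OF assms(1) j] sol by metis
  thus "\<exists>x y z. \<not> (q dvd x \<and> q dvd y \<and> q dvd z) \<and> q^N dvd a * x^2 + b * y^2 - z^2"
    using prim unfolding v(1) by auto
qed

lemma isotropic_commute: "isotropic q a b \<longleftrightarrow> isotropic q b a"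
  unfolding isotropic_def by (metis add.commute)

lemma isotropic_mult_square:
  assumes "prime q" "s \<noteq> 0"
  shows "isotropic q a (b * s^2) \<longleftrightarrow> isotropic q a b"
proof -
  define K where "K = Suc (multiplicity q s)"
  have cancel: "q dvd v" if "q^K dvd s * v" for v
    by (rule prime_dvd_of_power_dvd_mult[OF assms that]) (simp add: K_def)
  have qK: "q dvd q^K" by (simp add: K_def)
  show ?thesis
  proof
    assume iso: "isotropic q a (b * s^2)"
    show "isotropic q a b"
    proof (rule isotropicI[OF assms(1)])
      fix N
      obtain x y z where "\<not> (q dvd x \<and> q dvd y \<and> q dvd z)" "q^N dvd a * x^2 + b * s^2 * y^2 - z^2"
        using iso unfolding isotropic_def by blast
      moreover from this have "\<not> (q^K dvd x \<and> q^K dvd s * y \<and> q^K dvd z)"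
        using cancel qK dvd_trans by blast
      ultimately show "\<exists>x y z. \<not> (q^K dvd x \<and> q^K dvd y \<and> q^K dvd z) \<and> q^N dvd a * x^2 + b * y^2 - z^2"
        by (metis mult.assoc power_mult_distrib)
    qed
  next
    assume iso: "isotropic q a b"
    show "isotropic q a (b * s^2)"
    proof (rule isotropicI[OF assms(1)])
      fix N
      obtain x y z where xyz: "\<not> (q dvd x \<and> q dvd y \<and> q dvd z)" "q^N dvd a * x^2 + b * y^2 - z^2"
        using iso unfolding isotropic_def by blast
      have "a * (s * x)^2 + b * s^2 * y^2 - (s * z)^2 = s^2 * (a * x^2 + b * y^2 - z^2)"
        by (simp add: power_mult_distrib algebra_simps)
      hence "q^N dvd a * (s * x)^2 + b * s^2 * y^2 - (s * z)^2" using xyz(2) by simp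
      moreover have "\<not> (q^K dvd s * x \<and> q^K dvd y \<and> q^K dvd s * z)"
        using xyz(1) cancel qK dvd_trans by blast
      ultimately show "\<exists>x y z. \<not> (q^K dvd x \<and> q^K dvd y \<and> q^K dvd z) \<and> q^N dvd a * x^2 + b * s^2 * y^2 - z^2"
        by blast
    qed
  qed
qed

context
  fixes q :: int
  assumes prime_q: "prime q" and q_gt_2: "2 < q"
begin

lemma isotropic_units:
  assumes "\<not> q dvd a" "\<not> q dvd b"
  shows "isotropic q a b"
  unfolding isotropic_def
proof
  fix N
  obtain x y where "[a * x^2 + b * y^2 = 1] (mod q^N)"
    by (rule unit_represented_by_binary_form[OF prime_q q_gt_2 assms not_dvd_one_two(1)[OF prime_q q_gt_2]])
  hence "q^N dvd a * x^2 + b * y^2 - 1^2" by (simp add: cong_iff_dvd_diff)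
  thus "\<exists>x y z. \<not> (q dvd x \<and> q dvd y \<and> q dvd z) \<and> q^N dvd a * x^2 + b * y^2 - z^2"
    using not_dvd_one_two(1)[OF prime_q q_gt_2] by blast
qed

lemma isotropic_unit_prime_iff:
  assumes "\<not> q dvd a" "\<not> q dvd b"
  shows "isotropic q a (q * b) \<longleftrightarrow> Legendre a q = 1"
proof
  assume "isotropic q a (q * b)"
  then obtain x y z where prim: "\<not> (q dvd x \<and> q dvd y \<and> q dvd z)"
    and sol: "q^2 dvd a * x^2 + q * b * y^2 - z^2" unfolding isotropic_def by blast
  have "q dvd (a * x^2 + q * b * y^2 - z^2) - q * (b * y^2)"
    using sol by (meson dvd_diff dvd_power dvd_trans dvd_triv_left zero_less_numeral)
  hence mod_q: "q dvd a * x^2 - 1 * z^2" by (simp add: algebra_simps)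
  have "\<not> q dvd x"
  proof
    assume x: "q dvd x"
    hence "q dvd a * x^2" by (simp add: power2_eq_square)
    hence z: "q dvd z" using mod_q prime_q by (metis dvd_diff_right_iff mult_1 prime_dvd_power)
    have "q^2 dvd a * x^2" "q^2 dvd z^2" using x z by simp_all
    hence "q^2 dvd (a * x^2 + q * b * y^2 - z^2) - a * x^2 + z^2"
      by (intro dvd_add[OF dvd_diff[OF sol]])
    also have "(a * x^2 + q * b * y^2 - z^2) - a * x^2 + z^2 = q * (b * y^2)" by simp
    finally have "q * q dvd q * (b * y^2)" by (simp only: power2_eq_square)
    hence "q dvd b * y^2" using prime_q by auto
    thus False using prim x z prime_dvd_mult_square[OF prime_q] assms(2) by blast
  qed
  thus "Legendre a q = 1"
    using Legendre_eq_1_if_dvd_diff_squares[OF prime_q mod_q] assms(1) not_dvd_one_two(1)[OF prime_q q_gt_2]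
    by simp
next
  assume residue: "Legendre a q = 1"
  show "isotropic q a (q * b)"
    unfolding isotropic_def
  proof
    fix N
    obtain z where "[1 * z^2 = a] (mod q^N)" using lift_sqrt[OF prime_q q_gt_2, of 1 a N] residue by auto
    hence "q^N dvd a * 1^2 + q * b * 0^2 - z^2" by (simp add: cong_iff_dvd_diff dvd_diff_commute)
    thus "\<exists>x y z. \<not> (q dvd x \<and> q dvd y \<and> q dvd z) \<and> q^N dvd a * x^2 + q * b * y^2 - z^2"
      using not_dvd_one_two(1)[OF prime_q q_gt_2] by blast
  qed
qed

lemma isotropic_prime_prime_iff:
  assumes "\<not> q dvd a" "\<not> q dvd b"
  shows "isotropic q (q * a) (q * b) \<longleftrightarrow> Legendre (- (a * b)) q = 1"
proof
  assume "isotropic q (q * a) (q * b)"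
  then obtain x y z where prim: "\<not> (q dvd x \<and> q dvd y \<and> q dvd z)"
    and sol: "q^2 dvd q * a * x^2 + q * b * y^2 - z^2" unfolding isotropic_def by blast
  have "q dvd q * (a * x^2 + b * y^2) - (q * a * x^2 + q * b * y^2 - z^2)"
    using sol by (meson dvd_diff dvd_power dvd_trans dvd_triv_left zero_less_numeral)
  hence z: "q dvd z" using prime_q by (simp add: algebra_simps prime_dvd_power_iff)
  hence "q^2 dvd (q * a * x^2 + q * b * y^2 - z^2) + z^2" using sol by (intro dvd_add) simp_all
  hence "q * q dvd q * (a * x^2 - - b * y^2)" by (simp add: power2_eq_square algebra_simps)
  hence mod_q: "q dvd a * x^2 - - b * y^2" using prime_q by auto
  have "\<not> q dvd x"
  proof
    assume x: "q dvd x"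
    hence "q dvd a * x^2" by (simp add: power2_eq_square)
    hence "q dvd - b * y^2" using mod_q dvd_diff_right_iff by blast
    thus False using prim x z prime_dvd_mult_square[OF prime_q] assms(2) by (metis dvd_minus_iff)
  qed
  thus "Legendre (- (a * b)) q = 1"
    using Legendre_eq_1_if_dvd_diff_squares[OF prime_q mod_q] assms by simp
next
  assume "Legendre (- (a * b)) q = 1"
  hence residue: "Legendre (a * - b) q = 1" by simp
  show "isotropic q (q * a) (q * b)"
    unfolding isotropic_def
  proof
    fix N
    obtain x where "[a * x^2 = - b] (mod q^N)" using lift_sqrt[OF prime_q q_gt_2 residue] by blast
    hence "q^N dvd q * (a * x^2 - - b)" unfolding cong_iff_dvd_diff by (rule dvd_mult)
    hence "q^N dvd q * a * x^2 + q * b * 1^2 - 0^2" by (simp add: algebra_simps)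
    thus "\<exists>x y z. \<not> (q dvd x \<and> q dvd y \<and> q dvd z) \<and> q^N dvd q * a * x^2 + q * b * y^2 - z^2"
      using not_dvd_one_two(1)[OF prime_q q_gt_2] by blast
  qed
qed

lemma isotropic_iff_hilbert_of_squarefree:
  assumes "squarefree a" "squarefree b"
  shows "isotropic q a b \<longleftrightarrow> hilbert q a b = 1"
proof -
  have nz: "a \<noteq> 0" "b \<noteq> 0" "q \<noteq> 0" using assms prime_q by auto
  have unit_or_uniformizer: "\<not> q dvd d \<or> (\<exists>c. d = q * c \<and> \<not> q dvd c)" if d: "squarefree d" for d
  proof -
    have "\<not> q * q dvd d" using d prime_q squarefreeD[of d q] not_prime_unit by (auto simp: power2_eq_square)
    thus ?thesis by (metis dvdE dvd_triv_left mult_dvd_mono dvd_refl)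
  qed
  have unit_prime: "hilbert q u (q * c) = Legendre u q" if "\<not> q dvd u" "\<not> q dvd c" for u c
  proof -
    have "multiplicity q (q * c) = 1"
      using that nz prime_q by (subst prime_multiplicity_mult)
        (auto simp: not_dvd_imp_multiplicity_0 prime_multiplicity_self)
    thus ?thesis using hilbert_unit_right[OF that(1)] by (simp add: hilbert_commute[of q u])
  qed
  consider (none) "\<not> q dvd a" "\<not> q dvd b" | (right) c where "\<not> q dvd a" "b = q * c" "\<not> q dvd c"
    | (left) c where "a = q * c" "\<not> q dvd c" "\<not> q dvd b" | (both) c c' where "a = q * c" "\<not> q dvd c" "b = q * c'" "\<not> q dvd c'"
    using unit_or_uniformizer[OF assms(1)] unit_or_uniformizer[OF assms(2)] by blast
  thus ?thesis
  proof cases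
    case none
    thus ?thesis by (simp add: isotropic_units hilbert_units)
  next
    case right
    thus ?thesis by (simp add: isotropic_unit_prime_iff unit_prime)
  next
    case left
    thus ?thesis by (simp add: isotropic_commute[of q _ b] hilbert_commute[of q _ b] isotropic_unit_prime_iff unit_prime)
  next
    case (both c c')
    have c: "c \<noteq> 0" "c' \<noteq> 0" using both by auto
    have "hilbert q (q * c) (q * c') = Legendre (-1) q * (Legendre c' q * Legendre c q)"
      using both c nz prime_q hilbert_unit_right[of q c' q] hilbert_unit_right[of q c q] hilbert_commute[of q c q]
      by (simp add: hilbert_units prime_multiplicity_self hilbert_mult_left[OF prime_q q_gt_2] hilbert_mult_right[OF prime_q q_gt_2, of q c']
          hilbert_prime_prime[OF prime_q q_gt_2])
    also have "\<dots> = Legendre (- (c * c')) q"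
      using Legendre_mult[OF prime_q q_gt_2] Legendre_minus[OF prime_q q_gt_2, of "c * c'"] by simp
    finally show ?thesis using both by (simp add: isotropic_prime_prime_iff)
  qed
qed

theorem isotropic_iff_hilbert:
  assumes "a \<noteq> 0" "b \<noteq> 0"
  shows "isotropic q a b \<longleftrightarrow> hilbert q a b = 1"
proof -
  define s t where "s = square_part a" and "t = square_part b"
  define a' b' where "a' = squarefree_part a" and "b' = squarefree_part b"
  have ab: "a = a' * s^2" "b = b' * t^2"
    unfolding s_def t_def a'_def b'_def by (rule squarefree_decompose)+
  have nz: "a' \<noteq> 0" "b' \<noteq> 0" "s \<noteq> 0" "t \<noteq> 0" using ab assms by auto
  have "isotropic q a b \<longleftrightarrow> isotropic q b' a'"
    unfolding ab using nz prime_q isotropic_commute by (simp add: isotropic_mult_square)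
  moreover have "hilbert q a b = hilbert q b' a'"
    unfolding ab using nz hilbert_commute[of q _ a'] hilbert_commute[of q "a' * s^2"]
    by (simp add: hilbert_mult_square[OF prime_q q_gt_2])
  ultimately show ?thesis by (simp add: isotropic_iff_hilbert_of_squarefree a'_def b'_def)
qed

end

subsection \<open>The product formula\<close>

definition chi4 :: "int \<Rightarrow> int" where
  "chi4 u = (if u mod 4 = 1 then 1 else -1)"

definition chi8 :: "int \<Rightarrow> int" where
  "chi8 u = (if u mod 8 = 1 \<or> u mod 8 = 7 then 1 else -1)"

definition hilbert_inf :: "int \<Rightarrow> int \<Rightarrow> int" where
  "hilbert_inf a b = (if a < 0 \<and> b < 0 then -1 else 1)"

definition hilbert_2 :: "int \<Rightarrow> int \<Rightarrow> int" where
  "hilbert_2 a b = hilbert_inf (chi4 (unit_part 2 a)) (chi4 (unit_part 2 b)) *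
     chi8 (unit_part 2 a) ^ multiplicity 2 b * chi8 (unit_part 2 b) ^ multiplicity 2 a"

lemma chi4_values: "chi4 a = 1 \<or> chi4 a = -1"
  by (simp add: chi4_def)

lemma chi8_mult_self: "chi8 a * chi8 a = 1"
  by (simp add: chi8_def)

lemma odd_mod_4: "odd (a::int) \<Longrightarrow> a mod 4 = 1 \<or> a mod 4 = 3"
  by presburger

lemma odd_mod_8: "odd (a::int) \<Longrightarrow> a mod 8 = 1 \<or> a mod 8 = 3 \<or> a mod 8 = 5 \<or> a mod 8 = 7"
  by presburger

lemma eq_if_abs_eq_mod_4:
  fixes x y :: int
  assumes "\<bar>x\<bar> = \<bar>y\<bar>" "x mod 4 = 1" "y mod 4 = 1"
  shows "x = y"
proof (rule ccontr)
  assume "x \<noteq> y"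
  hence "x = - y" using assms(1) by (simp add: abs_eq_iff)
  thus False using assms(2,3) by presburger
qed

lemma chi4_mult: "odd a \<Longrightarrow> odd b \<Longrightarrow> chi4 (a * b) = chi4 a * chi4 b"
  using odd_mod_4[of a] odd_mod_4[of b] mod_mult_eq[of a 4 b] by (auto simp: chi4_def)

lemma chi8_mult:
  assumes "odd a" "odd b"
  shows "chi8 (a * b) = chi8 a * chi8 b"
  using odd_mod_8[OF assms(1)] odd_mod_8[OF assms(2)] mod_mult_eq[of a 8 b]
  by (elim disjE) (simp_all add: chi8_def)

lemma hilbert_inf_commute: "hilbert_inf a b = hilbert_inf b a"
  by (simp add: hilbert_inf_def)

lemma hilbert_inf_mult_left:
  "a \<noteq> 0 \<Longrightarrow> a' \<noteq> 0 \<Longrightarrow> hilbert_inf (a * a') b = hilbert_inf a b * hilbert_inf a' b"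
  by (auto simp: hilbert_inf_def mult_less_0_iff)

lemma hilbert_2_commute: "hilbert_2 a b = hilbert_2 b a"
  by (simp add: hilbert_2_def hilbert_inf_commute mult_ac)

lemma odd_unit_part_2: "a \<noteq> 0 \<Longrightarrow> odd (unit_part 2 a)"
  by (rule not_dvd_unit_part) simp_all

lemma hilbert_2_mult_left:
  assumes "a \<noteq> 0" "a' \<noteq> 0"
  shows "hilbert_2 (a * a') b = hilbert_2 a b * hilbert_2 a' b"
proof -
  have nz: "chi4 u \<noteq> 0" for u using chi4_values[of u] by auto
  have "unit_part 2 (a * a') = unit_part 2 a * unit_part 2 a'"
    "multiplicity 2 (a * a') = multiplicity 2 a + multiplicity 2 a'"
    using assms by (simp_all add: unit_part_mult prime_multiplicity_mult)
  thus ?thesis using odd_unit_part_2[OF assms(1)] odd_unit_part_2[OF assms(2)] nz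
    by (simp add: hilbert_2_def chi4_mult chi8_mult hilbert_inf_mult_left power_add power_mult_distrib mult_ac)
qed

lemma hilbert_2_odd: "odd a \<Longrightarrow> odd b \<Longrightarrow> hilbert_2 a b = hilbert_inf (chi4 a) (chi4 b)"
  by (simp add: hilbert_2_def unit_part_of_not_dvd not_dvd_imp_multiplicity_0)

lemma hilbert_2_double_odd:
  assumes "odd a" "odd b"
  shows "hilbert_2 a (2 * b) = hilbert_inf (chi4 a) (chi4 b) * chi8 a"
proof -
  have "b \<noteq> 0" using assms(2) by auto
  hence "unit_part 2 (2 * b) = b" "multiplicity 2 (2 * b) = 1"
    using assms(2) by (simp_all add: unit_part_mult unit_part_self prime_multiplicity_mult
        unit_part_of_not_dvd not_dvd_imp_multiplicity_0 prime_multiplicity_self)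
  thus ?thesis using assms(1)
    by (simp add: hilbert_2_def unit_part_of_not_dvd not_dvd_imp_multiplicity_0)
qed

lemma hilbert_2_neg_self:
  assumes "a \<noteq> 0"
  shows "hilbert_2 a (- a) = 1"
proof -
  define u where "u = unit_part 2 a"
  have odd: "odd u" unfolding u_def using assms by (rule odd_unit_part_2)
  have neg: "unit_part 2 (- a) = - u" by (simp add: unit_part_def u_def dvd_neg_div multiplicity_dvd)
  have "chi8 (- u) = chi8 u" using chi8_mult[of "-1" u] odd by (simp add: chi8_def)
  moreover have "chi4 (- u) = - chi4 u" using chi4_mult[of "-1" u] odd by (simp add: chi4_def)
  ultimately show ?thesis using chi4_values[of u] chi8_mult_self[of u]
    by (auto simp: hilbert_2_def neg u_def[symmetric] hilbert_inf_def power_mult_distrib[symmetric])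
qed

lemma minus_one_power_half_eq_chi4:
  assumes "odd r"
  shows "(-1::int) ^ ((r - 1) div 2) = chi4 (int r)"
proof (cases "int r mod 4 = 1")
  case True
  hence "even ((r - 1) div 2)" by presburger
  thus ?thesis using True by (simp add: chi4_def)
next
  case False
  hence "odd ((r - 1) div 2)" using assms by presburger
  thus ?thesis using False by (simp add: chi4_def)
qed

context
  fixes q :: int
  assumes prime_q: "prime q" and q_gt_2: "2 < q"
begin

lemma Legendre_minus_one: "Legendre (-1) q = chi4 q"
proof -
  obtain r where r: "q = int r" "prime r" "2 < r" "odd r" by (rule odd_prime_int_natE[OF prime_q q_gt_2])
  have "[Legendre (-1) q = chi4 q] (mod q)"
    using euler_criterion[OF r(2,3), of "-1"] minus_one_power_half_eq_chi4[OF r(4)] r(1) by simp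
  thus ?thesis
    using eq_if_cong_pm_one[OF prime_q q_gt_2 Legendre_of_not_dvd chi4_values] not_dvd_one_two[OF prime_q q_gt_2]
    by blast
qed

text \<open>Gauss's lemma counts the even numbers above \<open>(q - 1) / 2\<close>.\<close>
lemma Legendre_two: "Legendre 2 q = chi8 q"
proof -
  obtain r where r: "q = int r" "prime r" "2 < r" by (rule odd_prime_int_natE[OF prime_q q_gt_2])
  interpret GAUSS r 2
    using r not_dvd_one_two(3)[OF prime_q q_gt_2] by unfold_locales (auto simp: cong_0_iff)
  define h where "h = (q - 1) div 2"
  have q: "q = 2 * h + 1" using odd_prime_int[OF prime_q q_gt_2] unfolding h_def by presburger
  have "C = (\<lambda>x. x * 2) ` {0<..h}"
    unfolding C_def B_def A_def image_image r(1)[symmetric] h_def[symmetric]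
    by (rule image_cong) (use q in auto)
  moreover have "h < x * 2 \<longleftrightarrow> h div 2 < x" for x by linarith
  ultimately have "E = (\<lambda>x. x * 2) ` {h div 2 <.. h}"
    unfolding E_def r(1)[symmetric] h_def[symmetric] using q q_gt_2 by (auto simp: image_iff)
  hence "card E = card {h div 2 <.. h}" by (simp add: card_image inj_on_def)
  hence "Legendre 2 q = (-1) ^ nat (h - h div 2)" using gauss_lemma r by simp
  moreover have "even (nat (h - h div 2)) \<longleftrightarrow> even (h - h div 2)"
    using q q_gt_2 by (intro even_nat_iff) simp
  moreover have "q mod 8 = 1 \<or> q mod 8 = 7 \<longleftrightarrow> even (h - h div 2)" using q by presburger
  ultimately show ?thesis unfolding chi8_def by auto
qed

lemma Legendre_chi4_self: "Legendre (chi4 q) q = Legendre (-1) q"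
  using Legendre_minus_one Legendre_1[OF prime_q] chi4_values[of q] by auto

end

lemma quadratic_reciprocity_hilbert_inf:
  assumes "prime p" "2 < p" "prime q" "2 < q" "p \<noteq> q"
  shows "Legendre p q * Legendre q p = hilbert_inf (chi4 p) (chi4 q)"
proof -
  have "Legendre p q * Legendre q p = (-1) ^ (nat ((p - 1) div 2 * ((q - 1) div 2)))"
    using assms by (intro Quadratic_Reciprocity_int) auto
  moreover have "even (nat ((p - 1) div 2 * ((q - 1) div 2))) \<longleftrightarrow> even ((p - 1) div 2) \<or> even ((q - 1) div 2)"
    using assms by (subst even_nat_iff) auto
  moreover have "even ((p - 1) div 2) \<longleftrightarrow> chi4 p = 1" "even ((q - 1) div 2) \<longleftrightarrow> chi4 q = 1"
    using odd_prime_int[OF assms(1,2)] odd_prime_int[OF assms(3,4)] unfolding chi4_def by (auto; presburger)+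
  ultimately show ?thesis using chi4_values[of p] chi4_values[of q] by (auto simp: hilbert_inf_def)
qed

lemma Legendre_star_reciprocity:
  assumes "prime p" "2 < p" "prime q" "2 < q" "p \<noteq> q"
  shows "Legendre (chi4 p * p) q = Legendre q p"
proof -
  have "\<not> q dvd p" using assms primes_dvd_imp_eq by blast
  have "Legendre (chi4 p) q = hilbert_inf (chi4 p) (chi4 q)"
    using chi4_values[of p] chi4_values[of q] Legendre_1[OF assms(3)] Legendre_minus_one[OF assms(3,4)]
    by (auto simp: hilbert_inf_def)
  hence "Legendre (chi4 p * p) q = Legendre p q * Legendre q p * Legendre p q"
    using quadratic_reciprocity_hilbert_inf[OF assms] Legendre_mult[OF assms(3,4)] by simp
  thus ?thesis using Legendre_of_not_dvd[OF \<open>\<not> q dvd p\<close>] by auto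
qed

lemma multiplicative_eq_1:
  fixes f :: "int \<Rightarrow> int"
  assumes mult: "\<And>x y. x \<noteq> 0 \<Longrightarrow> y \<noteq> 0 \<Longrightarrow> f (x * y) = f x * f y"
    and minus_one: "f (-1) = 1" and primes: "\<And>p. prime p \<Longrightarrow> p dvd a \<Longrightarrow> f p = 1" and "a \<noteq> 0"
  shows "f a = 1"
  using primes \<open>a \<noteq> 0\<close>
proof (induction a rule: prime_divisors_induct)
  case (unit x)
  hence "x = 1 \<or> x = -1" by (auto simp: abs_if split: if_splits)
  thus ?case using mult[of "-1" "-1"] minus_one by auto
next
  case (factor p x)
  hence "f p = 1" "f x = 1" by auto
  thus ?case using mult[of p x] factor.prems(2) by simp
qed simp

text \<open>The product runs over a fixed set of odd primes so that it is bilinear.\<close>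
definition hilbert_prod :: "int set \<Rightarrow> int \<Rightarrow> int \<Rightarrow> int" where
  "hilbert_prod S a b = (\<Prod>q\<in>S. hilbert q a b) * hilbert_2 a b * hilbert_inf a b"

lemma hilbert_prod_commute: "hilbert_prod S a b = hilbert_prod S b a"
  by (simp add: hilbert_prod_def hilbert_commute hilbert_2_commute hilbert_inf_commute)

context
  fixes S :: "int set"
  assumes finite_S: "finite S" and odd_primes: "\<And>q. q \<in> S \<Longrightarrow> prime q \<and> 2 < q"
begin

lemma hilbert_prod_mult_left:
  assumes "a \<noteq> 0" "a' \<noteq> 0"
  shows "hilbert_prod S (a * a') b = hilbert_prod S a b * hilbert_prod S a' b"
proof -
  have "(\<Prod>q\<in>S. hilbert q (a * a') b) = (\<Prod>q\<in>S. hilbert q a b) * (\<Prod>q\<in>S. hilbert q a' b)"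
    unfolding prod.distrib[symmetric] using odd_primes assms by (intro prod.cong refl hilbert_mult_left) auto
  thus ?thesis
    by (simp add: hilbert_prod_def hilbert_2_mult_left[OF assms] hilbert_inf_mult_left[OF assms] mult_ac)
qed

lemma hilbert_prod_neg_self: "a \<noteq> 0 \<Longrightarrow> hilbert_prod S a (- a) = 1"
  using odd_primes hilbert_neg_self
  by (simp add: hilbert_prod_def hilbert_2_neg_self hilbert_inf_def cong: prod.cong)

lemma hilbert_prod_self: "a \<noteq> 0 \<Longrightarrow> hilbert_prod S a a = hilbert_prod S (-1) a"
  using hilbert_prod_mult_left[of "-1" "- a" a] hilbert_prod_neg_self[of a] hilbert_prod_commute[of S a "- a"]
  by simp

lemma prod_hilbert_unit_prime:
  assumes "p \<in> S" "\<And>q. q \<in> S \<Longrightarrow> \<not> q dvd u"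
  shows "(\<Prod>q\<in>S. hilbert q u p) = Legendre u p"
proof -
  have "hilbert q u p = 1" if "q \<in> S - {p}" for q
    using that assms odd_primes primes_dvd_imp_eq by (intro hilbert_units) blast+
  moreover have "hilbert p u p = Legendre u p"
    using hilbert_unit_right[of p u p] assms odd_primes
    by (simp add: hilbert_commute[of p u] prime_multiplicity_self)
  ultimately show ?thesis using prod.remove[OF finite_S assms(1), of "\<lambda>q. hilbert q u p"] by simp
qed

lemma prod_hilbert_units:
  assumes "\<And>q. q \<in> S \<Longrightarrow> \<not> q dvd a \<and> \<not> q dvd b"
  shows "(\<Prod>q\<in>S. hilbert q a b) = 1"
  using assms by (intro prod.neutral ballI hilbert_units) auto

lemma not_dvd_one_two_in_S: "q \<in> S \<Longrightarrow> \<not> q dvd 1 \<and> \<not> q dvd -1 \<and> \<not> q dvd 2"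
  using odd_primes not_dvd_one_two[of q] by blast

lemma hilbert_prod_minus_one_minus_one: "hilbert_prod S (-1) (-1) = 1"
  using prod_hilbert_units[of "-1" "-1"] not_dvd_one_two_in_S
  by (simp add: hilbert_prod_def hilbert_2_odd hilbert_inf_def chi4_def)

lemma hilbert_prod_minus_one_two: "hilbert_prod S (-1) 2 = 1"
  using prod_hilbert_units[of "-1" 2] not_dvd_one_two_in_S hilbert_2_double_odd[of "-1" 1]
  by (simp add: hilbert_prod_def hilbert_inf_def chi4_def chi8_def)

lemma hilbert_prod_minus_one_prime:
  assumes "p \<in> S"
  shows "hilbert_prod S (-1) p = 1"
proof -
  have p: "prime p" "2 < p" "odd p" using odd_primes assms odd_prime_int by auto
  have "(\<Prod>q\<in>S. hilbert q (-1) p) = chi4 p"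
    using prod_hilbert_unit_prime[OF assms] not_dvd_one_two_in_S Legendre_minus_one p by simp
  thus ?thesis using p chi4_values[of p]
    by (auto simp: hilbert_prod_def hilbert_2_odd hilbert_inf_def chi4_def)
qed

lemma hilbert_prod_two_prime:
  assumes "p \<in> S"
  shows "hilbert_prod S 2 p = 1"
proof -
  have p: "prime p" "2 < p" "odd p" using odd_primes assms odd_prime_int by auto
  have "(\<Prod>q\<in>S. hilbert q 2 p) = chi8 p"
    using prod_hilbert_unit_prime[OF assms] not_dvd_one_two_in_S Legendre_two p by simp
  moreover have "hilbert_2 2 p = chi8 p"
    using hilbert_2_double_odd[OF p(3), of 1] by (simp add: hilbert_2_commute hilbert_inf_def chi4_def)
  ultimately show ?thesis using chi8_mult_self by (simp add: hilbert_prod_def hilbert_inf_def)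
qed

lemma hilbert_prod_distinct_primes:
  assumes "p \<in> S" "l \<in> S" "p \<noteq> l"
  shows "hilbert_prod S p l = 1"
proof -
  have pl: "prime p" "2 < p" "odd p" "prime l" "2 < l" "odd l" using odd_primes assms odd_prime_int by auto
  have not_dvd: "\<not> p dvd l" "\<not> l dvd p" using pl assms(3) primes_dvd_imp_eq by blast+
  have "hilbert q p l = 1" if "q \<in> S - {p, l}" for q
    using that assms odd_primes primes_dvd_imp_eq by (intro hilbert_units) blast+
  hence "(\<Prod>q\<in>S. hilbert q p l) = (\<Prod>q\<in>{p, l}. hilbert q p l)"
    using finite_S assms by (intro prod.mono_neutral_right) auto
  also have "\<dots> = Legendre l p * Legendre p l"
    using not_dvd pl assms(3) hilbert_unit_right[of p l p] hilbert_unit_right[of l p l]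
    by (simp add: hilbert_commute[of l p] prime_multiplicity_self)
  also have "\<dots> = hilbert_inf (chi4 p) (chi4 l)"
    using quadratic_reciprocity_hilbert_inf[of p l] pl assms(3) by (simp add: mult.commute)
  finally show ?thesis using pl by (auto simp: hilbert_prod_def hilbert_2_odd hilbert_inf_def)
qed

lemma hilbert_prod_eq_1:
  assumes "a \<noteq> 0" "b \<noteq> 0" and S: "\<And>q. prime q \<Longrightarrow> 2 < q \<Longrightarrow> q dvd a \<or> q dvd b \<Longrightarrow> q \<in> S"
  shows "hilbert_prod S a b = 1"
proof -
  have two_or_S: "p = 2 \<or> p \<in> S" if "prime p" "p dvd a \<or> p dvd b" for p
    using that S prime_ge_2_int[of p] by (cases "p = 2") auto
  have mult: "hilbert_prod S c (x * y) = hilbert_prod S c x * hilbert_prod S c y" if "x \<noteq> 0" "y \<noteq> 0" for c x y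
    using hilbert_prod_mult_left[OF that] by (simp add: hilbert_prod_commute[of S c])
  have minus_one: "hilbert_prod S (-1) b = 1"
  proof (rule multiplicative_eq_1[OF mult hilbert_prod_minus_one_minus_one _ assms(2)])
    fix p assume "prime p" "p dvd b"
    thus "hilbert_prod S (-1) p = 1"
      using two_or_S hilbert_prod_minus_one_two hilbert_prod_minus_one_prime by blast
  qed
  have prime_right: "hilbert_prod S p b = 1" if p: "prime p" "p dvd a" for p
  proof (rule multiplicative_eq_1[OF mult _ _ assms(2)])
    have p': "p = 2 \<or> p \<in> S" using two_or_S p by blast
    show one: "hilbert_prod S p (-1) = 1"
      using p' hilbert_prod_minus_one_two hilbert_prod_minus_one_prime by (auto simp: hilbert_prod_commute[of S p])
    fix l assume "prime l" "l dvd b"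
    hence l: "l = 2 \<or> l \<in> S" using two_or_S by blast
    show "hilbert_prod S p l = 1"
    proof (cases "l = p")
      case True
      thus ?thesis using one hilbert_prod_self[of p] hilbert_prod_commute[of S p "-1"] p by auto
    next
      case False
      thus ?thesis using p' l hilbert_prod_two_prime hilbert_prod_distinct_primes
        by (metis hilbert_prod_commute)
    qed
  qed
  show ?thesis
    by (rule multiplicative_eq_1[OF hilbert_prod_mult_left minus_one prime_right assms(1)])
qed

end

theorem hilbert_product_formula:
  assumes "a \<noteq> 0" "b \<noteq> 0"
  shows "(\<Prod>q | prime q \<and> 2 < q \<and> q dvd a * b. hilbert q a b) * hilbert_2 a b * hilbert_inf a b = 1"
proof -
  have "finite {q. prime q \<and> 2 < q \<and> q dvd a * b}"
    by (rule finite_subset[OF _ finite_divisors_int[of "a * b"]]) (use assms in auto)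
  hence "hilbert_prod {q. prime q \<and> 2 < q \<and> q dvd a * b} a b = 1"
    by (rule hilbert_prod_eq_1[OF _ _ assms]) auto
  thus ?thesis by (simp only: hilbert_prod_def)
qed

subsection \<open>Square classes of integers\<close>

lemma even_multiplicity_of_square:
  assumes "is_square (x::int)" "prime q"
  shows "even (multiplicity q x)"
proof -
  obtain s where "x = s^2" using assms(1) by (rule is_nth_powerE)
  thus ?thesis using assms(2)
    by (cases "s = 0") (simp_all add: prime_multiplicity_mult power2_eq_square)
qed

lemma squarefree_not_dvd: "squarefree (d::int) \<Longrightarrow> prime q \<Longrightarrow> \<not> q^2 dvd d"
  using squarefreeD not_prime_unit by blast

lemma squarefree_multiplicity:
  assumes "squarefree (d::int)" "prime q"
  shows "multiplicity q d = of_bool (q dvd d)"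
  using squarefree_not_dvd[OF assms]
  by (auto intro!: multiplicity_eqI simp: not_dvd_imp_multiplicity_0 power2_eq_square)

lemma squarefree_dvdI:
  fixes d d' :: int
  assumes "squarefree d" "d' \<noteq> 0" "\<And>q. prime q \<Longrightarrow> q dvd d \<Longrightarrow> q dvd d'"
  shows "d dvd d'"
proof -
  have "multiplicity q d \<le> multiplicity q d'" if q: "prime q" for q
    using squarefree_multiplicity[OF assms(1) q] assms(2,3) q
      prime_multiplicity_gt_zero_iff[OF prime_imp_prime_elem[OF q], of d'] by (auto simp: Suc_le_eq)
  moreover have "d \<noteq> 0" using assms(1) by auto
  ultimately show ?thesis using prime_multiplicity_le_imp_dvd assms(2) by blast
qed

lemma squarefree_eqI:
  fixes d d' :: int
  assumes "squarefree d" "squarefree d'" "d * d' > 0" "\<And>q. prime q \<Longrightarrow> q dvd d \<longleftrightarrow> q dvd d'"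
  shows "d = d'"
proof -
  have "d dvd d'" by (rule squarefree_dvdI[OF assms(1)]) (use assms in auto)
  moreover have "d' dvd d" by (rule squarefree_dvdI[OF assms(2)]) (use assms in auto)
  ultimately have "\<bar>d\<bar> = \<bar>d'\<bar>" by (rule zdvd_antisym_abs)
  thus ?thesis using assms(3) by (auto simp: zero_less_mult_iff abs_if split: if_splits)
qed

lemma squarefree_part_of_squarefree:
  assumes "squarefree (d::int)"
  shows "squarefree_part d = d"
proof -
  have "is_unit (square_part d)" using squarefreeD[OF assms square_part_square_dvd] .
  hence "square_part d ^ 2 = 1" by (metis abs_square_eq_1 zdvd1_eq)
  thus ?thesis using squarefree_decompose[of d] by simp
qed

lemma prime_dvd_squarefree_part_iff:
  "prime (q::int) \<Longrightarrow> q dvd squarefree_part x \<longleftrightarrow> odd (multiplicity q x)"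
  using squarefree_multiplicity[of "squarefree_part x" q] prime_multiplicity_squarefree_part[of q x]
  by (auto simp: odd_iff_mod_2_eq_one split: if_splits)

lemma sgn_squarefree_part:
  assumes "x \<noteq> 0"
  shows "sgn (squarefree_part (x::int)) = sgn x"
proof -
  have "sgn x = sgn (squarefree_part x) * sgn (square_part x ^ 2)"
    by (subst squarefree_decompose) (simp only: sgn_mult)
  moreover have "sgn (square_part x ^ 2) = 1" by (rule sgn_pos) (use assms in simp)
  ultimately show ?thesis by simp
qed

lemma squarefree_part_eq_iff:
  fixes x y :: int
  assumes "x \<noteq> 0" "y \<noteq> 0"
  shows "squarefree_part x = squarefree_part y \<longleftrightarrow> is_square (x * y)"
proof
  assume eq: "squarefree_part x = squarefree_part y"
  have "x * y = squarefree_part x * square_part x ^ 2 * (squarefree_part y * square_part y ^ 2)"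
    using squarefree_decompose[of x] squarefree_decompose[of y] by simp
  also have "\<dots> = (squarefree_part x * square_part x * square_part y) ^ 2"
    unfolding eq by (simp add: power2_eq_square mult_ac)
  finally show "is_square (x * y)" by (rule is_nth_powerI)
next
  assume square: "is_square (x * y)"
  have "q dvd squarefree_part x \<longleftrightarrow> q dvd squarefree_part y" if q: "prime q" for q
    using even_multiplicity_of_square[OF square q] assms
    by (simp add: prime_dvd_squarefree_part_iff[OF q] prime_multiplicity_mult[OF q])
  moreover have "x * y > 0" using square assms by (auto elim!: is_nth_powerE)
  hence "squarefree_part x * squarefree_part y > 0"
    using assms by (simp add: sgn_1_pos[symmetric] sgn_mult sgn_squarefree_part)
  ultimately show "squarefree_part x = squarefree_part y" by (intro squarefree_eqI) auto
qed

lemma squarefree_part_mult_square: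
  fixes x :: int
  assumes "x \<noteq> 0" "s \<noteq> 0"
  shows "squarefree_part (x * s^2) = squarefree_part x"
proof -
  have "x * s^2 * x = (x * s)^2" by (simp add: power2_eq_square mult_ac)
  hence "is_square (x * s^2 * x)" by (rule is_nth_powerI)
  thus ?thesis using assms by (subst squarefree_part_eq_iff) auto
qed

lemma squarefree_part_mult_squarefree_part:
  fixes x y :: int
  assumes "x \<noteq> 0" "y \<noteq> 0"
  shows "squarefree_part (x * squarefree_part y) = squarefree_part (x * y)"
proof -
  have "squarefree_part (x * squarefree_part y) = squarefree_part (x * squarefree_part y * square_part y ^ 2)"
    using assms by (intro squarefree_part_mult_square[symmetric]) auto
  also have "x * squarefree_part y * square_part y ^ 2 = x * y"
    using squarefree_decompose[of y] by (simp add: mult.assoc)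
  finally show ?thesis .
qed

lemma is_square_squarefree_parts_iff:
  fixes x y z :: int
  assumes "x \<noteq> 0" "y \<noteq> 0" "z \<noteq> 0"
  shows "is_square (squarefree_part x * squarefree_part y * squarefree_part z) \<longleftrightarrow> is_square (x * y * z)"
proof -
  have "x * y * z = (squarefree_part x * square_part x ^ 2) * (squarefree_part y * square_part y ^ 2) *
      (squarefree_part z * square_part z ^ 2)"
    by (simp only: squarefree_decompose[symmetric])
  also have "\<dots> = squarefree_part x * squarefree_part y * squarefree_part z *
      (square_part x * square_part y * square_part z) ^ 2"
    by (simp add: power_mult_distrib mult_ac)
  finally have "x * y * z = squarefree_part x * squarefree_part y * squarefree_part z *
      (square_part x * square_part y * square_part z) ^ 2" .
  thus ?thesis using assms by (simp add: is_nth_power_mult_cancel_right)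
qed

lemma prime_dvd_square_product_iff:
  fixes q :: int
  assumes "prime q" "squarefree d1" "squarefree d2" "squarefree d3" "is_square (d1 * d2 * d3)"
  shows "q dvd d1 \<longleftrightarrow> (q dvd d2) \<noteq> (q dvd d3)"
proof -
  have "d1 \<noteq> 0" "d2 \<noteq> 0" "d3 \<noteq> 0" using assms by auto
  hence "multiplicity q (d1 * d2 * d3) = of_bool (q dvd d1) + of_bool (q dvd d2) + of_bool (q dvd d3)"
    using assms by (simp add: prime_multiplicity_mult squarefree_multiplicity)
  thus ?thesis using even_multiplicity_of_square[OF assms(5,1)] by (auto split: if_splits)
qed

lemma is_square_mult_coprimeD:
  fixes a b :: int
  assumes "coprime a b" "is_square (a * b)" "a \<noteq> 0" "b > 0"
  shows "is_square b"
proof -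
  have "even (multiplicity q b)" if q: "prime q" for q
  proof (cases "q dvd b")
    case True
    hence "\<not> q dvd a" using assms(1) q by (metis coprime_common_divisor not_prime_unit)
    hence "multiplicity q (a * b) = multiplicity q b"
      using assms(3,4) q by (simp add: prime_multiplicity_mult not_dvd_imp_multiplicity_0)
    thus ?thesis using even_multiplicity_of_square[OF assms(2) q] by simp
  qed (simp add: not_dvd_imp_multiplicity_0)
  hence "is_square (normalize b)" by (subst is_nth_power_conv_multiplicity) auto
  thus ?thesis using assms(4) by simp
qed

lemma squarefree_split_gcd:
  fixes d m :: int
  assumes "squarefree d" "m \<noteq> 0"
  obtains g c where "d = g * c" "g > 0" "g dvd m" "coprime c m"
proof -
  have "d \<noteq> 0" using assms(1) by auto
  obtain c where c: "d = gcd d m * c" by (rule dvdE[OF gcd_dvd1])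
  have "coprime c m"
  proof (rule ccontr)
    assume "\<not> coprime c m"
    then obtain x where x: "x dvd c" "x dvd m" "\<not> is_unit x" by (rule not_coprimeE)
    hence "x \<noteq> 0" using assms(2) by auto
    then obtain r where "prime r" "r dvd x" using x(3) by (auto elim: prime_divisorE)
    hence r: "prime r" "r dvd c" "r dvd m" using x dvd_trans by blast+
    hence "r dvd gcd d m" using c by (metis dvd_mult gcd_greatest)
    hence "r * r dvd d" using r(2) c by (metis mult_dvd_mono)
    thus False using squarefree_not_dvd[OF assms(1) r(1)] by (simp add: power2_eq_square)
  qed
  moreover have "gcd d m > 0" using assms(2) by (simp add: gcd_pos_int)
  ultimately show ?thesis using that[OF c] by simp
qed

lemma squarefree_part_dvd_mult:
  fixes a b m :: int
  assumes "a dvd m" "b dvd m" "a \<noteq> 0" "b \<noteq> 0" "m \<noteq> 0"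
  shows "squarefree_part (a * b) dvd m"
proof (rule squarefree_dvdI)
  show "squarefree (squarefree_part (a * b))" by (simp add: assms)
  show "q dvd m" if q: "prime q" "q dvd squarefree_part (a * b)" for q
  proof -
    have "odd (multiplicity q (a * b))" using q by (simp add: prime_dvd_squarefree_part_iff)
    hence "q dvd a * b" by (metis even_zero not_dvd_imp_multiplicity_0)
    hence "q dvd a \<or> q dvd b" using q(1) by (simp add: prime_dvd_mult_iff)
    thus ?thesis using assms(1,2) dvd_trans by blast
  qed
qed (rule assms)

lemma squarefree_triple_split_gcd:
  fixes d1 d2 d3 m :: int
  assumes d: "squarefree d1" "squarefree d2" "squarefree d3" "is_square (d1 * d2 * d3)" and "odd m"
  obtains g1 g2 g3 c1 c2 c3 where "d1 = g1 * c1" "d2 = g2 * c2" "d3 = g3 * c3"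
    "g1 dvd m" "g2 dvd m" "g3 dvd m" "coprime c1 m" "coprime c2 m" "coprime c3 m"
    "g1 * g3 > 0" "g2 > 0" "g3 mod 4 = 1" "is_square (c1 * c2 * c3)"
proof -
  have "m \<noteq> 0" using assms(5) by auto
  obtain g1 c1 where part1: "d1 = g1 * c1" "g1 > 0" "g1 dvd m" "coprime c1 m"
    using squarefree_split_gcd[OF d(1) \<open>m \<noteq> 0\<close>] .
  obtain g2 c2 where part2: "d2 = g2 * c2" "g2 > 0" "g2 dvd m" "coprime c2 m"
    using squarefree_split_gcd[OF d(2) \<open>m \<noteq> 0\<close>] .
  obtain g3 c3 where part3: "d3 = g3 * c3" "g3 > 0" "g3 dvd m" "coprime c3 m"
    using squarefree_split_gcd[OF d(3) \<open>m \<noteq> 0\<close>] .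
  have "coprime m (c1 * c2 * c3)" using part1(4) part2(4) part3(4) by (simp add: coprime_commute)
  hence "coprime g (c1 * c2 * c3)" if "g dvd m" for g using coprime_divisors[OF that dvd_refl] by blast
  hence coprime: "coprime (g1 * g2 * g3) (c1 * c2 * c3)"
    unfolding coprime_mult_left_iff[of "g1 * g2"] coprime_mult_left_iff[of g1 g2] using part1(3) part2(3) part3(3) by blast
  have product: "d1 * d2 * d3 = (g1 * g2 * g3) * (c1 * c2 * c3)" unfolding part1(1) part2(1) part3(1) by (simp add: mult_ac)
  have "d1 * d2 * d3 \<noteq> 0" using d(1-3) by auto
  hence "d1 * d2 * d3 > 0" using d(4) by (auto elim!: is_nth_powerE)
  moreover have "g1 * g2 * g3 > 0" using part1(2) part2(2) part3(2) by simp
  ultimately have "g1 * g2 * g3 \<noteq> 0" "c1 * c2 * c3 > 0" unfolding product using zero_less_mult_pos by auto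
  moreover have "is_square ((g1 * g2 * g3) * (c1 * c2 * c3))" using d(4) by (simp only: product)
  ultimately have square: "is_square (c1 * c2 * c3)" by (intro is_square_mult_coprimeD[OF coprime])
  define s where "s = chi4 g3"
  have s: "s = 1 \<or> s = -1" unfolding s_def by (rule chi4_values)
  have "odd g3" using part3(3) assms(5) dvd_trans by blast
  hence "s * g3 mod 4 = 1" using odd_mod_4[of g3] by (auto simp: s_def chi4_def zmod_zminus1_eq_if)
  moreover have "is_square (s * c1 * c2 * (s * c3))" using square s by auto
  moreover have "(s * g1) * (s * g3) > 0" using s part1(2) part3(2) by auto
  ultimately show ?thesis
    using s part1 part2 part3 by (intro that[of "s * g1" "s * c1" g2 c2 "s * g3" "s * c3"]) auto
qed

subsection \<open>Local solubility of the 2-coverings\<close>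

text \<open>Here and below \<open>ai\<close> stands for \<open>ei * m\<close>.\<close>
definition covering_eqs :: "int \<Rightarrow> int \<Rightarrow> int \<Rightarrow> int \<Rightarrow> int \<Rightarrow> int \<Rightarrow> int \<Rightarrow> int \<Rightarrow> int \<Rightarrow> int \<Rightarrow> int \<Rightarrow> bool" where
  "covering_eqs M a1 a2 a3 d1 d2 d3 t u1 u2 u3 \<longleftrightarrow>
     M dvd a1 * t^2 + d2 * u2^2 - d3 * u3^2 \<and>
     M dvd a2 * t^2 + d3 * u3^2 - d1 * u1^2 \<and>
     M dvd a3 * t^2 + d1 * u1^2 - d2 * u2^2"

abbreviation primitive :: "int \<Rightarrow> int \<Rightarrow> int \<Rightarrow> int \<Rightarrow> int \<Rightarrow> bool" where
  "primitive q t u1 u2 u3 \<equiv> \<not> (q dvd t \<and> q dvd u1 \<and> q dvd u2 \<and> q dvd u3)"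

definition locally_soluble :: "int \<Rightarrow> int \<Rightarrow> int \<Rightarrow> int \<Rightarrow> int \<Rightarrow> int \<Rightarrow> int \<Rightarrow> bool" where
  "locally_soluble q a1 a2 a3 d1 d2 d3 \<longleftrightarrow>
     (\<forall>N. \<exists>t u1 u2 u3. primitive q t u1 u2 u3 \<and> covering_eqs (q^N) a1 a2 a3 d1 d2 d3 t u1 u2 u3)"

lemma locally_solubleE:
  assumes "locally_soluble q a1 a2 a3 d1 d2 d3"
  obtains t u1 u2 u3 where "primitive q t u1 u2 u3" "covering_eqs (q^N) a1 a2 a3 d1 d2 d3 t u1 u2 u3"
  using assms unfolding locally_soluble_def by blast

lemma locally_soluble_rotate:
  "locally_soluble q a1 a2 a3 d1 d2 d3 \<Longrightarrow> locally_soluble q a2 a3 a1 d2 d3 d1"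
  unfolding locally_soluble_def covering_eqs_def by blast

lemma locally_soluble_reflect:
  assumes "locally_soluble q a1 a2 a3 d1 d2 d3"
  shows "locally_soluble q (- a1) (- a3) (- a2) d1 d3 d2"
proof -
  have neg: "M dvd - a * t^2 + d * u^2 - c * v^2" if "M dvd a * t^2 + c * v^2 - d * u^2" for M a c d t u v :: int
    using dvd_minus_iff[THEN iffD2, OF that] by (simp add: algebra_simps)
  have "covering_eqs M (- a1) (- a3) (- a2) d1 d3 d2 t u1 u3 u2"
    if "covering_eqs M a1 a2 a3 d1 d2 d3 t u1 u2 u3" for M t u1 u2 u3
    using that neg unfolding covering_eqs_def by blast
  thus ?thesis using assms unfolding locally_soluble_def by blast
qed

lemma covering_eqsI:
  assumes "a1 + a2 + a3 = 0" "[d3 * u3^2 = a1 * t^2 + d2 * u2^2] (mod M)"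
    "[d1 * u1^2 = a2 * t^2 + d3 * u3^2] (mod M)"
  shows "covering_eqs M a1 a2 a3 d1 d2 d3 t u1 u2 u3"
proof -
  have M: "M dvd a1 * t^2 + d2 * u2^2 - d3 * u3^2" "M dvd a2 * t^2 + d3 * u3^2 - d1 * u1^2"
    using assms(2,3) by (metis cong_iff_dvd_diff cong_sym)+
  have a3: "a3 = - a1 - a2" using assms(1) by simp
  have "a3 * t^2 + d1 * u1^2 - d2 * u2^2
      = - ((a1 * t^2 + d2 * u2^2 - d3 * u3^2) + (a2 * t^2 + d3 * u3^2 - d1 * u1^2))"
    unfolding a3 by (simp add: algebra_simps)
  thus ?thesis using M unfolding covering_eqs_def by (metis dvd_add dvd_minus_iff)
qed

lemma covering_eqs_dvd:
  "covering_eqs M a1 a2 a3 d1 d2 d3 t u1 u2 u3 \<Longrightarrow> M' dvd M \<Longrightarrow> covering_eqs M' a1 a2 a3 d1 d2 d3 t u1 u2 u3"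
  unfolding covering_eqs_def using dvd_trans by blast

lemma locally_solubleI:
  assumes "prime q"
    and "\<And>N. \<exists>t u1 u2 u3. primitive (q^K) t u1 u2 u3 \<and> covering_eqs (q^N) a1 a2 a3 d1 d2 d3 t u1 u2 u3"
  shows "locally_soluble q a1 a2 a3 d1 d2 d3"
  unfolding locally_soluble_def
proof
  fix N
  obtain t u1 u2 u3 where weak: "\<not> (\<forall>v\<in>set [t, u1, u2, u3]. (q^K) dvd v)"
    and sol: "covering_eqs (q ^ (N + 2 * K)) a1 a2 a3 d1 d2 d3 t u1 u2 u3"
    using assms(2)[of "N + 2 * K"] by auto
  from weak obtain j vs where j: "j \<le> K" and vs: "[t, u1, u2, u3] = map ((*) (q^j)) vs"
    and prim: "\<not> (\<forall>v\<in>set vs. q dvd v)" by (rule primitive_part_of_list)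
  from vs obtain t' v1 v2 v3 where v: "vs = [t', v1, v2, v3]"
    "t = q^j * t'" "u1 = q^j * v1" "u2 = q^j * v2" "u3 = q^j * v3"
    by (auto simp: Cons_eq_map_conv)
  have cancel: "q^N dvd a * t'^2 + d * v^2 - c * w^2"
    if "q ^ (N + 2 * K) dvd a * (q^j * t')^2 + d * (q^j * v)^2 - c * (q^j * w)^2" for a c d v w
  proof (rule power_dvd_of_dvd_mult_even_power[OF assms(1) j])
    have "a * (q^j * t')^2 + d * (q^j * v)^2 - c * (q^j * w)^2 = (q^j)^2 * (a * t'^2 + d * v^2 - c * w^2)"
      by (simp add: power_mult_distrib algebra_simps)
    thus "q ^ (N + 2 * K) dvd (q^j)^2 * (a * t'^2 + d * v^2 - c * w^2)" using that by simp
  qed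
  have "covering_eqs (q^N) a1 a2 a3 d1 d2 d3 t' v1 v2 v3"
    using sol unfolding covering_eqs_def v(2-5) by (blast intro: cancel)
  thus "\<exists>t u1 u2 u3. primitive q t u1 u2 u3 \<and> covering_eqs (q^N) a1 a2 a3 d1 d2 d3 t u1 u2 u3"
    using prim unfolding v(1) by auto
qed

lemma dvd_add_diff_iff:
  fixes x y z :: "'a::comm_ring_1"
  assumes "M dvd x + y - z"
  shows "M dvd x \<Longrightarrow> M dvd y \<longleftrightarrow> M dvd z" "M dvd y \<Longrightarrow> M dvd x \<longleftrightarrow> M dvd z" "M dvd z \<Longrightarrow> M dvd x \<longleftrightarrow> M dvd y"
  using assms by (metis add_diff_eq dvd_add_right_iff dvd_diff_left_iff dvd_diff_right_iff dvd_add_left_iff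
      add.commute)+

text \<open>Each of the three equations defines a conic with a point.\<close>
lemma hilbert_of_locally_soluble:
  assumes "prime q" "2 < q" "a1 \<noteq> 0" "d1 \<noteq> 0" "d2 \<noteq> 0" "d3 \<noteq> 0" "locally_soluble q a1 a2 a3 d1 d2 d3"
  shows "hilbert q (d2 * d3) (a1 * d3) = 1"
proof -
  define K where "K = Suc (multiplicity q d1 + multiplicity q d3)"
  have "isotropic q (d2 * d3) (a1 * d3)"
  proof (rule isotropicI[OF assms(1)])
    fix N
    obtain t u1 u2 u3 where prim: "primitive q t u1 u2 u3"
      and sol: "covering_eqs (q ^ (N + K)) a1 a2 a3 d1 d2 d3 t u1 u2 u3" by (rule locally_solubleE[OF assms(7)])
    have "q^N dvd q ^ (N + K)" "q^K dvd q ^ (N + K)" by (simp_all add: power_add)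
    note solN = covering_eqs_dvd[OF sol this(1)] and solK = covering_eqs_dvd[OF sol this(2)]
    have "\<not> (q^K dvd u2 \<and> q^K dvd t \<and> q^K dvd d3 * u3)"
    proof
      assume dvd: "q^K dvd u2 \<and> q^K dvd t \<and> q^K dvd d3 * u3"
      hence "q^K dvd a3 * t^2" "q^K dvd d2 * u2^2" by (simp_all add: power2_eq_square)
      hence "q^K dvd d1 * u1^2" using solK dvd_add_diff_iff(3) dvd_add_diff_iff(1) unfolding covering_eqs_def by blast
      hence u1: "q dvd u1^2"
        using assms(1,4) by (intro prime_dvd_of_power_dvd_mult[of q d1 K]) (auto simp: K_def)
      have u3: "q dvd u3"
        using dvd assms(1,6) by (intro prime_dvd_of_power_dvd_mult[of q d3 K]) (auto simp: K_def)
      have "q dvd q^K" by (simp add: K_def)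
      hence "q dvd t" "q dvd u2" using dvd dvd_trans by blast+
      thus False using prim u3 prime_dvd_power[OF assms(1) u1] by blast
    qed
    moreover have "d2 * d3 * u2^2 + a1 * d3 * t^2 - (d3 * u3)^2 = d3 * (a1 * t^2 + d2 * u2^2 - d3 * u3^2)"
      by (simp add: power2_eq_square algebra_simps)
    hence "q^N dvd d2 * d3 * u2^2 + a1 * d3 * t^2 - (d3 * u3)^2"
      using solN unfolding covering_eqs_def by simp
    ultimately show "\<exists>x y z. \<not> (q^K dvd x \<and> q^K dvd y \<and> q^K dvd z) \<and>
      q^N dvd d2 * d3 * x^2 + a1 * d3 * y^2 - z^2" by blast
  qed
  thus ?thesis using assms isotropic_iff_hilbert by simp
qed

text \<open>On the 2-coverings, translation by the 2-torsion point \<open>(0, 0)\<close> permutes the coordinates by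
  \<open>(t u3)(u1 u2)\<close>, up to scaling.\<close>
lemma locally_soluble_translate:
  assumes "prime q" "a1 + a2 + a3 = 0"
    and nz: "d1 \<noteq> 0" "d2 \<noteq> 0" "d3 \<noteq> 0" "s1 \<noteq> 0" "s2 \<noteq> 0" "s3 \<noteq> 0"
    and r: "d1 * d2 * d3 = r^2"
    and l: "a2 * d1 = l1 * s1^2" "- a1 * d2 = l2 * s2^2" "- a1 * a2 * d3 = l3 * s3^2"
    and sol: "locally_soluble q a1 a2 a3 d1 d2 d3"
  shows "locally_soluble q a1 a2 a3 l1 l2 l3"
proof -
  have "r \<noteq> 0" using nz r by auto
  define K where "K = Suc (multiplicity q (d1 * d2 * d3) + multiplicity q (s1 * r * d2) +
    multiplicity q (s2 * r * d1) + multiplicity q (s3 * d1 * d2))"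
  show ?thesis
  proof (rule locally_solubleI[OF assms(1), where K = K])
    fix N
    obtain t u1 u2 u3 where prim: "primitive q t u1 u2 u3"
      and eqs: "covering_eqs (q^N) a1 a2 a3 d1 d2 d3 t u1 u2 u3" by (rule locally_solubleE[OF sol])
    define T U1 U2 U3 where "T = (d1 * d2 * d3) * u3" "U1 = (s1 * r * d2) * u2" "U2 = (s2 * r * d1) * u1"
      "U3 = (s3 * d1 * d2) * t"
    note TU = T_U1_U2_U3_def
    have sq: "l1 * U1^2 = (l1 * s1^2) * r^2 * d2^2 * u2^2" "l2 * U2^2 = (l2 * s2^2) * r^2 * d1^2 * u1^2"
      "l3 * U3^2 = (l3 * s3^2) * d1^2 * d2^2 * t^2" unfolding TU by (simp_all add: power_mult_distrib mult_ac)
    have "a1 * T^2 + l2 * U2^2 - l3 * U3^2 = a1 * d1^2 * d2^2 * d3 * (a2 * t^2 + d3 * u3^2 - d1 * u1^2)"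
      "a2 * T^2 + l3 * U3^2 - l1 * U1^2 = - a2 * d1^2 * d2^2 * d3 * (a1 * t^2 + d2 * u2^2 - d3 * u3^2)"
      unfolding sq l[symmetric] r[symmetric] T_U1_U2_U3_def(1) by (simp_all add: algebra_simps power2_eq_square)
    hence "q^N dvd a1 * T^2 + l2 * U2^2 - l3 * U3^2" "q^N dvd a2 * T^2 + l3 * U3^2 - l1 * U1^2"
      using eqs unfolding covering_eqs_def by (simp_all only: dvd_mult)
    hence "covering_eqs (q^N) a1 a2 a3 l1 l2 l3 T U1 U2 U3"
      by (intro covering_eqsI[OF assms(2)]) (metis cong_iff_dvd_diff cong_sym)+
    moreover have "primitive (q^K) T U1 U2 U3"
    proof
      assume dvd: "q^K dvd T \<and> q^K dvd U1 \<and> q^K dvd U2 \<and> q^K dvd U3"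
      have cancel: "q dvd u" if "q^K dvd c * u" "c \<noteq> 0" "multiplicity q c < K" for c u
        using prime_dvd_of_power_dvd_mult[OF assms(1)] that by blast
      have "q dvd u3" by (rule cancel[of "d1 * d2 * d3"]) (use dvd nz in \<open>simp_all add: TU K_def\<close>)
      moreover have "q dvd u2" by (rule cancel[of "s1 * r * d2"]) (use dvd nz \<open>r \<noteq> 0\<close> in \<open>simp_all add: TU K_def\<close>)
      moreover have "q dvd u1" by (rule cancel[of "s2 * r * d1"]) (use dvd nz \<open>r \<noteq> 0\<close> in \<open>simp_all add: TU K_def\<close>)
      moreover have "q dvd t" by (rule cancel[of "s3 * d1 * d2"]) (use dvd nz in \<open>simp_all add: TU K_def\<close>)
      ultimately show False using prim by blast
    qed
    ultimately show "\<exists>t u1 u2 u3. primitive (q^K) t u1 u2 u3 \<and> covering_eqs (q^N) a1 a2 a3 l1 l2 l3 t u1 u2 u3"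
      by blast
  qed
qed

lemma locally_soluble_translate_squarefree_part:
  assumes "prime q" "a1 + a2 + a3 = 0" "a1 \<noteq> 0" "a2 \<noteq> 0" "d1 \<noteq> 0" "d2 \<noteq> 0" "d3 \<noteq> 0"
    and "is_square (d1 * d2 * d3)" "locally_soluble q a1 a2 a3 d1 d2 d3"
  shows "locally_soluble q a1 a2 a3 (squarefree_part (a2 * d1)) (squarefree_part (- a1 * d2))
    (squarefree_part (- a1 * a2 * d3))"
proof -
  obtain r where r: "d1 * d2 * d3 = r^2" using assms(8) by (rule is_nth_powerE)
  show ?thesis
    by (rule locally_soluble_translate[OF assms(1,2,5-7) _ _ _ r squarefree_decompose squarefree_decompose
          squarefree_decompose assms(9)]) (use assms in simp_all)
qed

lemma locally_soluble_torsion_translate: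
  assumes "prime q" "a + b + c = 0" "a \<noteq> 0" "b \<noteq> 0" "m \<noteq> 0" "d1 \<noteq> 0" "d2 \<noteq> 0" "d3 \<noteq> 0"
    and "is_square (d1 * d2 * d3)" "locally_soluble q (a * m) (b * m) (c * m) d1 d2 d3"
  shows "locally_soluble q (a * m) (b * m) (c * m)
    (squarefree_part (d1 * (b * m))) (squarefree_part (d2 * (- a * m))) (squarefree_part (d3 * (- a * b)))"
proof -
  have "a * m + b * m + c * m = 0" using assms(2) by (metis distrib_right mult_zero_left)
  from locally_soluble_translate_squarefree_part[OF assms(1) this _ _ assms(6-10)]
  have "locally_soluble q (a * m) (b * m) (c * m) (squarefree_part (b * m * d1))
      (squarefree_part (- (a * m) * d2)) (squarefree_part (- (a * m) * (b * m) * d3))"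
    using assms(3-5) by simp
  moreover have "- (a * m) * (b * m) * d3 = d3 * (- a * b) * m^2" by (simp add: power2_eq_square)
  hence "squarefree_part (- (a * m) * (b * m) * d3) = squarefree_part (d3 * (- a * b))"
    using assms by (simp only: squarefree_part_mult_square mult_eq_0_iff neg_equal_0_iff_equal simp_thms)
  moreover have "b * m * d1 = d1 * (b * m)" "- (a * m) * d2 = d2 * (- a * m)" by simp_all
  ultimately show ?thesis by (simp only:)
qed

lemma locally_soluble_torsion_translates:
  assumes "prime q" and e: "e1 + e2 + e3 = 0" "e1 \<noteq> 0" "e2 \<noteq> 0" "e3 \<noteq> 0"
    and nz: "m \<noteq> 0" "d1 \<noteq> 0" "d2 \<noteq> 0" "d3 \<noteq> 0" and square: "is_square (d1 * d2 * d3)"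
    and sol: "locally_soluble q (e1 * m) (e2 * m) (e3 * m) d1 d2 d3"
  shows "locally_soluble q (e1 * m) (e2 * m) (e3 * m)
      (squarefree_part (d1 * (e2 * m))) (squarefree_part (d2 * (- e1 * m))) (squarefree_part (d3 * (- e1 * e2)))"
    and "locally_soluble q (e1 * m) (e2 * m) (e3 * m)
      (squarefree_part (d1 * (- e2 * e3))) (squarefree_part (d2 * (e3 * m))) (squarefree_part (d3 * (- e2 * m)))"
    and "locally_soluble q (e1 * m) (e2 * m) (e3 * m)
      (squarefree_part (d1 * (- e3 * m))) (squarefree_part (d2 * (- e1 * e3))) (squarefree_part (d3 * (e1 * m)))"
proof -
  have sums: "e2 + e3 + e1 = 0" "e3 + e1 + e2 = 0"
    and squares: "is_square (d2 * d3 * d1)" "is_square (d3 * d1 * d2)"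
    using e(1) square by (simp_all add: mult_ac)
  note rotated = locally_soluble_rotate[OF sol] locally_soluble_rotate[OF locally_soluble_rotate[OF sol]]
  show "locally_soluble q (e1 * m) (e2 * m) (e3 * m)
      (squarefree_part (d1 * (e2 * m))) (squarefree_part (d2 * (- e1 * m))) (squarefree_part (d3 * (- e1 * e2)))"
    by (rule locally_soluble_torsion_translate[OF assms(1) e(1-3) nz square sol])
  show "locally_soluble q (e1 * m) (e2 * m) (e3 * m)
      (squarefree_part (d1 * (- e2 * e3))) (squarefree_part (d2 * (e3 * m))) (squarefree_part (d3 * (- e2 * m)))"
    using locally_soluble_torsion_translate[OF assms(1) sums(1) e(3,4) nz(1,3,4,2) squares(1) rotated(1)]
    by (rule locally_soluble_rotate[OF locally_soluble_rotate])
  have "locally_soluble q (e1 * m) (e2 * m) (e3 * m)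
      (squarefree_part (d1 * (- e3 * m))) (squarefree_part (d2 * (- e3 * e1))) (squarefree_part (d3 * (e1 * m)))"
    using locally_soluble_torsion_translate[OF assms(1) sums(2) e(4,2) nz(1,4,2,3) squares(2) rotated(2)]
    by (rule locally_soluble_rotate)
  thus "locally_soluble q (e1 * m) (e2 * m) (e3 * m)
      (squarefree_part (d1 * (- e3 * m))) (squarefree_part (d2 * (- e1 * e3))) (squarefree_part (d3 * (e1 * m)))"
    by (simp only: mult.commute[of "- e3" e1] minus_mult_commute[of e1 e3])
qed

lemma locally_solubleI_x_coordinate:
  assumes "a1 + a2 + a3 = 0" "\<not> (q dvd t \<and> q dvd x)"
    and "\<And>N. \<exists>u. [d1 * u^2 = x + a2 * t^2] (mod q^N)"
    and "\<And>N. \<exists>u. [d2 * u^2 = x - a1 * t^2] (mod q^N)"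
    and "\<And>N. \<exists>u. [d3 * u^2 = x] (mod q^N)"
  shows "locally_soluble q a1 a2 a3 d1 d2 d3"
  unfolding locally_soluble_def
proof
  fix N
  obtain u1 where u1: "[d1 * u1^2 = x + a2 * t^2] (mod q ^ Suc N)" using assms(3) by blast
  obtain u2 where u2: "[d2 * u2^2 = x - a1 * t^2] (mod q ^ Suc N)" using assms(4) by blast
  obtain u3 where u3: "[d3 * u3^2 = x] (mod q ^ Suc N)" using assms(5) by blast
  have "[a1 * t^2 + d2 * u2^2 = a1 * t^2 + (x - a1 * t^2)] (mod q ^ Suc N)" by (rule cong_add[OF cong_refl u2])
  hence "[x = a1 * t^2 + d2 * u2^2] (mod q ^ Suc N)" by (simp add: cong_sym_eq)
  with u3 have "[d3 * u3^2 = a1 * t^2 + d2 * u2^2] (mod q ^ Suc N)" by (rule cong_trans)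
  moreover have "[x + a2 * t^2 = d3 * u3^2 + a2 * t^2] (mod q ^ Suc N)" by (rule cong_add[OF cong_sym[OF u3] cong_refl])
  with u1 have "[d1 * u1^2 = a2 * t^2 + d3 * u3^2] (mod q ^ Suc N)" by (metis cong_trans add.commute)
  ultimately have "covering_eqs (q ^ Suc N) a1 a2 a3 d1 d2 d3 t u1 u2 u3"
    by (rule covering_eqsI[OF assms(1)])
  hence "covering_eqs (q^N) a1 a2 a3 d1 d2 d3 t u1 u2 u3" by (rule covering_eqs_dvd) simp
  moreover have "primitive q t u1 u2 u3"
  proof
    assume dvd: "q dvd t \<and> q dvd u1 \<and> q dvd u2 \<and> q dvd u3"
    have "[d3 * u3^2 = x] (mod q)" using u3 by (rule cong_dvd_modulus) simp
    hence "q dvd x" using dvd cong_dvd_iff by (metis dvd_mult dvd_mult2 power2_eq_square)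
    thus False using assms(2) dvd by blast
  qed
  ultimately show "\<exists>t u1 u2 u3. primitive q t u1 u2 u3 \<and> covering_eqs (q^N) a1 a2 a3 d1 d2 d3 t u1 u2 u3"
    by blast
qed

subsection \<open>Triples of units at an odd prime\<close>

context
  fixes q :: int
  assumes prime_q: "prime q" and q_gt_2: "2 < q"
begin

lemma locally_soluble_of_residues:
  assumes "a1 + a2 + a3 = 0" "Legendre d1 q = 1" "Legendre d2 q = 1" "Legendre d3 q = 1"
  shows "locally_soluble q a1 a2 a3 d1 d2 d3"
proof (rule locally_solubleI_x_coordinate[where t = 0 and x = 1])
  have "\<exists>u. [d * u^2 = 1] (mod q^N)" if "Legendre d q = 1" for d N
    using lift_sqrt[OF prime_q q_gt_2, of d 1 N] that by auto
  thus "\<exists>u. [d1 * u^2 = 1 + a2 * 0^2] (mod q^N)" "\<exists>u. [d2 * u^2 = 1 - a1 * 0^2] (mod q^N)"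
    "\<exists>u. [d3 * u^2 = 1] (mod q^N)" for N using assms by simp_all
qed (use assms not_dvd_one_two[OF prime_q q_gt_2] in auto)

lemma lift_sqrt_or_zero:
  assumes "w = 0 \<or> Legendre (d * w) q = 1"
  shows "\<exists>u. [d * u^2 = w] (mod q^N)"
proof (cases "w = 0")
  case True
  thus ?thesis by (intro exI[of _ 0]) simp
next
  case False
  thus ?thesis using lift_sqrt[OF prime_q q_gt_2, of d w N] assms by blast
qed

lemma locally_soluble_of_nonresidues:
  assumes sum: "a1 + a2 + a3 = 0" and good: "\<not> q dvd a1" "\<not> q dvd a2" "\<not> q dvd a3"
    and d: "Legendre d1 q = -1" "Legendre d2 q = 1" "Legendre d3 q = -1"
  shows "locally_soluble q a1 a2 a3 d1 d2 d3"
proof -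
  have a3: "a2 - - a1 = - a3" using sum by simp
  have "\<not> q dvd a2 - - a1" "\<not> q dvd - a1 - 0" using good unfolding a3 by auto
  from residue_point_on_nontrivial_covering[OF prime_q q_gt_2 this d]
  obtain x where x: "Legendre (d1 * (x + a2)) q \<noteq> -1" "Legendre (d2 * (x - a1)) q \<noteq> -1" "Legendre (d3 * x) q \<noteq> -1"
    by auto
  text \<open>A point with a vanishing coordinate over the residue field is moved onto a 2-torsion point.\<close>
  define y where "y = (if q dvd x then 0 else if q dvd x - a1 then a1 else if q dvd x + a2 then - a2 else x)"
  have "q dvd - a2 - x \<longleftrightarrow> q dvd x + a2" using dvd_minus_iff[of q "a2 + x"] by (simp add: add.commute)
  hence y_x: "[y = x] (mod q)"
    unfolding y_def cong_iff_dvd_diff by (simp add: dvd_diff_commute[of q a1 x])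
  have zero_or_unit: "y = 0 \<or> \<not> q dvd y" "y - a1 = 0 \<or> \<not> q dvd y - a1" "y + a2 = 0 \<or> \<not> q dvd y + a2"
  proof -
    have "a1 + a2 = - a3" "- a2 - a1 = a3" using sum by simp_all
    hence "\<not> q dvd a1 + a2" "\<not> q dvd - a2 - a1" using good(3) by (simp_all only: dvd_minus_iff not_False_eq_True)
    thus "y = 0 \<or> \<not> q dvd y" "y - a1 = 0 \<or> \<not> q dvd y - a1" "y + a2 = 0 \<or> \<not> q dvd y + a2"
      using good unfolding y_def by simp_all
  qed
  have lift: "\<exists>u. [c * u^2 = w] (mod q^N)"
    if "w = 0 \<or> \<not> q dvd w" "[w = v] (mod q)" "Legendre (c * v) q \<noteq> -1" "\<not> q dvd c" for c w v N
  proof (rule lift_sqrt_or_zero)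
    have "Legendre (c * w) q = Legendre (c * v) q" by (rule Legendre_cong[OF cong_mult[OF cong_refl that(2)]])
    thus "w = 0 \<or> Legendre (c * w) q = 1"
      using that Legendre_of_not_dvd[of q "c * w"] prime_q by (auto simp: prime_dvd_mult_iff)
  qed
  have units: "\<not> q dvd d1" "\<not> q dvd d2" "\<not> q dvd d3" using d not_dvd_of_Legendre by blast+
  show ?thesis
  proof (rule locally_solubleI_x_coordinate[OF sum, where t = 1 and x = y])
    show "\<not> (q dvd 1 \<and> q dvd y)" using not_dvd_one_two(1)[OF prime_q q_gt_2] by blast
    show "\<exists>u. [d1 * u^2 = y + a2 * 1^2] (mod q^N)" for N
      using lift[OF zero_or_unit(3) cong_add[OF y_x cong_refl] x(1) units(1)] by simp
    show "\<exists>u. [d2 * u^2 = y - a1 * 1^2] (mod q^N)" for N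
      using lift[OF zero_or_unit(2) cong_diff[OF y_x cong_refl] x(2) units(2)] by simp
    show "\<exists>u. [d3 * u^2 = y] (mod q^N)" for N by (rule lift[OF zero_or_unit(1) y_x x(3) units(3)])
  qed
qed

lemma locally_soluble_of_good_reduction:
  assumes "a1 + a2 + a3 = 0" "\<not> q dvd a1" "\<not> q dvd a2" "\<not> q dvd a3"
    and "\<not> q dvd d1" "\<not> q dvd d2" "\<not> q dvd d3" "is_square (d1 * d2 * d3)"
  shows "locally_soluble q a1 a2 a3 d1 d2 d3"
proof -
  have "Legendre d1 q * Legendre d2 q * Legendre d3 q = 1"
    using Legendre_triple_eq_1[OF prime_q q_gt_2 assms(5-7)] assms(8) by (auto elim: is_nth_powerE)
  then consider (trivial) "Legendre d1 q = 1" "Legendre d2 q = 1" "Legendre d3 q = 1"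
    | (d2_residue) "Legendre d1 q = -1" "Legendre d2 q = 1" "Legendre d3 q = -1"
    | (d3_residue) "Legendre d2 q = -1" "Legendre d3 q = 1" "Legendre d1 q = -1"
    | (d1_residue) "Legendre d3 q = -1" "Legendre d1 q = 1" "Legendre d2 q = -1"
    using Legendre_values[of d1 q] Legendre_values[of d2 q] Legendre_values[of d3 q] by auto
  thus ?thesis
  proof cases
    case trivial
    show ?thesis by (rule locally_soluble_of_residues[OF assms(1) trivial])
  next
    case d2_residue
    show ?thesis by (rule locally_soluble_of_nonresidues[OF assms(1-4) d2_residue])
  next
    case d3_residue
    have "locally_soluble q a2 a3 a1 d2 d3 d1"
      by (rule locally_soluble_of_nonresidues[OF _ assms(3,4,2) d3_residue]) (use assms(1) in simp)
    thus ?thesis using locally_soluble_rotate by blast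
  next
    case d1_residue
    have "locally_soluble q a3 a1 a2 d3 d1 d2"
      by (rule locally_soluble_of_nonresidues[OF _ assms(4,2,3) d1_residue]) (use assms(1) in simp)
    thus ?thesis using locally_soluble_rotate by blast
  qed
qed

lemma locally_soluble_of_residue_product:
  assumes "a1 + a2 + a3 = 0" "\<not> q dvd a1" "q dvd a2" "\<not> q dvd d2" "Legendre (d1 * d3) q = 1"
  shows "locally_soluble q a1 a2 a3 d1 d2 d3"
proof -
  obtain t u where tu: "[a1 * t^2 + d2 * u^2 = d3] (mod q)"
    by (rule binary_form_surj_mod[OF prime_q q_gt_2 assms(2,4)])
  define x where "x = a1 * t^2 + d2 * u^2"
  have d3: "\<not> q dvd d3" using not_dvd_of_Legendre[of "d1 * d3" q] assms(5) by auto
  have x: "[x = d3] (mod q)" using tu by (simp add: x_def)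
  show ?thesis
  proof (rule locally_solubleI_x_coordinate[OF assms(1), where t = t and x = x])
    show "\<not> (q dvd t \<and> q dvd x)" using cong_dvd_iff[OF x] d3 by blast
    have "[d3 * x = d3^2] (mod q)" using cong_mult[OF cong_refl x, of d3] by (simp add: power2_eq_square)
    hence "Legendre (d3 * x) q = 1" using Legendre_square[OF prime_q d3] Legendre_cong by metis
    thus "\<exists>u. [d3 * u^2 = x] (mod q^N)" for N by (intro lift_sqrt_or_zero) simp
    have "[a2 * t^2 = 0] (mod q)" using assms(3) by (simp add: cong_0_iff)
    hence "[d1 * (x + a2 * t^2) = d1 * (d3 + 0)] (mod q)" by (intro cong_mult cong_add cong_refl x)
    hence "Legendre (d1 * (x + a2 * t^2)) q = 1" using assms(5) Legendre_cong by (metis add_0_right)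
    thus "\<exists>u. [d1 * u^2 = x + a2 * t^2] (mod q^N)" for N by (intro lift_sqrt_or_zero) simp
    show "\<exists>u. [d2 * u^2 = x - a1 * t^2] (mod q^N)" for N
      unfolding x_def by (intro exI[of _ u]) simp
  qed
qed

lemma locally_soluble_units_iff:
  assumes "a1 + a2 + a3 = 0" "odd (multiplicity q a1)" "odd (multiplicity q a2)"
    and units: "\<not> q dvd d1" "\<not> q dvd d2" "\<not> q dvd d3" and "is_square (d1 * d2 * d3)"
  shows "locally_soluble q a1 a2 a3 d1 d2 d3 \<longleftrightarrow> Legendre d2 q = 1 \<and> Legendre d3 q = 1"
proof -
  have triple: "Legendre d1 q * Legendre d2 q * Legendre d3 q = 1"
    using Legendre_triple_eq_1[OF prime_q q_gt_2 units] assms(7) by (auto elim: is_nth_powerE)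
  have equal: "Legendre c q * Legendre d q = 1"
    if "locally_soluble q a a' a'' c' c d" "odd (multiplicity q a)" "\<not> q dvd c'" "\<not> q dvd c" "\<not> q dvd d"
    for a a' a'' c' c d
  proof -
    have nz: "a \<noteq> 0" "c' \<noteq> 0" "c \<noteq> 0" "d \<noteq> 0" using that by auto
    have cd: "\<not> q dvd c * d" using that prime_q by (simp add: prime_dvd_mult_iff)
    have "hilbert q (a * d) (c * d) = 1"
      using hilbert_of_locally_soluble[OF prime_q q_gt_2 nz that(1)] by (simp add: hilbert_commute)
    hence "Legendre (c * d) q ^ multiplicity q (a * d) = 1" using hilbert_unit_right[OF cd] by simp
    moreover have "odd (multiplicity q (a * d))"
      using that nz prime_q by (simp add: prime_multiplicity_mult not_dvd_imp_multiplicity_0)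
    ultimately show ?thesis
      using Legendre_of_not_dvd[OF cd] Legendre_mult[OF prime_q q_gt_2] by auto
  qed
  show ?thesis
  proof
    assume sol: "locally_soluble q a1 a2 a3 d1 d2 d3"
    have "Legendre d2 q * Legendre d3 q = 1" by (rule equal[OF sol assms(2) units])
    moreover have "Legendre d3 q * Legendre d1 q = 1"
      by (rule equal[OF locally_soluble_rotate[OF sol] assms(3) units(2,3,1)])
    ultimately show "Legendre d2 q = 1 \<and> Legendre d3 q = 1"
      using triple Legendre_of_not_dvd[OF units(1)] by auto
  next
    assume "Legendre d2 q = 1 \<and> Legendre d3 q = 1"
    thus "locally_soluble q a1 a2 a3 d1 d2 d3" using triple locally_soluble_of_residues[OF assms(1)] by simp
  qed
qed

end

subsection \<open>Primes dividing the twist\<close>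

lemma is_square_translate:
  fixes a1 a2 d1 d2 d3 :: int
  assumes "a1 \<noteq> 0" "a2 \<noteq> 0" "d1 \<noteq> 0" "d2 \<noteq> 0" "d3 \<noteq> 0" "is_square (d1 * d2 * d3)"
  shows "is_square (squarefree_part (a2 * d1) * squarefree_part (- a1 * d2) * squarefree_part (- a1 * a2 * d3))"
proof -
  have "(a2 * d1) * (- a1 * d2) * (- a1 * a2 * d3) = (d1 * d2 * d3) * (a1 * a2)^2"
    by (simp add: power2_eq_square mult_ac)
  hence "is_square ((a2 * d1) * (- a1 * d2) * (- a1 * a2 * d3))"
    using assms(6) by (simp only: is_nth_power_mult is_nth_power_nth_power)
  thus ?thesis using assms(1-5) by (subst is_square_squarefree_parts_iff) auto
qed

lemma locally_soluble_translate_iff: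
  assumes "prime q" "a1 + a2 + a3 = 0" "a1 \<noteq> 0" "a2 \<noteq> 0"
    and d: "squarefree d1" "squarefree d2" "squarefree d3" "is_square (d1 * d2 * d3)"
  shows "locally_soluble q a1 a2 a3 (squarefree_part (a2 * d1)) (squarefree_part (- a1 * d2))
    (squarefree_part (- a1 * a2 * d3)) \<longleftrightarrow> locally_soluble q a1 a2 a3 d1 d2 d3" (is "?translated \<longleftrightarrow> ?sol")
proof
  have nz: "d1 \<noteq> 0" "d2 \<noteq> 0" "d3 \<noteq> 0" using d by auto
  show "?sol \<Longrightarrow> ?translated" using locally_soluble_translate_squarefree_part assms(1-4) nz d(4) by blast
  define D1 D2 D3 where "D1 = squarefree_part (a2 * d1)" "D2 = squarefree_part (- a1 * d2)"
    "D3 = squarefree_part (- a1 * a2 * d3)"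
  note D = D1_D2_D3_def
  have involution: "squarefree_part (b * squarefree_part (b * d)) = d" if "squarefree d" "b \<noteq> 0" for b d :: int
  proof -
    have "d \<noteq> 0" using that by auto
    have "squarefree_part (b * squarefree_part (b * d)) = squarefree_part (d * b^2)"
      using that \<open>d \<noteq> 0\<close> squarefree_part_mult_squarefree_part[of b "b * d"]
      by (simp add: power2_eq_square mult_ac)
    thus ?thesis using that \<open>d \<noteq> 0\<close> by (simp add: squarefree_part_mult_square squarefree_part_of_squarefree)
  qed
  have "is_square (D1 * D2 * D3)" unfolding D by (rule is_square_translate[OF assms(3,4) nz d(4)])
  moreover assume ?translated
  hence "locally_soluble q a1 a2 a3 D1 D2 D3" by (simp only: D)
  ultimately have "locally_soluble q a1 a2 a3 (squarefree_part (a2 * D1)) (squarefree_part (- a1 * D2))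
      (squarefree_part (- a1 * a2 * D3))"
    using assms(1-4) by (intro locally_soluble_translate_squarefree_part) (auto simp: D)
  moreover have "squarefree_part (a2 * D1) = d1" "squarefree_part (- a1 * D2) = d2"
    "squarefree_part (- a1 * a2 * D3) = d3"
    unfolding D by (rule involution; use d assms in simp)+
  ultimately show ?sol by simp
qed

text \<open>Orthogonality for the pairing \<open>[d2, c3] + [d3, c2]\<close> to the torsion triples
  \<open>(c1, c2, c3) = (- e3 m, - e1 e3, e1 m)\<close> and \<open>(e2 m, - e1 m, - e1 e2)\<close>.\<close>
definition orthogonal_to_torsion :: "int \<Rightarrow> int \<Rightarrow> int \<Rightarrow> int \<Rightarrow> int \<Rightarrow> int \<Rightarrow> int \<Rightarrow> bool" where
  "orthogonal_to_torsion q e1 e2 e3 m d2 d3 \<longleftrightarrow>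
     hilbert q d2 (e1 * m) * hilbert q d3 (- e1 * e3) = 1 \<and>
     hilbert q d2 (- e1 * e2) * hilbert q d3 (- e1 * m) = 1"

lemma orthogonal_to_torsion_reflect:
  "orthogonal_to_torsion q (- e1) (- e3) (- e2) m d3 d2 \<longleftrightarrow> orthogonal_to_torsion q e1 e2 e3 m d2 d3"
  by (auto simp: orthogonal_to_torsion_def mult.commute)

context
  fixes q m :: int
  assumes prime_q: "prime q" and q_gt_2: "2 < q" and multiplicity_m: "multiplicity q m = 1"
begin

private lemma multiplicity_unit_mult_m:
  assumes "\<not> q dvd e"
  shows "multiplicity q (e * m) = 1"
proof -
  have "e \<noteq> 0" "m \<noteq> 0" using assms multiplicity_m by auto
  thus ?thesis using assms multiplicity_m
    by (simp add: prime_multiplicity_mult[OF prime_q] not_dvd_imp_multiplicity_0)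
qed

lemma orthogonal_to_torsion_translate:
  assumes units: "\<not> q dvd e1" "\<not> q dvd e2" "\<not> q dvd e3" and nz: "d2 \<noteq> 0" "d3 \<noteq> 0"
  shows "orthogonal_to_torsion q e1 e2 e3 m (squarefree_part (- (e1 * m) * d2))
      (squarefree_part (- (e1 * m) * (e2 * m) * d3)) \<longleftrightarrow> orthogonal_to_torsion q e1 e2 e3 m d2 d3"
proof -
  have e: "e1 \<noteq> 0" "e2 \<noteq> 0" "e3 \<noteq> 0" "m \<noteq> 0" using units multiplicity_m by auto
  have b: "e1 * m \<noteq> 0" "- e1 * e3 \<noteq> 0" "- e1 * e2 \<noteq> 0" "- e1 * m \<noteq> 0" "- (e1 * m) \<noteq> 0"
    using e nz by auto
  have factor: "hilbert q (squarefree_part (c * d)) b = hilbert q c b * hilbert q d b"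
    if "b \<noteq> 0" "c \<noteq> 0" "d \<noteq> 0" for b c d
    using that hilbert_squarefree_part_left[OF prime_q q_gt_2, of "c * d" b] hilbert_mult_left[OF prime_q q_gt_2] by simp
  have "- (e1 * m) * (e2 * m) * d3 = (- e1 * e2 * d3) * m^2" by (simp add: power2_eq_square mult_ac)
  hence D3: "squarefree_part (- (e1 * m) * (e2 * m) * d3) = squarefree_part ((- e1 * e2) * d3)"
    using e nz by (simp only: squarefree_part_mult_square mult_eq_0_iff neg_equal_0_iff_equal not_False_eq_True simp_thms)
  have torsion: "hilbert q (- (e1 * m)) (e1 * m) = 1" "hilbert q (- e1 * e2) (- e1 * e3) = 1"
    "hilbert q (- (e1 * m)) (- e1 * e2) * hilbert q (- e1 * e2) (- (e1 * m)) = 1"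
    using hilbert_neg_self[OF prime_q q_gt_2, of "e1 * m"] hilbert_units[of q "- e1 * e2" "- e1 * e3"] units e nz prime_q
      hilbert_mult_self[OF prime_q q_gt_2, of "- (e1 * m)" "- e1 * e2"] hilbert_commute[of q "- (e1 * m)"]
    by (simp_all add: prime_dvd_mult_iff)
  show ?thesis
    unfolding orthogonal_to_torsion_def D3 factor[OF b(1,5) nz(1)] factor[OF b(2,3) nz(2)]
      factor[OF b(3,5) nz(1)] factor[OF b(4,3) nz(2)] using torsion by (simp add: mult_ac)
qed

lemma locally_soluble_units_iff_orthogonal:
  assumes sum: "e1 + e2 + e3 = 0" and good: "\<not> q dvd e1" "\<not> q dvd e2" "\<not> q dvd e3"
    and d: "squarefree d1" "squarefree d2" "squarefree d3" "is_square (d1 * d2 * d3)"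
    and units: "\<not> q dvd d2" "\<not> q dvd d3"
  shows "locally_soluble q (e1 * m) (e2 * m) (e3 * m) d1 d2 d3 \<longleftrightarrow> orthogonal_to_torsion q e1 e2 e3 m d2 d3"
proof -
  have "\<not> q dvd d1" using prime_dvd_square_product_iff[OF prime_q d] units by blast
  moreover have "e1 * m + e2 * m + e3 * m = 0" using sum by (metis distrib_right mult_zero_left)
  ultimately have "locally_soluble q (e1 * m) (e2 * m) (e3 * m) d1 d2 d3 \<longleftrightarrow> Legendre d2 q = 1 \<and> Legendre d3 q = 1"
    using multiplicity_unit_mult_m good(1,2) units d(4) by (intro locally_soluble_units_iff prime_q q_gt_2) auto
  moreover have "hilbert q d (e1 * m) = Legendre d q" "hilbert q d (- e1 * m) = Legendre d q" if "\<not> q dvd d" for d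
    using hilbert_unit_right[OF that] multiplicity_unit_mult_m[OF good(1)] by (simp_all add: hilbert_commute[of q d])
  moreover have "\<not> q dvd - e1 * e3" "\<not> q dvd - e1 * e2" using good prime_q by (simp_all add: prime_dvd_mult_iff)
  ultimately show ?thesis using units unfolding orthogonal_to_torsion_def by (simp add: hilbert_units)
qed

lemma locally_soluble_iff_orthogonal_if_translated:
  assumes sum: "e1 + e2 + e3 = 0" and good: "\<not> q dvd e1" "\<not> q dvd e2" "\<not> q dvd e3"
    and d: "squarefree d1" "squarefree d2" "squarefree d3" "is_square (d1 * d2 * d3)"
    and translated: "\<And>D1 D2 D3. \<lbrakk>squarefree D1; squarefree D2; squarefree D3; is_square (D1 * D2 * D3);
        q dvd D2 \<longleftrightarrow> \<not> q dvd d2; q dvd D3 \<longleftrightarrow> q dvd d3\<rbrakk> \<Longrightarrow>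
        locally_soluble q (e1 * m) (e2 * m) (e3 * m) D1 D2 D3 \<longleftrightarrow> orthogonal_to_torsion q e1 e2 e3 m D2 D3"
  shows "locally_soluble q (e1 * m) (e2 * m) (e3 * m) d1 d2 d3 \<longleftrightarrow> orthogonal_to_torsion q e1 e2 e3 m d2 d3"
proof -
  have nz: "d1 \<noteq> 0" "d2 \<noteq> 0" "d3 \<noteq> 0" "e1 * m \<noteq> 0" "e2 * m \<noteq> 0"
    using d good multiplicity_m by auto
  let ?D1 = "squarefree_part (e2 * m * d1)" and ?D2 = "squarefree_part (- (e1 * m) * d2)"
    and ?D3 = "squarefree_part (- (e1 * m) * (e2 * m) * d3)"
  have square: "is_square (?D1 * ?D2 * ?D3)" by (rule is_square_translate[OF nz(4,5,1-3) d(4)])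
  have "multiplicity q (- (e1 * m) * d2) = 1 + of_bool (q dvd d2)"
    using nz d(2) multiplicity_unit_mult_m[OF good(1)]
    by (simp add: prime_multiplicity_mult[OF prime_q] squarefree_multiplicity[OF _ prime_q])
  hence D2: "q dvd ?D2 \<longleftrightarrow> \<not> q dvd d2" unfolding prime_dvd_squarefree_part_iff[OF prime_q] by simp
  have "multiplicity q (- (e1 * m) * (e2 * m) * d3) = 2 + of_bool (q dvd d3)"
    using nz d(3) multiplicity_unit_mult_m[OF good(1)] multiplicity_unit_mult_m[OF good(2)]
    by (simp add: prime_multiplicity_mult[OF prime_q] squarefree_multiplicity[OF _ prime_q])
  hence D3: "q dvd ?D3 \<longleftrightarrow> q dvd d3" unfolding prime_dvd_squarefree_part_iff[OF prime_q] by simp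
  have "orthogonal_to_torsion q e1 e2 e3 m ?D2 ?D3 \<longleftrightarrow> orthogonal_to_torsion q e1 e2 e3 m d2 d3"
    by (rule orthogonal_to_torsion_translate[OF good nz(2,3)])
  moreover have "e1 * m + e2 * m + e3 * m = 0" using sum by (metis distrib_right mult_zero_left)
  hence "locally_soluble q (e1 * m) (e2 * m) (e3 * m) ?D1 ?D2 ?D3 \<longleftrightarrow> locally_soluble q (e1 * m) (e2 * m) (e3 * m) d1 d2 d3"
    by (rule locally_soluble_translate_iff[OF prime_q _ nz(4,5) d])
  ultimately show ?thesis using translated[OF _ _ _ square D2 D3] by simp
qed

lemma locally_soluble_unit_iff_orthogonal:
  assumes sum: "e1 + e2 + e3 = 0" and good: "\<not> q dvd e1" "\<not> q dvd e2" "\<not> q dvd e3"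
    and d: "squarefree d1" "squarefree d2" "squarefree d3" "is_square (d1 * d2 * d3)"
    and unit: "\<not> q dvd d3"
  shows "locally_soluble q (e1 * m) (e2 * m) (e3 * m) d1 d2 d3 \<longleftrightarrow> orthogonal_to_torsion q e1 e2 e3 m d2 d3"
proof (cases "q dvd d2")
  case False
  show ?thesis by (rule locally_soluble_units_iff_orthogonal[OF sum good d False unit])
next
  case True
  show ?thesis
    by (rule locally_soluble_iff_orthogonal_if_translated[OF sum good d],
        rule locally_soluble_units_iff_orthogonal[OF sum good]) (use True unit in auto)
qed

text \<open>The local image at a prime dividing the twist exactly once is generated by the 2-torsion, and it
  is its own orthogonal complement. Translation by the two torsion points clears \<open>q\<close> from \<open>d2\<close>
  and \<open>d3\<close>; reflection exchanges these points.\<close>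
theorem locally_soluble_iff_orthogonal_to_torsion:
  assumes sum: "e1 + e2 + e3 = 0" and good: "\<not> q dvd e1" "\<not> q dvd e2" "\<not> q dvd e3"
    and d: "squarefree d1" "squarefree d2" "squarefree d3" "is_square (d1 * d2 * d3)"
  shows "locally_soluble q (e1 * m) (e2 * m) (e3 * m) d1 d2 d3 \<longleftrightarrow> orthogonal_to_torsion q e1 e2 e3 m d2 d3"
proof -
  have unit_d2: "locally_soluble q (e1 * m) (e2 * m) (e3 * m) d1 d2 d3 \<longleftrightarrow> orthogonal_to_torsion q e1 e2 e3 m d2 d3"
    if "squarefree d1" "squarefree d2" "squarefree d3" "is_square (d1 * d2 * d3)" "\<not> q dvd d2"
    for d1 d2 d3
  proof -
    have "locally_soluble q (e1 * m) (e2 * m) (e3 * m) d1 d2 d3 \<longleftrightarrow>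
        locally_soluble q (- e1 * m) (- e3 * m) (- e2 * m) d1 d3 d2"
      using locally_soluble_reflect[of q "e1 * m" "e2 * m" "e3 * m" d1 d2 d3]
        locally_soluble_reflect[of q "- e1 * m" "- e3 * m" "- e2 * m" d1 d3 d2] by auto
    also have "\<dots> \<longleftrightarrow> orthogonal_to_torsion q (- e1) (- e3) (- e2) m d3 d2"
      using sum good that by (intro locally_soluble_unit_iff_orthogonal) (auto simp: mult_ac)
    finally show ?thesis unfolding orthogonal_to_torsion_reflect .
  qed
  show ?thesis
  proof (cases "q dvd d2")
    case False
    thus ?thesis by (rule unit_d2[OF d])
  next
    case True
    show ?thesis
      by (rule locally_soluble_iff_orthogonal_if_translated[OF sum good d], rule unit_d2) (use True in auto)
  qed
qed

end

subsection \<open>Ramified triples and primes of bad reduction\<close>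

lemma covering_eqs_prime_square_dvd:
  assumes "prime q" "squarefree d1" "squarefree d3" "covering_eqs (q^2) a1 a2 a3 d1 d2 d3 t u1 u2 u3"
    and "q dvd t" "q dvd u2"
  shows "q dvd u1" "q dvd u3"
proof -
  have "q^2 dvd a1 * t^2" "q^2 dvd a3 * t^2" "q^2 dvd d2 * u2^2" using assms(5,6) by (simp_all add: dvd_mult)
  hence "q^2 dvd d3 * u3^2" "q^2 dvd d1 * u1^2"
    using assms(4) dvd_add_diff_iff(1,3) unfolding covering_eqs_def by blast+
  thus "q dvd u1" "q dvd u3"
    using prime_square_dvd_mult_square squarefree_not_dvd assms(1-3) by blast+
qed

lemma not_locally_soluble_of_ramified_pair:
  assumes "prime q" "\<not> q dvd a2" "squarefree d1" "squarefree d3" "q dvd d1" "q dvd d3" "\<not> q dvd d2"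
  shows "\<not> locally_soluble q a1 a2 a3 d1 d2 d3"
proof
  assume "locally_soluble q a1 a2 a3 d1 d2 d3"
  then obtain t u1 u2 u3 where prim: "primitive q t u1 u2 u3"
    and mod_q2: "covering_eqs (q^2) a1 a2 a3 d1 d2 d3 t u1 u2 u3" by (rule locally_solubleE)
  have mod_q: "covering_eqs q a1 a2 a3 d1 d2 d3 t u1 u2 u3" by (rule covering_eqs_dvd[OF mod_q2]) simp
  have "q dvd d3 * u3^2" "q dvd d1 * u1^2" using assms(5,6) by simp_all
  hence "q dvd a2 * t^2" using mod_q dvd_add_diff_iff(2) unfolding covering_eqs_def by blast
  hence t: "q dvd t" using prime_dvd_mult_square assms(1,2) by blast
  hence "q dvd a1 * t^2" by (rule dvd_mult_square)
  hence "q dvd d2 * u2^2"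
    using mod_q \<open>q dvd d3 * u3^2\<close> dvd_add_diff_iff(1) unfolding covering_eqs_def by blast
  hence u2: "q dvd u2" using prime_dvd_mult_square assms(1,7) by blast
  thus False using covering_eqs_prime_square_dvd[OF assms(1,3,4) mod_q2 t] prim t by blast
qed

lemma locally_soluble_imp_not_dvd:
  assumes "prime q" "\<not> q dvd a1" "\<not> q dvd a3"
    and d: "squarefree d1" "squarefree d2" "squarefree d3" "is_square (d1 * d2 * d3)"
    and sol: "locally_soluble q a1 a2 a3 d1 d2 d3"
  shows "\<not> q dvd d2"
proof
  assume dvd: "q dvd d2"
  note pattern = prime_dvd_square_product_iff[OF assms(1) d]
  have sol': "locally_soluble q a2 a3 a1 d2 d3 d1" by (rule locally_soluble_rotate[OF sol])
  show False
  proof (cases "q dvd d1")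
    case True
    thus False using sol' not_locally_soluble_of_ramified_pair[OF assms(1,3) d(2,1) dvd] pattern dvd by blast
  next
    case False
    hence "q dvd d3" using pattern dvd by blast
    thus False using locally_soluble_rotate[OF sol'] dvd False
        not_locally_soluble_of_ramified_pair[OF assms(1,2) d(3,2)] by blast
  qed
qed

context
  fixes q :: int
  assumes prime_q: "prime q" and q_gt_2: "2 < q"
begin

lemma primitive_solution_at_bad_prime:
  assumes a: "\<not> q dvd a1" "q dvd a2" and d: "squarefree d1" "squarefree d3" "\<not> q dvd d2" "q dvd d1 \<longleftrightarrow> q dvd d3"
    and nontrivial: "q dvd d1 \<or> Legendre (d1 * d3) q \<noteq> 1"
    and prim: "primitive q t u1 u2 u3" and mod_q2: "covering_eqs (q^2) a1 a2 a3 d1 d2 d3 t u1 u2 u3"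
  shows "\<not> q dvd t" "q dvd d1 * u1" "q dvd d3 * u3"
proof -
  have "q dvd q^2" by simp
  hence mod_q: "q dvd a1 * t^2 + d2 * u2^2 - d3 * u3^2" "q dvd a2 * t^2 + d3 * u3^2 - d1 * u1^2"
    using covering_eqs_dvd[OF mod_q2] unfolding covering_eqs_def by blast+
  have u2: "q dvd u2" if "q dvd t" "q dvd d3 * u3^2"
  proof -
    have "q dvd a1 * t^2" using that(1) by (rule dvd_mult_square)
    hence "q dvd d2 * u2^2" using dvd_add_diff_iff(1)[OF mod_q(1)] that(2) by blast
    thus ?thesis using prime_dvd_mult_square[OF prime_q _ d(3)] by blast
  qed
  have "\<not> q dvd t \<and> q dvd d1 * u1 \<and> q dvd d3 * u3"
  proof (cases "q dvd d1")
    case True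
    hence dvd: "q dvd d1" "q dvd d3" using d(4) by auto
    have "\<not> q dvd t"
    proof
      assume t: "q dvd t"
      hence "q dvd u2" using u2 dvd by simp
      thus False using covering_eqs_prime_square_dvd[OF prime_q d(1,2) mod_q2 t] prim t by blast
    qed
    thus ?thesis using dvd by simp
  next
    case False
    hence units: "\<not> q dvd d1" "\<not> q dvd d3" using d(4) by auto
    have "q dvd a2 * t^2" using a(2) by simp
    hence diff: "q dvd d3 * u3^2 - d1 * u1^2" using dvd_diff[OF mod_q(2), of "a2 * t^2"] by simp
    hence u3: "q dvd u3"
      using Legendre_eq_1_if_dvd_diff_squares[OF prime_q diff _ units(2,1)] nontrivial units
      by (auto simp: mult.commute)
    hence "q dvd d1 * u1^2" using diff by (simp add: power2_eq_square dvd_diff_right_iff)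
    hence u1: "q dvd u1" using prime_dvd_mult_square prime_q units(1) by blast
    have "\<not> q dvd t" using u2 u1 u3 prim by (auto simp: power2_eq_square)
    thus ?thesis using u1 u3 by simp
  qed
  thus "\<not> q dvd t" "q dvd d1 * u1" "q dvd d3 * u3" by blast+
qed

text \<open>The binary form is similar to its negative, through multiplication by an element of norm \<open>-1\<close>.\<close>
lemma binary_form_neg_mod_power:
  assumes "d1 = f * a" "d3 = f * b" "\<not> q dvd a" "\<not> q dvd b" "q dvd d1 * u1" "q dvd d3 * u3"
  obtains v1 v3 where "[d1 * v1^2 - d3 * v3^2 = - (d1 * u1^2 - d3 * u3^2)] (mod q^N)" "q dvd d3 * v3"
proof -
  have "\<not> q dvd - (a * b)" using assms(3,4) prime_q by (simp add: prime_dvd_mult_iff)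
  then obtain r s where "[1 * r^2 + - (a * b) * s^2 = -1] (mod q^N)"
    using unit_represented_by_binary_form[OF prime_q q_gt_2] not_dvd_one_two[OF prime_q q_gt_2] by blast
  hence norm: "[r^2 - a * b * s^2 = -1] (mod q^N)" by simp
  define v1 v3 where "v1 = r * u1 + b * s * u3" and "v3 = a * s * u1 + r * u3"
  have "d1 * v1^2 - d3 * v3^2 = (r^2 - a * b * s^2) * (d1 * u1^2 - d3 * u3^2)"
    unfolding v1_def v3_def assms(1,2) by (simp add: power2_eq_square algebra_simps)
  also have "[\<dots> = -1 * (d1 * u1^2 - d3 * u3^2)] (mod q^N)" by (rule cong_mult[OF norm cong_refl])
  finally have "[d1 * v1^2 - d3 * v3^2 = - (d1 * u1^2 - d3 * u3^2)] (mod q^N)" by simp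
  moreover have "d3 * v3 = b * s * (d1 * u1) + r * (d3 * u3)" by (simp add: v3_def assms(1,2) algebra_simps)
  hence "q dvd d3 * v3" using assms(5,6) by simp
  ultimately show ?thesis by (rule that)
qed

lemma locally_soluble_neg_of_unit_t:
  assumes sum: "a1 + a2 + a3 = 0" and "\<not> q dvd a1" "\<not> q dvd d2"
    and f: "d1 = f * a" "d3 = f * b" "\<not> q dvd a" "\<not> q dvd b"
    and sol: "\<And>N. \<exists>t u1 u2 u3. covering_eqs (q^N) a1 a2 a3 d1 d2 d3 t u1 u2 u3 \<and>
      \<not> q dvd t \<and> q dvd d1 * u1 \<and> q dvd d3 * u3"
  shows "locally_soluble q a1 a2 a3 (- d1) d2 (- d3)"
  unfolding locally_soluble_def
proof
  fix N
  obtain t u1 u2 u3 where eqs: "covering_eqs (q ^ Suc N) a1 a2 a3 d1 d2 d3 t u1 u2 u3"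
    and t: "\<not> q dvd t" and ramified: "q dvd d1 * u1" "q dvd d3 * u3" using sol by blast
  obtain v1 v3 where neg: "[d1 * v1^2 - d3 * v3^2 = - (d1 * u1^2 - d3 * u3^2)] (mod q^N)"
    and v3: "q dvd d3 * v3" by (rule binary_form_neg_mod_power[OF f ramified])
  have "q^N dvd (a2 * t^2 + d3 * u3^2 - d1 * u1^2) + ((d1 * v1^2 - d3 * v3^2) - - (d1 * u1^2 - d3 * u3^2))"
    using covering_eqs_dvd[OF eqs, of "q^N"] neg unfolding covering_eqs_def cong_iff_dvd_diff
    by (intro dvd_add) simp_all
  hence second_eq: "[- d1 * v1^2 = a2 * t^2 + - d3 * v3^2] (mod q^N)"
    using dvd_minus_iff unfolding cong_iff_dvd_diff by (fastforce simp: algebra_simps)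
  have first_eq: "q dvd a1 * t^2 + d2 * u2^2 - d3 * u3^2"
    using covering_eqs_dvd[OF eqs, of q] unfolding covering_eqs_def by simp
  have "\<not> q dvd u2"
  proof
    assume "q dvd u2"
    hence "q dvd d2 * u2^2" by (rule dvd_mult_square)
    moreover have "q dvd d3 * u3^2" using ramified(2) by (simp add: power2_eq_square mult.assoc[symmetric])
    ultimately have "q dvd a1 * t^2" using dvd_add_diff_iff(2)[OF first_eq] by blast
    thus False using prime_dvd_mult_square[OF prime_q] assms(2) t by blast
  qed
  define w where "w = - d3 * v3^2 - a1 * t^2"
  have "w - d2 * u2^2 = - ((a1 * t^2 + d2 * u2^2 - d3 * u3^2) + (d3 * v3) * v3 + (d3 * u3) * u3)"
    by (simp add: w_def power2_eq_square algebra_simps)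
  hence "[w = d2 * u2^2] (mod q)"
    using first_eq v3 ramified unfolding cong_iff_dvd_diff by (simp only: dvd_minus_iff dvd_add dvd_mult2)
  hence "[d2 * w = (d2 * u2)^2] (mod q)"
    using cong_mult[OF cong_refl, of w "d2 * u2^2" q d2] by (simp add: power2_eq_square mult_ac)
  moreover have "Legendre ((d2 * u2)^2) q = 1"
    using \<open>\<not> q dvd u2\<close> assms(3) prime_q by (intro Legendre_square) (simp_all add: prime_dvd_mult_iff)
  ultimately have "Legendre (d2 * w) q = 1" using Legendre_cong by metis
  then obtain v2 where v2: "[d2 * v2^2 = w] (mod q^N)" using lift_sqrt[OF prime_q q_gt_2] by blast
  have "[a1 * t^2 + d2 * v2^2 = a1 * t^2 + w] (mod q^N)" by (rule cong_add[OF cong_refl v2])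
  hence "[- d3 * v3^2 = a1 * t^2 + d2 * v2^2] (mod q^N)" by (simp add: w_def cong_sym_eq)
  hence "covering_eqs (q^N) a1 a2 a3 (- d1) d2 (- d3) t v1 v2 v3" using second_eq by (rule covering_eqsI[OF sum])
  thus "\<exists>t u1 u2 u3. primitive q t u1 u2 u3 \<and> covering_eqs (q^N) a1 a2 a3 (- d1) d2 (- d3) t u1 u2 u3"
    using t by blast
qed

lemma squarefree_pair_common_factor:
  assumes "squarefree d1" "squarefree d3" "q dvd d1 \<longleftrightarrow> q dvd d3"
  obtains f a b where "d1 = f * a" "d3 = f * b" "\<not> q dvd a" "\<not> q dvd b"
proof (cases "q dvd d1")
  case True
  then obtain a b where ab: "d1 = q * a" "d3 = q * b" using assms(3) by (auto elim!: dvdE)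
  have "\<not> q^2 dvd d1" "\<not> q^2 dvd d3" using squarefree_not_dvd prime_q assms(1,2) by blast+
  hence "\<not> q dvd a" "\<not> q dvd b" using ab by (auto simp: power2_eq_square)
  thus ?thesis using that ab by blast
next
  case False
  thus ?thesis using that[of 1 d1 d3] assms(3) by simp
qed

lemma locally_soluble_neg:
  assumes sum: "a1 + a2 + a3 = 0" and a: "\<not> q dvd a1" "q dvd a2" "\<not> q dvd a3"
    and d: "squarefree d1" "squarefree d2" "squarefree d3" "is_square (d1 * d2 * d3)"
    and sol: "locally_soluble q a1 a2 a3 d1 d2 d3"
  shows "locally_soluble q a1 a2 a3 (- d1) d2 (- d3)"
proof -
  have d2: "\<not> q dvd d2" by (rule locally_soluble_imp_not_dvd[OF prime_q a(1,3) d sol])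
  show ?thesis
  proof (cases "\<not> q dvd d1 \<and> Legendre (d1 * d3) q = 1")
    case True
    thus ?thesis by (intro locally_soluble_of_residue_product prime_q q_gt_2 sum a d2) simp
  next
    case False
    have pattern: "q dvd d1 \<longleftrightarrow> q dvd d3" using prime_dvd_square_product_iff[OF prime_q d] d2 by blast
    obtain f a b where f: "d1 = f * a" "d3 = f * b" "\<not> q dvd a" "\<not> q dvd b"
      by (rule squarefree_pair_common_factor[OF d(1,3) pattern])
    show ?thesis
    proof (rule locally_soluble_neg_of_unit_t[OF sum a(1) d2 f])
      fix N
      obtain t u1 u2 u3 where prim: "primitive q t u1 u2 u3"
        and eqs: "covering_eqs (q ^ (N + 2)) a1 a2 a3 d1 d2 d3 t u1 u2 u3" by (rule locally_solubleE[OF sol])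
      have "covering_eqs (q^2) a1 a2 a3 d1 d2 d3 t u1 u2 u3" "covering_eqs (q^N) a1 a2 a3 d1 d2 d3 t u1 u2 u3"
        by (rule covering_eqs_dvd[OF eqs], simp only: power_add dvd_triv_left dvd_triv_right)+
      thus "\<exists>t u1 u2 u3. covering_eqs (q^N) a1 a2 a3 d1 d2 d3 t u1 u2 u3 \<and>
          \<not> q dvd t \<and> q dvd d1 * u1 \<and> q dvd d3 * u3"
        using primitive_solution_at_bad_prime[OF a(1,2) d(1,3) d2 pattern _ prim] False by blast
    qed
  qed
qed

lemma locally_soluble_untwist:
  assumes residues: "Legendre m q = 1" "Legendre g1 q = 1" "Legendre g2 q = 1" "Legendre g3 q = 1"
    and "locally_soluble q (a1 * m) (a2 * m) (a3 * m) (g1 * d1) (g2 * d2) (g3 * d3)"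
  shows "locally_soluble q a1 a2 a3 d1 d2 d3"
  unfolding locally_soluble_def
proof
  fix N
  have root: "\<exists>u. \<not> q dvd u \<and> [u^2 = g] (mod q^N)" if "Legendre g q = 1" for g
    using lift_sqrt[OF prime_q q_gt_2, of 1 g N] that by auto
  obtain v where v: "\<not> q dvd v" "[v^2 = m] (mod q^N)" using root residues by blast
  obtain w1 where w1: "\<not> q dvd w1" "[w1^2 = g1] (mod q^N)" using root residues by blast
  obtain w2 where w2: "\<not> q dvd w2" "[w2^2 = g2] (mod q^N)" using root residues by blast
  obtain w3 where w3: "\<not> q dvd w3" "[w3^2 = g3] (mod q^N)" using root residues by blast
  obtain t u1 u2 u3 where prim: "primitive q t u1 u2 u3"
    and eqs: "covering_eqs (q^N) (a1 * m) (a2 * m) (a3 * m) (g1 * d1) (g2 * d2) (g3 * d3) t u1 u2 u3"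
    by (rule locally_solubleE[OF assms(5)])
  have transfer: "q^N dvd x * (v * t)^2 + y * (r * i)^2 - z * (s * j)^2"
    if "q^N dvd x * m * t^2 + g * y * i^2 - h * z * j^2" "[r^2 = g] (mod q^N)" "[s^2 = h] (mod q^N)"
    for x y z r s g h i j
  proof -
    have "x * (v * t)^2 + y * (r * i)^2 - z * (s * j)^2 = x * v^2 * t^2 + r^2 * y * i^2 - s^2 * z * j^2"
      by (simp add: power_mult_distrib mult_ac)
    also have "[\<dots> = x * m * t^2 + g * y * i^2 - h * z * j^2] (mod q^N)"
      by (intro cong_add cong_diff cong_mult cong_refl v that)
    finally show ?thesis using that(1) cong_dvd_iff by blast
  qed
  have "covering_eqs (q^N) a1 a2 a3 d1 d2 d3 (v * t) (w1 * u1) (w2 * u2) (w3 * u3)"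
    using eqs w1 w2 w3 unfolding covering_eqs_def by (blast intro: transfer)
  moreover have "primitive q (v * t) (w1 * u1) (w2 * u2) (w3 * u3)"
    using prim v w1 w2 w3 prime_q by (simp add: prime_dvd_mult_iff)
  ultimately show "\<exists>t u1 u2 u3. primitive q t u1 u2 u3 \<and> covering_eqs (q^N) a1 a2 a3 d1 d2 d3 t u1 u2 u3"
    by blast
qed

end

subsection \<open>The place 2\<close>

lemma odd_square_cong_1_mod_8: "odd (s::int) \<Longrightarrow> [s^2 = 1] (mod 8)"
  using odd_mod_8[of s] power_mod[of s 8 2] by (auto simp: cong_def)

lemma odd_square_cong_1_mod_4: "odd (s::int) \<Longrightarrow> [s^2 = 1] (mod 4)"
  by (rule cong_dvd_modulus[OF odd_square_cong_1_mod_8]) simp_all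

lemma locally_soluble_2I:
  assumes "a1 + a2 + a3 = 0" "odd d1" "odd d2" "odd d3"
    and "[d2 = d3 - a1 * t^2] (mod 8)" "[d1 = d3 + a2 * t^2] (mod 8)"
  shows "locally_soluble 2 a1 a2 a3 d1 d2 d3"
proof (rule locally_solubleI_x_coordinate[OF assms(1), where t = t and x = d3])
  show "\<exists>u. [d1 * u^2 = d3 + a2 * t^2] (mod 2^N)" for N using lift_sqrt_2[OF assms(2,6)] by blast
  show "\<exists>u. [d2 * u^2 = d3 - a1 * t^2] (mod 2^N)" for N using lift_sqrt_2[OF assms(3,5)] by blast
  show "\<exists>u. [d3 * u^2 = d3] (mod 2^N)" for N by (intro exI[of _ 1]) simp
qed (use assms in simp)

lemma hilbert_2_of_locally_soluble:
  assumes sol: "\<And>q. prime q \<Longrightarrow> 2 < q \<Longrightarrow> locally_soluble q a1 a2 a3 d1 d2 d3"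
    and nz: "a1 \<noteq> 0" "d1 \<noteq> 0" "d2 \<noteq> 0" "d3 \<noteq> 0" and real: "d2 * d3 > 0 \<or> a1 * d3 > 0"
  shows "hilbert_2 (d2 * d3) (a1 * d3) = 1"
proof -
  let ?S = "{q. prime q \<and> 2 < q \<and> q dvd (d2 * d3) * (a1 * d3)}"
  have "(\<Prod>q\<in>?S. hilbert q (d2 * d3) (a1 * d3)) = 1"
    using hilbert_of_locally_soluble[OF _ _ nz] sol by (intro prod.neutral ballI) auto
  moreover have "hilbert_inf (d2 * d3) (a1 * d3) = 1" using real by (auto simp: hilbert_inf_def)
  ultimately show ?thesis using hilbert_product_formula[of "d2 * d3" "a1 * d3"] nz by simp
qed

lemma hilbert_2_double_odd_eq_1_iff:
  assumes "odd u" "odd b"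
  shows "hilbert_2 u (2 * b) = 1 \<longleftrightarrow>
    u mod 8 = 1 \<or> u mod 8 = 7 \<and> b mod 4 = 1 \<or> u mod 8 = 3 \<and> b mod 4 = 3"
proof -
  have "chi4 u = (if u mod 8 = 1 \<or> u mod 8 = 5 then 1 else -1)"
    using odd_mod_8[OF assms(1)] unfolding chi4_def by (auto; presburger)
  thus ?thesis
    using odd_mod_8[OF assms(1)] odd_mod_4[OF assms(2)] unfolding hilbert_2_double_odd[OF assms]
    by (elim disjE) (simp_all add: chi4_def[of b] chi8_def hilbert_inf_def)
qed

lemma cong_mod_8_of_square_product:
  fixes d1 d2 d3 :: int
  assumes odd: "odd d1" "odd d2" "odd d3" and square: "is_square (d1 * d2 * d3)"
  shows "[d2 * d3 = d1] (mod 8)"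
proof -
  obtain s where s: "d1 * d2 * d3 = s^2" using square by (rule is_nth_powerE)
  hence "odd s" using odd by (metis even_mult_iff even_power zero_less_numeral)
  hence "[d1 * (d1 * d2 * d3) = d1 * 1] (mod 8)"
    unfolding s by (intro cong_mult cong_refl odd_square_cong_1_mod_8)
  moreover have "[d1^2 * (d2 * d3) = 1 * (d2 * d3)] (mod 8)"
    by (rule cong_mult[OF odd_square_cong_1_mod_8[OF odd(1)] cong_refl])
  ultimately show ?thesis
    by (simp add: power2_eq_square mult.assoc) (metis cong_sym cong_trans)
qed

lemma hilbert_2_eq_1_imp_mod_8:
  assumes odd: "odd d1" "odd d2" "odd d3" "odd b1" "odd b2"
    and d3: "d3 mod 4 = 1" and square: "is_square (d1 * d2 * d3)"
    and conics: "hilbert_2 (d2 * d3) (2 * (b1 * d3)) = 1" "hilbert_2 (d3 * d1) (2 * (b2 * d1)) = 1"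
  shows "d1 mod 8 = 1 \<or> d1 mod 8 = 7 \<and> b1 mod 4 = 1 \<or> d1 mod 8 = 3 \<and> b1 mod 4 = 3"
    "d2 mod 8 = 1 \<or> d2 mod 8 = 7 \<and> b2 mod 4 = 3 \<or> d2 mod 8 = 3 \<and> b2 mod 4 = 1"
    "d1 mod 4 = d2 mod 4" "d3 mod 8 = ((d1 mod 8) * (d2 mod 8)) mod 8"
proof -
  have rotated: "is_square (d2 * d3 * d1)" "is_square (d3 * d1 * d2)"
    using square by (simp_all add: mult_ac)
  have d: "(d2 * d3) mod 8 = d1 mod 8" "(d3 * d1) mod 8 = d2 mod 8" "(d1 * d2) mod 8 = d3 mod 8"
    using cong_mod_8_of_square_product[OF odd(1,2,3) square] cong_mod_8_of_square_product[OF odd(2,3,1) rotated(1)]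
      cong_mod_8_of_square_product[OF odd(3,1,2) rotated(2)] by (simp_all add: cong_def)
  have b1: "(b1 * d3) mod 4 = b1 mod 4" using mod_mult_right_eq[of b1 d3 4] d3 by simp
  show "d1 mod 8 = 1 \<or> d1 mod 8 = 7 \<and> b1 mod 4 = 1 \<or> d1 mod 8 = 3 \<and> b1 mod 4 = 3"
    using conics(1) odd by (subst (asm) hilbert_2_double_odd_eq_1_iff) (simp_all add: d b1)
  have d2: "d2 mod 8 = 1 \<or> d2 mod 8 = 7 \<and> (b2 * d1) mod 4 = 1 \<or> d2 mod 8 = 3 \<and> (b2 * d1) mod 4 = 3"
    using conics(2) odd by (subst (asm) hilbert_2_double_odd_eq_1_iff) (simp_all add: d)
  have "[d3 * d1 = 1 * d1] (mod 4)" using d3 by (intro cong_mult) (simp_all add: cong_def)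
  moreover have "[d3 * d1 = d2] (mod 4)" using d(2) cong_dvd_modulus[of "d3 * d1" d2 8 4] by (simp add: cong_def)
  ultimately show d12: "d1 mod 4 = d2 mod 4" by (simp add: cong_def)
  have "(b2 * d1) mod 4 = ((b2 mod 4) * 3) mod 4" if "d2 mod 8 = 7 \<or> d2 mod 8 = 3"
  proof -
    have "d1 mod 4 = 3" using that d12 by presburger
    thus ?thesis by (metis mod_mult_eq)
  qed
  thus "d2 mod 8 = 1 \<or> d2 mod 8 = 7 \<and> b2 mod 4 = 3 \<or> d2 mod 8 = 3 \<and> b2 mod 4 = 1"
    using d2 odd_mod_4[OF odd(5)] by auto
  show "d3 mod 8 = ((d1 mod 8) * (d2 mod 8)) mod 8" using d(3) by (simp add: mod_mult_eq)
qed

lemma hilbert_2_eq_1_imp_cong_mod_8: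
  assumes odd: "odd d1" "odd d2" "odd d3" "odd b1" "odd b2"
    and d3: "d3 mod 4 = 1" and square: "is_square (d1 * d2 * d3)"
    and conics: "hilbert_2 (d2 * d3) (2 * (b1 * d3)) = 1" "hilbert_2 (d3 * d1) (2 * (b2 * d1)) = 1"
  shows "\<exists>t. [d2 = d3 - 2 * b1 * t^2] (mod 8) \<and> [d1 = d3 + 2 * b2 * t^2] (mod 8)"
proof -
  note residues = hilbert_2_eq_1_imp_mod_8[OF odd d3 square conics]
  have "y = z \<and> x = z \<or> y = (z - 2 * r) mod 8 \<and> x = (z + 2 * s) mod 8"
    if "x = 1 \<or> x = 7 \<and> r = 1 \<or> x = 3 \<and> r = 3" "y = 1 \<or> y = 7 \<and> s = 3 \<or> y = 3 \<and> s = 1"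
      "x = 1 \<longleftrightarrow> y = 1" "z = (x * y) mod 8" for x y z r s :: int
    using that by (elim disjE conjE) simp_all
  moreover have "(d1 mod 8) mod 4 = (d2 mod 8) mod 4" using residues(3) by (simp add: mod_mod_cancel)
  hence "d1 mod 8 = 1 \<longleftrightarrow> d2 mod 8 = 1" using residues(1,2) by (elim disjE conjE) simp_all
  ultimately have "d2 mod 8 = d3 mod 8 \<and> d1 mod 8 = d3 mod 8 \<or>
      d2 mod 8 = (d3 mod 8 - 2 * (b1 mod 4)) mod 8 \<and> d1 mod 8 = (d3 mod 8 + 2 * (b2 mod 4)) mod 8"
    using residues(1,2,4) by blast
  moreover have "(d3 mod 8 - 2 * (b1 mod 4)) mod 8 = (d3 - 2 * b1) mod 8"
    "(d3 mod 8 + 2 * (b2 mod 4)) mod 8 = (d3 + 2 * b2) mod 8"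
    by (simp_all add: mult_mod_right mod_diff_eq mod_add_eq)
  ultimately consider (even_t) "d2 mod 8 = d3 mod 8" "d1 mod 8 = d3 mod 8"
    | (odd_t) "d2 mod 8 = (d3 - 2 * b1) mod 8" "d1 mod 8 = (d3 + 2 * b2) mod 8" by argo
  thus ?thesis
  proof cases
    case even_t
    thus ?thesis by (intro exI[of _ 0]) (simp add: cong_def)
  next
    case odd_t
    thus ?thesis by (intro exI[of _ 1]) (simp add: cong_def)
  qed
qed

text \<open>Reciprocity replaces the 2-adic condition: the conics \<open>a1 t\<^sup>2 + d2 u2\<^sup>2 = d3 u3\<^sup>2\<close> and
  \<open>a2 t\<^sup>2 + d3 u3\<^sup>2 = d1 u1\<^sup>2\<close> are isotropic at every other place, hence also at 2, and this pins
  the residues modulo 8 down to the soluble patterns.\<close>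
theorem locally_soluble_2_of_other_places:
  assumes "a1 + a2 + a3 = 0" "2 dvd a1" "\<not> 4 dvd a1" "2 dvd a2" "\<not> 4 dvd a2"
    and odd: "odd d1" "odd d2" "odd d3" and square: "is_square (d1 * d2 * d3)" and d3: "d3 mod 4 = 1"
    and signs: "a1 < 0" "d2 > 0"
    and sol: "\<And>q. prime q \<Longrightarrow> 2 < q \<Longrightarrow> locally_soluble q a1 a2 a3 d1 d2 d3"
  shows "locally_soluble 2 a1 a2 a3 d1 d2 d3"
proof -
  obtain b1 b2 where b: "a1 = 2 * b1" "a2 = 2 * b2" using assms(2,4) by (auto elim!: dvdE)
  have odd_b: "odd b1" "odd b2" using assms(3,5) b by auto
  have nz: "d1 \<noteq> 0" "d2 \<noteq> 0" "d3 \<noteq> 0" "b1 \<noteq> 0" "b2 \<noteq> 0" using odd odd_b by auto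
  have "d1 * d2 * d3 > 0" using square nz by (auto elim!: is_nth_powerE)
  hence "d3 * d1 > 0" using signs(2) by (metis mult.commute mult.assoc zero_less_mult_pos)
  hence "hilbert_2 (d3 * d1) (2 * (b2 * d1)) = 1"
    using hilbert_2_of_locally_soluble[of a2 a3 a1 d2 d3 d1] locally_soluble_rotate[OF sol] nz b(2)
    by (simp add: mult.assoc)
  moreover have "d2 * d3 > 0 \<or> a1 * d3 > 0"
    using signs nz by (cases "d3 > 0") (auto intro: mult_neg_neg)
  hence "hilbert_2 (d2 * d3) (2 * (b1 * d3)) = 1"
    using hilbert_2_of_locally_soluble[OF sol] nz b(1) by (simp add: mult.assoc)
  ultimately obtain t where "[d2 = d3 - a1 * t^2] (mod 8)" "[d1 = d3 + a2 * t^2] (mod 8)"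
    using hilbert_2_eq_1_imp_cong_mod_8[OF odd odd_b d3 square] b by auto
  thus ?thesis by (rule locally_soluble_2I[OF assms(1) odd])
qed

lemma locally_soluble_2_imp_mod_4:
  assumes a: "2 dvd a1" "\<not> 4 dvd a1" "2 dvd a2" "4 dvd a3"
    and odd: "odd d1" "odd d2" "odd d3" and square: "is_square (d1 * d2 * d3)"
    and sol: "locally_soluble 2 a1 a2 a3 d1 d2 d3"
  shows "d3 mod 4 = 1"
proof -
  obtain t u1 u2 u3 where prim: "primitive 2 t u1 u2 u3"
    and eqs: "covering_eqs (2^2) a1 a2 a3 d1 d2 d3 t u1 u2 u3" by (rule locally_solubleE[OF sol])
  have "covering_eqs 2 a1 a2 a3 d1 d2 d3 t u1 u2 u3" by (rule covering_eqs_dvd[OF eqs]) simp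
  hence parity: "even u2 \<longleftrightarrow> even u3" "even u3 \<longleftrightarrow> even u1"
    using a(1,3) odd unfolding covering_eqs_def by auto
  have mod_4: "4 dvd a1 * t^2 + d2 * u2^2 - d3 * u3^2" "4 dvd a3 * t^2 + d1 * u1^2 - d2 * u2^2"
    using eqs unfolding covering_eqs_def by simp_all
  have "odd u3"
  proof
    assume "even u3"
    hence "even u1" "even u2" "odd t" using parity prim by auto
    hence "4 dvd d2 * u2^2" "4 dvd d3 * u3^2" using \<open>even u3\<close> by (auto elim!: evenE simp: power2_eq_square)
    hence "2^2 dvd t^2 * a1" using dvd_add_diff_iff(2)[OF mod_4(1)] by (simp add: mult.commute)
    moreover have "coprime (2^2) (t^2)"
      using \<open>odd t\<close> by (metis coprime_left_2_iff_odd coprime_power_left_iff coprime_power_right_iff)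
    ultimately show False using a(2) by (simp add: coprime_dvd_mult_right_iff)
  qed
  hence "odd u1" "odd u2" using parity by auto
  hence squares: "[u1^2 = 1] (mod 4)" "[u2^2 = 1] (mod 4)"
    using odd_square_cong_1_mod_4 by blast+
  have "4 dvd a3 * t^2" using a(4) by simp
  hence "4 dvd (a3 * t^2 + d1 * u1^2 - d2 * u2^2) - a3 * t^2" using mod_4(2) by (rule dvd_diff[rotated])
  hence "[d1 * u1^2 = d2 * u2^2] (mod 4)" by (simp add: cong_iff_dvd_diff)
  hence "[d1 * 1 = d2 * 1] (mod 4)"
    using cong_mult[OF cong_refl squares(1), of d1] cong_mult[OF cong_refl squares(2), of d2] cong_trans cong_sym by meson
  hence "[d1 * d2 * d3 = d2 * d2 * d3] (mod 4)" by (intro cong_mult cong_refl) simp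
  moreover obtain s where s: "d1 * d2 * d3 = s^2" using square by (rule is_nth_powerE)
  moreover from this have "odd s" using odd by (metis even_mult_iff even_power zero_less_numeral)
  hence "[s^2 = 1] (mod 4)" by (rule odd_square_cong_1_mod_4)
  moreover have "[d2^2 * d3 = 1 * d3] (mod 4)"
    by (rule cong_mult[OF odd_square_cong_1_mod_4[OF odd(2)] cong_refl])
  ultimately have "[d3 = 1] (mod 4)" by (metis cong_sym cong_trans mult_1 power2_eq_square)
  thus ?thesis by (simp add: cong_def)
qed

subsection \<open>The Selmer group and its 2-torsion classes\<close>

lemma sqf_eq_squarefree_part:
  assumes "x \<noteq> 0"
  shows "sqf x = squarefree_part x"
  unfolding sqf_def
proof (rule the_equality)
  show "squarefree (squarefree_part x) \<and> (\<exists>s. x = squarefree_part x * s^2)"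
    using squarefree_decompose[of x] by auto
  fix d assume "squarefree d \<and> (\<exists>s. x = d * s^2)"
  then obtain s where d: "squarefree d" "x = d * s^2" by blast
  hence "d \<noteq> 0" "s \<noteq> 0" using assms by auto
  thus "d = squarefree_part x" using d by (simp add: squarefree_part_mult_square squarefree_part_of_squarefree)
qed

lemma sqf_of_squarefree:
  assumes "squarefree d"
  shows "sqf d = d"
proof -
  have "d \<noteq> 0" using assms by auto
  thus ?thesis using assms by (simp add: sqf_eq_squarefree_part squarefree_part_of_squarefree)
qed

lemma ex_less_4: "(\<exists>i<4::nat. P i) \<longleftrightarrow> P 0 \<or> P 1 \<or> P 2 \<or> P 3"
  by (auto simp: numeral_eq_Suc less_Suc_eq)

lemma padic_sol_D_eqs_iff:
  "padic_sol p 4 (D_eqs e1 e2 e3 m (d1, d2, d3)) \<longleftrightarrow>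
     locally_soluble (int p) (e1 * m) (e2 * m) (e3 * m) d1 d2 d3"
proof -
  have "(\<exists>x::nat \<Rightarrow> int. (\<exists>i<4. \<not> int p dvd x i) \<and>
          (\<forall>v\<in>set (D_eqs e1 e2 e3 m (d1, d2, d3) x). int p ^ N dvd v)) \<longleftrightarrow>
        (\<exists>t u1 u2 u3. primitive (int p) t u1 u2 u3 \<and>
          covering_eqs (int p ^ N) (e1 * m) (e2 * m) (e3 * m) d1 d2 d3 t u1 u2 u3)" (is "?L \<longleftrightarrow> ?R") for N
  proof
    assume ?L
    then obtain x :: "nat \<Rightarrow> int" where "\<exists>i<4. \<not> int p dvd x i"
      "\<forall>v\<in>set (D_eqs e1 e2 e3 m (d1, d2, d3) x). int p ^ N dvd v" by blast
    thus ?R unfolding ex_less_4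
      by (intro exI[of _ "x 0"] exI[of _ "x 1"] exI[of _ "x 2"] exI[of _ "x 3"])
        (simp add: D_eqs_def covering_eqs_def)
  next
    assume ?R
    then obtain t u1 u2 u3 where "primitive (int p) t u1 u2 u3"
      "covering_eqs (int p ^ N) (e1 * m) (e2 * m) (e3 * m) d1 d2 d3 t u1 u2 u3" by blast
    thus ?L unfolding ex_less_4
      by (intro exI[of _ "\<lambda>i. if i = 0 then t else if i = 1 then u1 else if i = 2 then u2 else u3"])
        (auto simp: D_eqs_def covering_eqs_def)
  qed
  thus ?thesis unfolding padic_sol_def locally_soluble_def by blast
qed

lemma sum_squares_eq_negative_imp_zero:
  fixes a b c x y z :: real
  assumes "a > 0" "b > 0" "c < 0" "a * x^2 + b * y^2 = c * z^2"
  shows "x = 0 \<and> y = 0 \<and> z = 0"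
proof -
  have "a * x^2 \<ge> 0" "b * y^2 \<ge> 0" "c * z^2 \<le> 0" using assms by (auto intro: mult_nonpos_nonneg)
  hence "a * x^2 = 0 \<and> b * y^2 = 0 \<and> c * z^2 = 0" using assms(4) by linarith
  thus ?thesis using assms by simp
qed

lemma real_sol_D_eqs_imp_pos:
  assumes "e1 * m < 0" "e3 * m > 0" "d1 * d2 * d3 > 0" "real_sol 4 (D_eqs e1 e2 e3 m (d1, d2, d3))"
  shows "d2 > 0"
proof -
  obtain x :: "nat \<Rightarrow> real" where x: "x 0 \<noteq> 0 \<or> x 1 \<noteq> 0 \<or> x 2 \<noteq> 0 \<or> x 3 \<noteq> 0"
    and eqs: "e1 * m * (x 0)^2 + d2 * (x 2)^2 = d3 * (x 3)^2" "e3 * m * (x 0)^2 + d1 * (x 1)^2 = d2 * (x 2)^2"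
    using assms(4) unfolding real_sol_def D_eqs_def ex_less_4 by auto
  show ?thesis
  proof (rule ccontr)
    assume "\<not> d2 > 0"
    hence "d2 < 0" "d1 * d3 < 0"
      using assms(3) by (auto simp: zero_less_mult_iff mult_less_0_iff not_less_iff_gr_or_eq)
    then consider (d1_pos) "d1 > 0" "d3 < 0" | (d1_neg) "d1 < 0" "d3 > 0" by (auto simp: mult_less_0_iff)
    thus False
    proof cases
      case d1_pos
      hence "x 0 = 0 \<and> x 1 = 0 \<and> x 2 = 0"
        using eqs(2) assms(2) \<open>d2 < 0\<close> by (intro sum_squares_eq_negative_imp_zero) (simp_all flip: of_int_mult)
      thus False using x eqs(1) d1_pos by simp
    next
      case d1_neg
      have "- (e1 * m) * (x 0)^2 + d3 * (x 3)^2 = d2 * (x 2)^2" using eqs(1) by simp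
      hence "x 0 = 0 \<and> x 3 = 0 \<and> x 2 = 0"
        using assms(1) d1_neg \<open>d2 < 0\<close> by (intro sum_squares_eq_negative_imp_zero[of "- real_of_int (e1 * m)" d3 d2])
          (simp_all flip: of_int_mult)
      thus False using x eqs(2) d1_neg by simp
    qed
  qed
qed

lemma real_sol_D_eqsI:
  assumes "e1 + e2 + e3 = 0" "e1 * m < 0" "e3 * m > 0" "d1 * d2 * d3 > 0" "d2 > 0"
  shows "real_sol 4 (D_eqs e1 e2 e3 m (d1, d2, d3))"
proof -
  have "d1 * d3 > 0" using assms(4,5) by (metis mult.commute mult.assoc zero_less_mult_pos)
  then consider (pos) "d1 > 0" "d3 > 0" | (neg) "d1 < 0" "d3 < 0" by (auto simp: zero_less_mult_iff)
  thus ?thesis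
  proof cases
    case pos
    thus ?thesis unfolding real_sol_def ex_less_4 D_eqs_def using assms(5)
      by (intro exI[of _ "\<lambda>i. if i = 0 then 0 else 1 / sqrt (if i = 1 then d1 else if i = 2 then d2 else d3)"])
        (simp add: power_divide)
  next
    case neg
    define u1 u3 where "u1 = sqrt (e3 * m / (- d1))" and "u3 = sqrt (e1 * m / d3)"
    have "real_of_int (e3 * m) / (- d1) \<ge> 0" "real_of_int (e1 * m) / d3 \<ge> 0"
      using neg assms(2,3) by (simp_all add: divide_nonneg_neg divide_nonpos_neg less_imp_le del: of_int_mult)
    hence "d1 * u1^2 = - (e3 * m)" "d3 * u3^2 = e1 * m" unfolding u1_def u3_def using neg by simp_all
    moreover have "real_of_int (e1 * m) + e2 * m + e3 * m = 0"
      using assms(1) by (metis distrib_right mult_zero_left of_int_0 of_int_add of_int_mult)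
    ultimately show ?thesis unfolding real_sol_def ex_less_4 D_eqs_def
      by (intro exI[of _ "\<lambda>i. if i = 0 then 1 else if i = 1 then u1 else if i = 2 then 0 else u3"]) simp
  qed
qed

lemma all_prime_int_iff: "(\<forall>q::int. prime q \<longrightarrow> P q) \<longleftrightarrow> (\<forall>p::nat. prime p \<longrightarrow> P (int p))"
  by (metis prime_int_nat_transfer prime_nat_int_transfer prime_ge_0_int int_nat_eq)

definition parity :: "triple \<Rightarrow> bool \<times> bool" where
  "parity L = (case L of (d1, d2, d3) \<Rightarrow> (even d2, even d3))"

abbreviation odd_rep :: "triple \<Rightarrow> bool" where
  "odd_rep L \<equiv> parity L = (False, False)"

lemma even_sqf_iff: "x \<noteq> 0 \<Longrightarrow> even (sqf x) \<longleftrightarrow> odd (multiplicity 2 x)"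
  by (simp add: sqf_eq_squarefree_part prime_dvd_squarefree_part_iff)

lemma parity_tmul:
  assumes "squarefree d2" "squarefree d3" "squarefree c2" "squarefree c3"
  shows "parity (tmul (d1, d2, d3) (c1, c2, c3)) = (even d2 \<noteq> even c2, even d3 \<noteq> even c3)"
proof -
  have "even (sqf (d * c)) \<longleftrightarrow> even d \<noteq> even c" if "squarefree d" "squarefree c" for d c :: int
  proof -
    have "d \<noteq> 0" "c \<noteq> 0" using that by auto
    thus ?thesis using that by (auto simp: even_sqf_iff prime_multiplicity_mult squarefree_multiplicity)
  qed
  thus ?thesis using assms by (simp add: tmul_def parity_def)
qed

locale two_descent =
  fixes e1 e2 e3 :: int
  assumes e_sum: "e1 + e2 + e3 = 0"
    and e1_mod_4: "2 dvd e1" "\<not> 4 dvd e1" and e2_mod_4: "2 dvd e2" "\<not> 4 dvd e2" and e3_mod_4: "4 dvd e3"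
    and e1_neg: "e1 < 0" and e3_pos: "0 < e3"
begin

abbreviation twist_soluble :: "int \<Rightarrow> int \<Rightarrow> int \<Rightarrow> int \<Rightarrow> int \<Rightarrow> bool" where
  "twist_soluble m q \<equiv> locally_soluble q (e1 * m) (e2 * m) (e3 * m)"

lemma e_nonzero: "e1 \<noteq> 0" "e2 \<noteq> 0" "e3 \<noteq> 0"
  using e1_neg e3_pos e2_mod_4(2) by auto

lemma multiplicity_2_e: "multiplicity 2 e1 = 1" "multiplicity 2 e2 = 1"
  using e1_mod_4 e2_mod_4 by (auto intro!: multiplicity_eqI)

lemma twisted_sum: "e1 * m + e2 * m + e3 * m = 0"
  using e_sum by (metis distrib_right mult_zero_left)

lemma Sel2_iff:
  assumes "m > 0"
  shows "(d1, d2, d3) \<in> Sel2 e1 e2 e3 m \<longleftrightarrow>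
    squarefree d1 \<and> squarefree d2 \<and> squarefree d3 \<and> is_square (d1 * d2 * d3) \<and> d2 > 0 \<and>
    (\<forall>q. prime q \<longrightarrow> twist_soluble m q d1 d2 d3)"
proof -
  have signs: "e1 * m < 0" "e3 * m > 0" using assms e1_neg e3_pos by (simp_all add: mult_neg_pos)
  have "d1 * d2 * d3 > 0" if "squarefree d1" "squarefree d2" "squarefree d3" "d1 * d2 * d3 = s^2" for s
  proof -
    have "d1 * d2 * d3 \<noteq> 0" using that(1-3) by auto
    thus ?thesis using that(4) by simp
  qed
  hence "real_sol 4 (D_eqs e1 e2 e3 m (d1, d2, d3)) \<longleftrightarrow> d2 > 0"
    if "squarefree d1" "squarefree d2" "squarefree d3" "d1 * d2 * d3 = s^2" for s
    using real_sol_D_eqs_imp_pos[OF signs] real_sol_D_eqsI[OF e_sum signs] that by blast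
  thus ?thesis
    unfolding Sel2_def D_adelic_def is_nth_power_def all_prime_int_iff padic_sol_D_eqs_iff by auto
qed

lemma Sel2E:
  assumes "L \<in> Sel2 e1 e2 e3 m" "m > 0"
  obtains d1 d2 d3 where "L = (d1, d2, d3)" "squarefree d1" "squarefree d2" "squarefree d3"
    "is_square (d1 * d2 * d3)" "d2 > 0" "\<And>q. prime q \<Longrightarrow> twist_soluble m q d1 d2 d3"
proof (cases L)
  case (fields d1 d2 d3)
  thus ?thesis using that assms by (simp add: Sel2_iff)
qed

lemma twist_mod_4:
  assumes "odd m"
  shows "2 dvd e1 * m" "\<not> 4 dvd e1 * m" "2 dvd e2 * m" "\<not> 4 dvd e2 * m" "4 dvd e3 * m"
proof -
  have "coprime (2 * 2) m" unfolding coprime_mult_left_iff using assms by simp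
  hence "coprime 4 m" by simp
  thus "\<not> 4 dvd e1 * m" "\<not> 4 dvd e2 * m" using e1_mod_4 e2_mod_4 by (simp_all add: coprime_dvd_mult_left_iff)
qed (use e1_mod_4 e2_mod_4 e3_mod_4 in auto)

lemma mem_Sel2_of_odd_places:
  assumes "odd m" "m > 0"
    and odd: "odd d1" "odd d2" "odd d3" and d: "squarefree d1" "squarefree d2" "squarefree d3"
    and square: "is_square (d1 * d2 * d3)" and d2: "d2 > 0" and d3: "d3 mod 4 = 1"
    and sol: "\<And>q. prime q \<Longrightarrow> 2 < q \<Longrightarrow> twist_soluble m q d1 d2 d3"
  shows "(d1, d2, d3) \<in> Sel2 e1 e2 e3 m"
proof -
  have "e1 * m < 0" using assms(2) e1_neg by (simp add: mult_neg_pos)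
  hence "twist_soluble m 2 d1 d2 d3"
    using locally_soluble_2_of_other_places[OF twisted_sum twist_mod_4(1-4)[OF assms(1)] odd square d3 _ d2 sol]
    by blast
  hence "twist_soluble m q d1 d2 d3" if "prime q" for q
    using sol that prime_ge_2_int[OF that] by (cases "q = 2") auto
  thus ?thesis using assms by (simp add: Sel2_iff)
qed

lemma Sel2_first_component:
  assumes "(d1, d2, d3) \<in> Sel2 e1 e2 e3 m" "m > 0"
  shows "d1 = squarefree_part (d2 * d3)"
proof -
  have d: "squarefree d1" "squarefree d2" "squarefree d3" "is_square (d1 * (d2 * d3))"
    using assms by (simp_all add: Sel2_iff mult.assoc)
  hence "d1 \<noteq> 0" "d2 * d3 \<noteq> 0" by auto
  hence "squarefree_part d1 = squarefree_part (d2 * d3)" using squarefree_part_eq_iff d(4) by blast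
  thus ?thesis using squarefree_part_of_squarefree[OF d(1)] by simp
qed

lemma one_in_Sel2:
  assumes "m > 0"
  shows "(1, 1, 1) \<in> Sel2 e1 e2 e3 m"
proof -
  have "twist_soluble m q 1 1 1" if "prime q" for q
    unfolding locally_soluble_def covering_eqs_def using that not_prime_unit[of q]
    by (intro allI exI[of _ 0] exI[of _ 1]) auto
  thus ?thesis using assms by (simp add: Sel2_iff)
qed

lemma Sel2_unramified:
  assumes "(d1, d2, d3) \<in> Sel2 e1 e2 e3 m" "m > 0" "prime q" "\<not> q dvd e1 * e2 * e3" "\<not> q dvd m"
  shows "\<not> q dvd d1" "\<not> q dvd d2" "\<not> q dvd d3"
proof -
  have good: "\<not> q dvd e1 * m" "\<not> q dvd e2 * m" "\<not> q dvd e3 * m"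
    using assms(3-5) by (auto simp: prime_dvd_mult_iff)
  have d: "squarefree d1" "squarefree d2" "squarefree d3" "is_square (d1 * d2 * d3)"
    and sol: "twist_soluble m q d1 d2 d3"
    using assms(1-3) by (simp_all add: Sel2_iff)
  have rotated: "is_square (d2 * d3 * d1)" "is_square (d3 * d1 * d2)" using d(4) by (simp_all add: mult_ac)
  show "\<not> q dvd d2" by (rule locally_soluble_imp_not_dvd[OF assms(3) good(1,3) d sol])
  have sol': "locally_soluble q (e2 * m) (e3 * m) (e1 * m) d2 d3 d1" by (rule locally_soluble_rotate[OF sol])
  show "\<not> q dvd d3" by (rule locally_soluble_imp_not_dvd[OF assms(3) good(2,1) d(2,3,1) rotated(1) sol'])
  show "\<not> q dvd d1"
    by (rule locally_soluble_imp_not_dvd[OF assms(3) good(3,2) d(3,1,2) rotated(2) locally_soluble_rotate[OF sol']])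
qed

lemma parity_Tors:
  assumes "odd m"
  shows "parity (1, 1, 1) = (False, False)"
    "parity (tsqf (- e3 * m, - e1 * e3, e1 * m)) = (even (multiplicity 2 e3), True)"
    "parity (tsqf (- e2 * e3, e3 * m, - e2 * m)) = (odd (multiplicity 2 e3), True)"
    "parity (tsqf (e2 * m, - e1 * m, - e1 * e2)) = (True, False)"
proof -
  have "m \<noteq> 0" using assms by auto
  thus "parity (1, 1, 1) = (False, False)"
    "parity (tsqf (- e3 * m, - e1 * e3, e1 * m)) = (even (multiplicity 2 e3), True)"
    "parity (tsqf (- e2 * e3, e3 * m, - e2 * m)) = (odd (multiplicity 2 e3), True)"
    "parity (tsqf (e2 * m, - e1 * m, - e1 * e2)) = (True, False)"
    using assms e_nonzero multiplicity_2_e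
    by (simp_all add: parity_def tsqf_def even_sqf_iff prime_multiplicity_mult not_dvd_imp_multiplicity_0)
qed

lemma bij_betw_parity_Tors:
  assumes "odd m"
  shows "bij_betw parity (Tors e1 e2 e3 m) UNIV"
  unfolding bij_betw_def
proof
  show "inj_on parity (Tors e1 e2 e3 m)"
    unfolding Tors_def inj_on_def using parity_Tors[OF assms] by auto
  have "parity ` Tors e1 e2 e3 m =
      {(False, False), (even (multiplicity 2 e3), True), (odd (multiplicity 2 e3), True), (True, False)}"
    unfolding Tors_def image_insert image_empty parity_Tors[OF assms] ..
  thus "parity ` Tors e1 e2 e3 m = UNIV" unfolding UNIV_bool UNIV_Times_UNIV[symmetric] by auto
qed

lemma squarefree_Tors:
  assumes "(c1, c2, c3) \<in> Tors e1 e2 e3 m" "m \<noteq> 0"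
  shows "squarefree c1" "squarefree c2" "squarefree c3"
  using assms e_nonzero by (auto simp: Tors_def tsqf_def sqf_eq_squarefree_part)

lemma unique_odd_rep:
  assumes "odd m" "squarefree d2" "squarefree d3"
  shows "\<exists>!L'. L' \<in> sel_class e1 e2 e3 m (d1, d2, d3) \<and> odd_rep L'"
proof -
  have odd_iff: "odd_rep (tmul (d1, d2, d3) T) \<longleftrightarrow> parity T = (even d2, even d3)" if "T \<in> Tors e1 e2 e3 m" for T
  proof (cases T)
    case (fields c1 c2 c3)
    moreover have "m \<noteq> 0" using assms(1) by auto
    ultimately show ?thesis
      using parity_tmul[OF assms(2,3)] squarefree_Tors that by (auto simp: parity_def)
  qed
  have inj: "inj_on parity (Tors e1 e2 e3 m)" and surj: "parity ` Tors e1 e2 e3 m = UNIV"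
    using bij_betw_parity_Tors[OF assms(1)] by (simp_all add: bij_betw_def)
  obtain T where T: "T \<in> Tors e1 e2 e3 m" "parity T = (even d2, even d3)"
    using surj by (metis UNIV_I imageE)
  show ?thesis
  proof (rule ex1I)
    show "tmul (d1, d2, d3) T \<in> sel_class e1 e2 e3 m (d1, d2, d3) \<and> odd_rep (tmul (d1, d2, d3) T)"
      using T odd_iff by (simp add: sel_class_def)
    fix L' assume "L' \<in> sel_class e1 e2 e3 m (d1, d2, d3) \<and> odd_rep L'"
    then obtain T' where T': "T' \<in> Tors e1 e2 e3 m" "L' = tmul (d1, d2, d3) T'" "parity T' = (even d2, even d3)"
      using odd_iff by (auto simp: sel_class_def)
    hence "T' = T" using T inj by (metis inj_onD)
    thus "L' = tmul (d1, d2, d3) T" using T' by simp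
  qed
qed

lemma tmul_tsqf_in_Sel2:
  assumes "m > 0" "(d1, d2, d3) \<in> Sel2 e1 e2 e3 m"
    and x: "x1 \<noteq> 0" "x2 > 0" "x3 \<noteq> 0" "is_square (x1 * x2 * x3)"
    and sol: "\<And>q. prime q \<Longrightarrow> twist_soluble m q
      (squarefree_part (d1 * x1)) (squarefree_part (d2 * x2)) (squarefree_part (d3 * x3))"
  shows "tmul (d1, d2, d3) (tsqf (x1, x2, x3)) \<in> Sel2 e1 e2 e3 m"
proof -
  have d: "squarefree d1" "squarefree d2" "squarefree d3" "is_square (d1 * d2 * d3)" "d2 > 0"
    using assms(1,2) by (simp_all add: Sel2_iff)
  have nz: "d1 \<noteq> 0" "d2 \<noteq> 0" "d3 \<noteq> 0" "x2 \<noteq> 0" using d x(2) by auto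
  have tmul: "tmul (d1, d2, d3) (tsqf (x1, x2, x3)) =
      (squarefree_part (d1 * x1), squarefree_part (d2 * x2), squarefree_part (d3 * x3))"
    using nz x by (simp add: tmul_def tsqf_def sqf_eq_squarefree_part squarefree_part_mult_squarefree_part)
  have "(d1 * x1) * (d2 * x2) * (d3 * x3) = (d1 * d2 * d3) * (x1 * x2 * x3)" by simp
  hence "is_square (squarefree_part (d1 * x1) * squarefree_part (d2 * x2) * squarefree_part (d3 * x3))"
    using nz x d(4) by (subst is_square_squarefree_parts_iff) (simp_all only: is_nth_power_mult mult_eq_0_iff simp_thms)
  moreover have "sgn (squarefree_part (d2 * x2)) = 1" using nz d(5) x(2) by (simp add: sgn_squarefree_part)
  ultimately show ?thesis using assms(1) sol unfolding tmul by (simp add: Sel2_iff sgn_1_pos)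
qed

lemma tmul_one:
  assumes "squarefree d1" "squarefree d2" "squarefree d3"
  shows "tmul (d1, d2, d3) (1, 1, 1) = (d1, d2, d3)"
  using assms by (simp add: tmul_def sqf_of_squarefree)

lemma sel_class_subset_Sel2:
  assumes "m > 0" "L \<in> Sel2 e1 e2 e3 m"
  shows "sel_class e1 e2 e3 m L \<subseteq> Sel2 e1 e2 e3 m"
proof -
  obtain d1 d2 d3 where L: "L = (d1, d2, d3)" and d: "squarefree d1" "squarefree d2" "squarefree d3"
    "is_square (d1 * d2 * d3)"
    and sol: "\<And>q. prime q \<Longrightarrow> twist_soluble m q d1 d2 d3"
    using Sel2E[OF assms(2,1)] by metis
  have in_Sel2: "(d1, d2, d3) \<in> Sel2 e1 e2 e3 m" using assms(2) L by simp
  have nz: "m \<noteq> 0" "d1 \<noteq> 0" "d2 \<noteq> 0" "d3 \<noteq> 0" using d assms(1) by auto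
  note translates = locally_soluble_torsion_translates[OF _ e_sum e_nonzero nz d(4) sol]
  have "tmul L (1, 1, 1) = L" unfolding L by (rule tmul_one[OF d(1-3)])
  moreover have "tmul L (tsqf (e2 * m, - e1 * m, - e1 * e2)) \<in> Sel2 e1 e2 e3 m"
    unfolding L
  proof (rule tmul_tsqf_in_Sel2[OF assms(1) in_Sel2 _ _ _ _ translates(1)])
    show "- e1 * m > 0" using assms(1) e1_neg by (simp add: mult_neg_pos)
    show "is_square (e2 * m * (- e1 * m) * (- e1 * e2))"
      by (rule is_nth_powerI[of _ "e1 * e2 * m"]) (simp add: power2_eq_square)
  qed (use e_nonzero nz in simp_all)
  moreover have "tmul L (tsqf (- e2 * e3, e3 * m, - e2 * m)) \<in> Sel2 e1 e2 e3 m"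
    unfolding L
  proof (rule tmul_tsqf_in_Sel2[OF assms(1) in_Sel2 _ _ _ _ translates(2)])
    show "e3 * m > 0" using assms(1) e3_pos by simp
    show "is_square (- e2 * e3 * (e3 * m) * (- e2 * m))"
      by (rule is_nth_powerI[of _ "e2 * e3 * m"]) (simp add: power2_eq_square)
  qed (use e_nonzero nz in simp_all)
  moreover have "tmul L (tsqf (- e3 * m, - e1 * e3, e1 * m)) \<in> Sel2 e1 e2 e3 m"
    unfolding L
  proof (rule tmul_tsqf_in_Sel2[OF assms(1) in_Sel2 _ _ _ _ translates(3)])
    show "- e1 * e3 > 0" using e1_neg e3_pos by (simp add: mult_neg_pos)
    show "is_square (- e3 * m * (- e1 * e3) * (e1 * m))"
      by (rule is_nth_powerI[of _ "e1 * e3 * m"]) (simp add: power2_eq_square)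
  qed (use e_nonzero nz in simp_all)
  ultimately show ?thesis using assms(2) unfolding sel_class_def Tors_def by simp
qed

lemma Sel2_eq_Tors:
  assumes "odd m" "m > 0" "card (Sel2 e1 e2 e3 m) = 4"
  shows "Sel2 e1 e2 e3 m = Tors e1 e2 e3 m"
proof -
  have "tmul (1, 1, 1) T = T" if "T \<in> Tors e1 e2 e3 m" for T
    using squarefree_Tors that assms(2) by (cases T) (simp add: tmul_def sqf_of_squarefree)
  hence "Tors e1 e2 e3 m = sel_class e1 e2 e3 m (1, 1, 1)" by (simp add: sel_class_def)
  also have "\<dots> \<subseteq> Sel2 e1 e2 e3 m" by (intro sel_class_subset_Sel2 one_in_Sel2 assms(2))
  finally have "Tors e1 e2 e3 m \<subseteq> Sel2 e1 e2 e3 m" .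
  moreover have "card (Tors e1 e2 e3 m) = 4"
    using bij_betw_same_card[OF bij_betw_parity_Tors[OF assms(1)]]
    by (simp add: UNIV_Times_UNIV[symmetric] card_cartesian_product del: UNIV_Times_UNIV)
  moreover have "finite (Sel2 e1 e2 e3 m)" using assms(3) by (metis card.infinite zero_neq_numeral)
  ultimately show ?thesis using assms(3) by (intro card_subset_eq[symmetric]) auto
qed

lemma odd_rep_Tors:
  assumes "odd m" "T \<in> Tors e1 e2 e3 m" "odd_rep T"
  shows "T = (1, 1, 1)"
proof -
  have "(1, 1, 1) \<in> Tors e1 e2 e3 m" by (simp add: Tors_def)
  thus ?thesis using bij_betw_parity_Tors[OF assms(1)] assms(2,3) parity_Tors(1)[OF assms(1)]
    by (metis bij_betw_imp_inj_on inj_onD)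
qed

end

subsection \<open>The twist by a product of residues\<close>

locale quadratic_twist = two_descent +
  fixes n k :: nat and p :: "nat \<Rightarrow> nat"
  assumes prime_p: "\<forall>i<k. prime (p i)" and inj_p: "inj_on p {..<k}"
    and n_def: "n = (\<Prod>i<k. p i)" and odd_n: "odd n"
    and coprime_n: "coprime (int n) (e1 * e2 * e3)"
    and residues: "\<forall>i<k. \<forall>q::nat. prime q \<and> odd q \<and> int q dvd e1 * e2 * e3 \<longrightarrow> QuadRes (int q) (int (p i))"
    and star_residues: "\<forall>i<k. \<forall>q::nat. prime q \<and> odd q \<and> int q dvd e1 * e3 \<longrightarrow> Legendre (pstar (p i)) (int q) = 1"
    and card_Sel2: "card (Sel2 e1 e2 e3 1) = 4"
begin

lemma n_pos: "n > 0"
  using odd_n by (cases n) auto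

lemma int_n_pos: "int n > 0"
  using n_pos by simp

lemma prime_int_p: "i < k \<Longrightarrow> prime (int (p i))"
  using prime_p by simp

lemma p_dvd_n: "i < k \<Longrightarrow> int (p i) dvd int n"
  unfolding n_def of_nat_prod by (rule dvd_prodI) simp_all

lemma p_gt_2:
  assumes "i < k"
  shows "2 < int (p i)"
proof -
  have "odd (p i)" using p_dvd_n[OF assms] odd_n by (metis dvd_trans int_dvd_int_iff)
  hence "p i \<noteq> 2" by auto
  thus ?thesis using prime_p assms prime_ge_2_nat[of "p i"] by simp
qed

lemma p_distinct: "i < k \<Longrightarrow> j < k \<Longrightarrow> int (p i) dvd int (p j) \<longleftrightarrow> i = j"
  using prime_p inj_p primes_dvd_imp_eq[of "p i" "p j"] by (auto simp: inj_on_def)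

lemma prime_dvd_n_iff:
  assumes "prime q"
  shows "q dvd int n \<longleftrightarrow> (\<exists>i<k. q = int (p i))"
proof -
  have "q dvd int n \<longleftrightarrow> (\<exists>i<k. q dvd int (p i))"
    unfolding n_def using assms by (simp add: prime_dvd_prod_iff Bex_def)
  thus ?thesis using primes_dvd_imp_eq[OF assms prime_int_p] by (metis dvd_refl)
qed

lemma squarefree_n: "squarefree (int n)"
  unfolding n_def of_nat_prod
proof (rule squarefree_prod_coprime)
  show "coprime (int (p i)) (int (p j))" if "i \<in> {..<k}" "j \<in> {..<k}" "i \<noteq> j" for i j
    using that prime_int_p p_distinct by (intro prime_imp_coprime) auto
  show "squarefree (int (p i))" if "i \<in> {..<k}" for i
    using that prime_int_p by (auto intro: squarefree_prime)
qed

lemma squarefree_divisor: "d dvd int n \<Longrightarrow> squarefree d"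
  using squarefree_mono squarefree_n by blast

lemma odd_divisor: "d dvd int n \<Longrightarrow> odd d"
  using odd_n by (metis dvd_trans even_of_nat)

lemma not_dvd_n: "prime q \<Longrightarrow> q dvd e1 * e2 * e3 \<Longrightarrow> \<not> q dvd int n"
  using coprime_n by (metis coprime_common_divisor not_prime_unit)

lemma pstar_eq:
  assumes "i < k"
  shows "pstar (p i) = chi4 (int (p i)) * int (p i)"
proof -
  have "odd (p i)" using odd_prime_int[OF prime_int_p p_gt_2] assms by simp
  thus ?thesis by (simp only: pstar_def minus_one_power_half_eq_chi4 not_False_eq_True)
qed

definition prime_prod :: "(nat \<Rightarrow> nat) \<Rightarrow> int" where
  "prime_prod f = (\<Prod>j<k. int (p j) ^ f j)"

definition star_prod :: "(nat \<Rightarrow> nat) \<Rightarrow> int" where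
  "star_prod f = (\<Prod>j<k. pstar (p j) ^ f j)"

lemma prime_prod_pos: "prime_prod f > 0"
  unfolding prime_prod_def using p_gt_2 by (intro prod_pos) force

lemma abs_star_prod: "\<bar>star_prod f\<bar> = prime_prod f"
proof -
  have "\<bar>pstar (p j)\<bar> = int (p j)" if "j < k" for j
    using chi4_values[of "int (p j)"] pstar_eq[OF that] by (auto simp: abs_mult)
  thus ?thesis by (simp add: star_prod_def prime_prod_def abs_prod power_abs)
qed

lemma star_prod_mod_4: "star_prod f mod 4 = 1"
proof -
  have "[pstar (p j) = 1] (mod 4)" if "j < k" for j
    using odd_mod_4[OF odd_prime_int[OF prime_int_p[OF that] p_gt_2[OF that]]] pstar_eq[OF that]
    by (auto simp: chi4_def cong_def zmod_zminus1_eq_if)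
  hence "[star_prod f = (\<Prod>j<k. 1 ^ f j)] (mod 4)"
    unfolding star_prod_def by (intro cong_prod cong_pow) simp
  thus ?thesis by (simp add: cong_def)
qed

lemma multiplicity_prime_prod:
  assumes "i < k"
  shows "multiplicity (int (p i)) (prime_prod f) = f i"
proof -
  have prime: "prime_elem (int (p i))" using prime_int_p assms by blast
  have nz: "p j \<noteq> 0" if "j < k" for j using p_gt_2[OF that] by simp
  have "multiplicity (int (p i)) (prime_prod f) = (\<Sum>j<k. f j * multiplicity (int (p i)) (int (p j)))"
    unfolding prime_prod_def using nz
    by (subst prime_elem_multiplicity_prod_distrib[OF prime])
      (auto simp: prime_elem_multiplicity_power_distrib[OF prime] dest: nz)
  also have "\<dots> = (\<Sum>j<k. if j = i then f i else 0)"
    using p_distinct[OF assms] prime_multiplicity_self[OF prime_int_p[OF assms]]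
    by (intro sum.cong refl) (auto simp: not_dvd_imp_multiplicity_0)
  finally show ?thesis using assms by simp
qed

lemma prime_prod_dvd_n:
  assumes "\<And>j. j < k \<Longrightarrow> f j \<le> 1"
  shows "prime_prod f dvd int n"
  unfolding prime_prod_def n_def of_nat_prod
proof (rule prod_dvd_prod)
  fix j assume "j \<in> {..<k}"
  hence "f j = 0 \<or> f j = 1" using assms[of j] by auto
  thus "int (p j) ^ f j dvd int (p j)" by auto
qed

lemma pos_divisor_eq_prime_prod:
  assumes "d > 0" "d dvd int n"
  shows "d = prime_prod (\<lambda>j. multiplicity (int (p j)) d)" (is "d = ?D")
proof -
  have "multiplicity q d = multiplicity q ?D" if q: "prime q" for q
  proof (cases "\<exists>i<k. q = int (p i)")
    case True
    thus ?thesis using multiplicity_prime_prod by auto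
  next
    case False
    hence "\<not> q dvd d" using assms(2) prime_dvd_n_iff[OF q] dvd_trans by blast
    moreover have "\<not> q dvd ?D"
      using False q primes_dvd_imp_eq[OF q prime_int_p]
      by (auto simp: prime_prod_def prime_dvd_prod_iff dest!: prime_dvd_power)
    ultimately show ?thesis by (simp add: not_dvd_imp_multiplicity_0)
  qed
  hence "normalize d = normalize ?D"
    using assms(1) prime_prod_pos by (intro multiplicity_eq_imp_eq) (auto simp: less_le)
  thus ?thesis using assms(1) prime_prod_pos by (simp add: less_imp_le)
qed

lemma divisor_eq_star_prod:
  assumes "d mod 4 = 1" "d dvd int n"
  shows "d = star_prod (\<lambda>j. multiplicity (int (p j)) d)" (is "d = ?D")
proof -
  have abs: "multiplicity q \<bar>d\<bar> = multiplicity q d" for q :: int by (cases "d \<ge> 0") simp_all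
  have "\<bar>d\<bar> > 0" using assms(1) by auto
  hence "\<bar>d\<bar> = prime_prod (\<lambda>j. multiplicity (int (p j)) \<bar>d\<bar>)"
    using assms(2) by (intro pos_divisor_eq_prime_prod) simp_all
  hence "\<bar>d\<bar> = \<bar>?D\<bar>" unfolding abs abs_star_prod .
  moreover have "?D mod 4 = 1" by (rule star_prod_mod_4)
  ultimately show ?thesis using assms(1) eq_if_abs_eq_mod_4 by blast
qed

context
  fixes q :: int
  assumes prime_q: "prime q" and q_gt_2: "2 < q"
begin

lemma Legendre_pos_divisor:
  assumes "q dvd e1 * e2 * e3" "d > 0" "d dvd int n"
  shows "Legendre d q = 1"
proof -
  obtain r where r: "q = int r" "prime r" "odd r" by (rule odd_prime_int_natE[OF prime_q q_gt_2])
  have "Legendre (int (p j)) q = 1" if "j < k" for j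
  proof -
    have "\<not> q dvd int (p j)" using not_dvd_n[OF prime_q assms(1)] p_dvd_n[OF that] dvd_trans by blast
    moreover have "QuadRes q (int (p j))" using residues r assms(1) that by blast
    ultimately show ?thesis by (simp add: Legendre_eq_1_iff)
  qed
  thus ?thesis
    by (subst pos_divisor_eq_prime_prod[OF assms(2,3)])
      (simp add: prime_prod_def Legendre_prod[OF prime_q q_gt_2] Legendre_power[OF prime_q q_gt_2])
qed

lemma Legendre_divisor_1_mod_4:
  assumes "q dvd e1 * e3" "d mod 4 = 1" "d dvd int n"
  shows "Legendre d q = 1"
proof -
  obtain r where r: "q = int r" "prime r" "odd r" by (rule odd_prime_int_natE[OF prime_q q_gt_2])
  have "Legendre (pstar (p j)) q = 1" if "j < k" for j using star_residues r assms(1) that by blast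
  thus ?thesis
    by (subst divisor_eq_star_prod[OF assms(2,3)])
      (simp add: star_prod_def Legendre_prod[OF prime_q q_gt_2] Legendre_power[OF prime_q q_gt_2])
qed

end

lemma locally_soluble_untwist_divisors:
  assumes q: "prime q" "2 < q" "q dvd e1 * e2 * e3"
    and g: "g1 dvd int n" "g2 dvd int n" "g3 dvd int n" "g2 > 0" "g3 mod 4 = 1" "g1 * g3 > 0"
    and c: "squarefree c1" "squarefree c2" "squarefree c3" "is_square (c1 * c2 * c3)"
    and sol: "twist_soluble (int n) q (g1 * c1) (g2 * c2) (g3 * c3)"
  shows "locally_soluble q e1 e2 e3 c1 c2 c3"
proof -
  note untwist = locally_soluble_untwist[OF q(1,2) Legendre_pos_divisor[OF q int_n_pos dvd_refl]]
  have g2: "Legendre g2 q = 1" by (rule Legendre_pos_divisor[OF q g(4,2)])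
  have pos: "Legendre \<bar>g\<bar> q = 1" if "g dvd int n" "g \<noteq> 0" for g
    using that by (intro Legendre_pos_divisor[OF q]) simp_all
  have nz: "g1 \<noteq> 0" "g3 \<noteq> 0" using g(6) by auto
  show ?thesis
  proof (cases "Legendre g1 q = 1 \<and> Legendre g3 q = 1")
    case True
    thus ?thesis using untwist[OF _ g2 _ sol] by blast
  next
    case False
    have neg: "g1 < 0" "g3 < 0" using False pos[OF g(1) nz(1)] pos[OF g(3) nz(2)] g(6)
      by (auto simp: zero_less_mult_iff)
    have "\<not> q dvd e1 * e3"
    proof
      assume "q dvd e1 * e3"
      hence g3: "Legendre g3 q = 1" by (rule Legendre_divisor_1_mod_4[OF q(1,2) _ g(5,3)])
      have "Legendre (- 1) q = 1"
        using pos[OF g(3) nz(2)] g3 neg Legendre_minus[OF q(1,2), of g3] by simp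
      hence "Legendre g1 q = 1"
        using pos[OF g(1) nz(1)] neg Legendre_minus[OF q(1,2), of g1] by simp
      thus False using False g3 by blast
    qed
    hence a: "\<not> q dvd e1" "q dvd e2" "\<not> q dvd e3" using q(1,3) by (auto simp: prime_dvd_mult_iff)
    have "twist_soluble (int n) q (\<bar>g1\<bar> * - c1) (g2 * c2) (\<bar>g3\<bar> * - c3)"
      using sol neg by simp
    hence "locally_soluble q e1 e2 e3 (- c1) c2 (- c3)"
      using untwist[OF pos[OF g(1) nz(1)] g2 pos[OF g(3) nz(2)]] by blast
    from locally_soluble_neg[OF q(1,2) e_sum a _ c(2) _ _ this] show ?thesis using c by simp
  qed
qed

lemma locally_soluble_twist_of_divisors:
  assumes d: "d1 dvd int n" "d2 dvd int n" "d3 dvd int n" "d2 > 0" "d3 mod 4 = 1" "is_square (d1 * d2 * d3)"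
    and q: "prime q" "2 < q" "\<not> q dvd int n"
  shows "twist_soluble (int n) q d1 d2 d3"
proof (cases "q dvd e1 * e2 * e3")
  case False
  have "\<not> q dvd d1" "\<not> q dvd d2" "\<not> q dvd d3" using q(3) d(1-3) dvd_trans by blast+
  moreover have "\<not> q dvd e1 * int n" "\<not> q dvd e2 * int n" "\<not> q dvd e3 * int n"
    using False q by (auto simp: prime_dvd_mult_iff)
  ultimately show ?thesis using locally_soluble_of_good_reduction[OF q(1,2) twisted_sum _ _ _ _ _ _ d(6)] by blast
next
  case True
  have units: "\<not> q dvd d1" "\<not> q dvd d2" "\<not> q dvd d3" using q(3) d(1-3) dvd_trans by blast+
  have triple: "Legendre d1 q * Legendre d2 q * Legendre d3 q = 1"
    using Legendre_triple_eq_1[OF q(1,2) units] d(6) by (auto elim: is_nth_powerE)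
  have d2: "Legendre d2 q = 1" by (rule Legendre_pos_divisor[OF q(1,2) True d(4,2)])
  show ?thesis
  proof (cases "q dvd e1 * e3")
    case True
    hence "Legendre d3 q = 1" by (rule Legendre_divisor_1_mod_4[OF q(1,2) _ d(5,3)])
    thus ?thesis using triple d2 by (intro locally_soluble_of_residues[OF q(1,2) twisted_sum]) simp_all
  next
    case False
    hence "\<not> q dvd e1 * int n" "q dvd e2 * int n" using True q(1,3) by (auto simp: prime_dvd_mult_iff)
    moreover have "Legendre (d1 * d3) q = 1" using triple d2 by (simp add: Legendre_mult[OF q(1,2)])
    ultimately show ?thesis using locally_soluble_of_residue_product[OF q(1,2) twisted_sum _ _ units(2)] by blast
  qed
qed

lemma mem_Sel2_of_local_at_p:
  assumes d: "d1 dvd int n" "d2 dvd int n" "d3 dvd int n" "d2 > 0" "d3 mod 4 = 1" "is_square (d1 * d2 * d3)"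
    and sol: "\<And>i. i < k \<Longrightarrow> twist_soluble (int n) (int (p i)) d1 d2 d3"
  shows "(d1, d2, d3) \<in> Sel2 e1 e2 e3 (int n)"
proof (rule mem_Sel2_of_odd_places)
  show "twist_soluble (int n) q d1 d2 d3" if q: "prime q" "2 < q" for q
    using sol prime_dvd_n_iff[OF q(1)] locally_soluble_twist_of_divisors[OF d q] by blast
qed (use odd_n n_pos d odd_divisor squarefree_divisor in auto)

lemma odd_Sel2_twist_mod_4:
  assumes L: "(d1, d2, d3) \<in> Sel2 e1 e2 e3 (int n)" and odd: "odd d2" "odd d3"
  shows "odd d1" "d3 mod 4 = 1"
proof -
  have d: "squarefree d1" "squarefree d2" "squarefree d3" "is_square (d1 * d2 * d3)"
    and sol: "twist_soluble (int n) 2 d1 d2 d3"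
    using L int_n_pos by (simp_all add: Sel2_iff)
  show "odd d1" using prime_dvd_square_product_iff[of 2, OF _ d] odd by simp
  thus "d3 mod 4 = 1"
    using locally_soluble_2_imp_mod_4[OF twist_mod_4(1-3,5) _ odd d(4) sol] odd_n by simp
qed

text \<open>The factors of \<open>d1\<close>, \<open>d2\<close>, \<open>d3\<close> prime to \<open>n\<close> form a Selmer element of the
  untwisted curve, where only torsion is left.\<close>
lemma good_rep_of_odd_Sel2:
  assumes L: "(d1, d2, d3) \<in> Sel2 e1 e2 e3 (int n)" and odd: "odd d2" "odd d3"
  shows "good_rep n (d1, d2, d3)"
proof -
  have d: "squarefree d1" "squarefree d2" "squarefree d3" "is_square (d1 * d2 * d3)" "d2 > 0"
    and sol: "\<And>q. prime q \<Longrightarrow> twist_soluble (int n) q d1 d2 d3"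
    using L int_n_pos by (simp_all add: Sel2_iff)
  note d1_d3 = odd_Sel2_twist_mod_4[OF L odd]
  obtain g1 g2 g3 c1 c2 c3 where split: "d1 = g1 * c1" "d2 = g2 * c2" "d3 = g3 * c3"
    and g_dvd: "g1 dvd int n" "g2 dvd int n" "g3 dvd int n"
    and coprime: "coprime c1 (int n)" "coprime c2 (int n)" "coprime c3 (int n)"
    and g: "g1 * g3 > 0" "g2 > 0" "g3 mod 4 = 1" and square: "is_square (c1 * c2 * c3)"
    by (rule squarefree_triple_split_gcd[OF d(1-4), of "int n"]) (use odd_n in simp)
  have c: "squarefree c1" "squarefree c2" "squarefree c3"
    using d(1-3) squarefree_mono[OF dvd_triv_right] unfolding split by blast+
  have c2: "c2 > 0" using d(5) g(2) zero_less_mult_pos unfolding split by blast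
  have c3: "c3 mod 4 = 1" using d1_d3(2) g(3) mod_mult_left_eq[of g3 4 c3] unfolding split by simp
  have "twist_soluble 1 q c1 c2 c3" if q: "prime q" "2 < q" for q
  proof (cases "q dvd e1 * e2 * e3")
    case True
    show ?thesis
      using locally_soluble_untwist_divisors[OF q True g_dvd g(2,3,1) c square] sol[OF q(1)] unfolding split by simp
  next
    case False
    have "\<not> q dvd c1 \<and> \<not> q dvd c2 \<and> \<not> q dvd c3"
    proof (cases "q dvd int n")
      case True
      thus ?thesis using coprime q(1) by (metis coprime_common_divisor not_prime_unit)
    next
      case False
      show ?thesis
        using Sel2_unramified[OF L int_n_pos q(1) \<open>\<not> q dvd e1 * e2 * e3\<close> False] unfolding split by auto
    qed
    moreover have "\<not> q dvd e1" "\<not> q dvd e2" "\<not> q dvd e3" using False by auto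
    ultimately show ?thesis using locally_soluble_of_good_reduction[OF q e_sum _ _ _ _ _ _ square] by simp
  qed
  hence "(c1, c2, c3) \<in> Sel2 e1 e2 e3 1"
    using d1_d3(1) odd c square c2 c3 unfolding split by (intro mem_Sel2_of_odd_places) auto
  hence "(c1, c2, c3) \<in> Tors e1 e2 e3 1" using Sel2_eq_Tors[of 1] card_Sel2 by simp
  moreover have "odd_rep (c1, c2, c3)" using odd unfolding split by (simp add: parity_def)
  ultimately have "(c1, c2, c3) = (1, 1, 1)" using odd_rep_Tors[of 1] by simp
  thus ?thesis using split g_dvd g by (simp add: good_rep_def)
qed

lemma odd_rep_of_good_rep: "good_rep n L \<Longrightarrow> odd_rep L"
  using odd_divisor by (auto simp: good_rep_def parity_def split: prod.splits)

lemma unique_good_rep: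
  assumes L: "L \<in> Sel2 e1 e2 e3 (int n)"
  shows "\<exists>!L'. L' \<in> sel_class e1 e2 e3 (int n) L \<and> good_rep n L'"
proof -
  obtain d1 d2 d3 where d: "L = (d1, d2, d3)" "squarefree d2" "squarefree d3"
    using Sel2E[OF L int_n_pos] by metis
  have "good_rep n M \<longleftrightarrow> odd_rep M" if "M \<in> sel_class e1 e2 e3 (int n) L" for M
  proof
    have "M \<in> Sel2 e1 e2 e3 (int n)" using sel_class_subset_Sel2[OF int_n_pos L] that by blast
    thus "odd_rep M \<Longrightarrow> good_rep n M" using good_rep_of_odd_Sel2 by (cases M) (auto simp: parity_def)
  qed (rule odd_rep_of_good_rep)
  moreover have "\<exists>!L'. L' \<in> sel_class e1 e2 e3 (int n) L \<and> odd_rep L'"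
    unfolding d(1) using unique_odd_rep d(2,3) odd_n by simp
  ultimately show ?thesis by (metis (no_types, lifting))
qed

end

subsection \<open>The Selmer group as a kernel\<close>

definition sign_of_bit :: "bit \<Rightarrow> int" where
  "sign_of_bit b = (if b = 0 then 1 else -1)"

lemma sign_of_bit_eq_1_iff: "sign_of_bit b = 1 \<longleftrightarrow> b = 0"
  by (simp add: sign_of_bit_def)

lemma sign_of_bit_add: "sign_of_bit (a + b) = sign_of_bit a * sign_of_bit b"
  by (cases a; cases b) (simp_all add: sign_of_bit_def)

lemma sign_of_bit_0: "sign_of_bit 0 = 1"
  by (simp add: sign_of_bit_def)

lemma sign_of_bit_mult_of_nat: "sign_of_bit (b * of_nat m) = sign_of_bit b ^ m"
  by (induction m) (simp_all only: of_nat_0 of_nat_Suc distrib_left mult_zero_right mult_1_right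
    sign_of_bit_0 sign_of_bit_add power_0 power_Suc)

lemma sign_of_bit_sum: "sign_of_bit (\<Sum>j\<in>A. f j) = (\<Prod>j\<in>A. sign_of_bit (f j))"
  by (induction A rule: infinite_finite_induct)
    (simp_all only: sum.infinite prod.infinite sum.empty prod.empty sum.insert prod.insert
      sign_of_bit_0 sign_of_bit_add not_False_eq_True)

lemma bit_of_nat_eq: "(of_nat m :: bit) = of_bool (odd m)"
  by (induction m) simp_all

lemma sign_of_bit_lsym:
  assumes "\<not> int q dvd u"
  shows "sign_of_bit (lsym u q) = Legendre u (int q)"
  using assms by (simp add: sign_of_bit_def lsym_def Legendre_def cong_0_iff)

lemma ex_less_3: "(\<exists>i<3::nat. P i) \<longleftrightarrow> P 0 \<or> P 1 \<or> P 2"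
  by (auto simp: numeral_eq_Suc less_Suc_eq)

lemma padic_sol_conic_iff:
  "padic_sol q 3 (\<lambda>x. [a * (x 0)^2 + b * (x 1)^2 - (x 2)^2]) \<longleftrightarrow> isotropic (int q) a b"
proof -
  have "(\<exists>x::nat \<Rightarrow> int. (\<exists>i<3. \<not> int q dvd x i) \<and>
          (\<forall>v\<in>set [a * (x 0)^2 + b * (x 1)^2 - (x 2)^2]. int q ^ N dvd v)) \<longleftrightarrow>
        (\<exists>x y z. \<not> (int q dvd x \<and> int q dvd y \<and> int q dvd z) \<and> int q ^ N dvd a * x^2 + b * y^2 - z^2)"
    (is "?L \<longleftrightarrow> ?R") for N
  proof
    assume ?L
    then obtain x :: "nat \<Rightarrow> int" where "\<exists>i<3. \<not> int q dvd x i" "int q ^ N dvd a * (x 0)^2 + b * (x 1)^2 - (x 2)^2"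
      by auto
    thus ?R unfolding ex_less_3 by (intro exI[of _ "x 0"] exI[of _ "x 1"] exI[of _ "x 2"]) simp
  next
    assume ?R
    then obtain x y z where "\<not> (int q dvd x \<and> int q dvd y \<and> int q dvd z)"
      "int q ^ N dvd a * x^2 + b * y^2 - z^2" by blast
    thus ?L unfolding ex_less_3
      by (intro exI[of _ "\<lambda>i. if i = 0 then x else if i = 1 then y else z"]) auto
  qed
  thus ?thesis unfolding padic_sol_def isotropic_def by blast
qed

lemma sign_of_bit_hilb_add:
  assumes "prime q" "2 < q" "a \<noteq> 0" "b \<noteq> 0"
  shows "sign_of_bit (hilb_add q a b) = hilbert (int q) a b"
proof -
  have q: "prime (int q)" "2 < int q" using assms(1,2) by simp_all
  have "hilb_add q a b = 0 \<longleftrightarrow> hilbert (int q) a b = 1"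
    unfolding hilb_add_def padic_sol_conic_iff isotropic_iff_hilbert[OF q assms(3,4)] by simp
  thus ?thesis using hilbert_values[OF q assms(3,4)] by (auto simp: sign_of_bit_def)
qed

context quadratic_twist
begin

lemma multiplicity_n: "i < k \<Longrightarrow> multiplicity (int (p i)) (int n) = 1"
  using squarefree_multiplicity[OF squarefree_n prime_int_p] p_dvd_n by simp

lemma sign_of_bit_matA:
  assumes "i < k" "j < k"
  shows "sign_of_bit (matA n p i j) = hilbert (int (p i)) (int (p j)) (- int n)"
  unfolding matA_def using prime_p p_gt_2[OF assms(1)] p_gt_2[OF assms(2)] assms n_pos
  by (intro sign_of_bit_hilb_add) auto

lemma sign_of_bit_matA_transpose:
  assumes "i < k" "j < k"
  shows "sign_of_bit (matA n p j i) = hilbert (int (p i)) (pstar (p j)) (int n)"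
proof -
  note pi = prime_int_p[OF assms(1)] p_gt_2[OF assms(1)]
  note pj = prime_int_p[OF assms(2)] p_gt_2[OF assms(2)]
  have nz: "int (p i) \<noteq> 0" "int (p j) \<noteq> 0" "int n \<noteq> 0" using pi(2) pj(2) n_pos by auto
  show ?thesis
  proof (cases "i = j")
    case True
    have unit: "\<not> int (p i) dvd chi4 (int (p i))" "chi4 (int (p i)) \<noteq> 0"
      using chi4_values[of "int (p i)"] not_dvd_one_two[OF pi] by auto
    have "hilbert (int (p i)) (int (p i)) (- int n) =
        hilbert (int (p i)) (int (p i)) (-1) * hilbert (int (p i)) (int (p i)) (int n)"
      using hilbert_mult_right[OF pi, of "-1" "int n"] nz by simp
    also have "hilbert (int (p i)) (int (p i)) (-1) = hilbert (int (p i)) (chi4 (int (p i))) (int n)"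
      using not_dvd_one_two[OF pi] unit(1)
      by (simp add: hilbert_unit_right hilbert_commute[of _ "chi4 _"] multiplicity_n[OF assms(1)]
        prime_multiplicity_self[OF pi(1)] Legendre_chi4_self[OF pi])
    finally show ?thesis
      using sign_of_bit_matA[OF assms(1,1)] nz unit(2) unfolding True[symmetric]
      by (simp add: pstar_eq[OF assms(1)] hilbert_mult_left[OF pi])
  next
    case False
    hence unit: "\<not> int (p j) dvd int (p i)" "\<not> int (p i) dvd pstar (p j)" "int (p j) \<noteq> int (p i)"
      using p_distinct[OF assms] p_distinct[OF assms(2,1)] chi4_values[of "int (p j)"]
      by (auto simp: pstar_eq[OF assms(2)])
    have "sign_of_bit (matA n p j i) = Legendre (int (p i)) (int (p j))"
      using sign_of_bit_matA[OF assms(2,1)] hilbert_unit_right[OF unit(1), of "- int n"]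
      by (simp add: hilbert_commute[of _ "int (p i)"] multiplicity_n[OF assms(2)])
    also have "\<dots> = Legendre (pstar (p j)) (int (p i))"
      unfolding pstar_eq[OF assms(2)] by (rule Legendre_star_reciprocity[OF pj pi unit(3), symmetric])
    also have "\<dots> = hilbert (int (p i)) (pstar (p j)) (int n)"
      using hilbert_unit_right[OF unit(2), of "int n"]
      by (simp add: hilbert_commute[of _ "pstar _"] multiplicity_n[OF assms(1)])
    finally show ?thesis .
  qed
qed

lemma sign_of_bit_row_matA:
  assumes "i < k"
  shows "sign_of_bit (\<Sum>j<k. matA n p i j * of_nat (f j)) = hilbert (int (p i)) (prime_prod f) (- int n)"
proof -
  note pi = prime_int_p[OF assms] p_gt_2[OF assms]
  have nz: "int (p j) \<noteq> 0" if "j < k" for j using p_gt_2[OF that] by simp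
  have "sign_of_bit (\<Sum>j<k. matA n p i j * of_nat (f j)) = (\<Prod>j<k. hilbert (int (p i)) (int (p j) ^ f j) (- int n))"
    unfolding sign_of_bit_sum sign_of_bit_mult_of_nat using assms nz n_pos
    by (simp add: sign_of_bit_matA hilbert_power_left[OF pi])
  also have "\<dots> = hilbert (int (p i)) (prime_prod f) (- int n)"
    unfolding prime_prod_def using nz n_pos by (intro hilbert_prod_left[OF pi, symmetric]) auto
  finally show ?thesis .
qed

lemma sign_of_bit_column_matA:
  assumes "i < k"
  shows "sign_of_bit (\<Sum>j<k. matA n p j i * of_nat (f j)) = hilbert (int (p i)) (star_prod f) (int n)"
proof -
  note pi = prime_int_p[OF assms] p_gt_2[OF assms]
  have nz: "pstar (p j) \<noteq> 0" if "j < k" for j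
    using p_gt_2[OF that] chi4_values[of "int (p j)"] by (auto simp: pstar_eq[OF that])
  have "sign_of_bit (\<Sum>j<k. matA n p j i * of_nat (f j)) = (\<Prod>j<k. hilbert (int (p i)) (pstar (p j) ^ f j) (int n))"
    unfolding sign_of_bit_sum sign_of_bit_mult_of_nat using assms nz n_pos
    by (simp add: sign_of_bit_matA_transpose hilbert_power_left[OF pi])
  also have "\<dots> = hilbert (int (p i)) (star_prod f) (int n)"
    unfolding star_prod_def using nz n_pos by (intro hilbert_prod_left[OF pi, symmetric]) auto
  finally show ?thesis .
qed

lemma orthogonal_to_torsion_iff_rows:
  assumes d: "d2 dvd int n" "d3 dvd int n" "d2 > 0" "d3 mod 4 = 1" and i: "i < k"
    and y: "\<And>j. j < k \<Longrightarrow> y j = of_nat (multiplicity (int (p j)) d2)"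
    and z: "\<And>j. j < k \<Longrightarrow> z j = of_nat (multiplicity (int (p j)) d3)"
  shows "orthogonal_to_torsion (int (p i)) e1 e2 e3 (int n) d2 d3 \<longleftrightarrow>
    (\<Sum>j<k. matA n p i j * y j) + lsym (- e1) (p i) * y i + lsym (- e1 * e3) (p i) * z i = 0 \<and>
    lsym (- e1 * e2) (p i) * y i + (\<Sum>j<k. matA n p j i * z j) + lsym (- e1) (p i) * z i = 0"
proof -
  define q where "q = int (p i)"
  have q: "prime q" "2 < q" unfolding q_def by (rule prime_int_p[OF i] p_gt_2[OF i])+
  have "\<not> q dvd e1 * e2 * e3" using not_dvd_n[OF q(1)] p_dvd_n[OF i] q_def by blast
  hence units: "\<not> q dvd - e1" "\<not> q dvd - e1 * e2" "\<not> q dvd - e1 * e3"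
    using q(1) by (auto simp: prime_dvd_mult_iff)
  have diag: "sign_of_bit (lsym u (p i) * of_nat (multiplicity q d)) = hilbert q d u" if "\<not> q dvd u" for u d
    unfolding sign_of_bit_mult_of_nat using that sign_of_bit_lsym[of "p i" u] hilbert_unit_right[OF that]
    by (simp add: q_def)
  have y_row: "sign_of_bit (\<Sum>j<k. matA n p i j * y j) = hilbert q d2 (- int n)"
    using sign_of_bit_row_matA[OF i, of "\<lambda>j. multiplicity (int (p j)) d2"] pos_divisor_eq_prime_prod[OF d(3,1)] y
    by (simp add: q_def)
  have z_row: "sign_of_bit (\<Sum>j<k. matA n p j i * z j) = hilbert q d3 (int n)"
    using sign_of_bit_column_matA[OF i, of "\<lambda>j. multiplicity (int (p j)) d3"] divisor_eq_star_prod[OF d(4,2)] z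
    by (simp add: q_def)
  have "e1 * int n = - int n * - e1" "- e1 * int n = int n * - e1" by simp_all
  hence factor: "hilbert q d (e1 * int n) = hilbert q d (- int n) * hilbert q d (- e1)"
    "hilbert q d (- e1 * int n) = hilbert q d (int n) * hilbert q d (- e1)" for d
    using hilbert_mult_right[OF q] n_pos e_nonzero(1) by (metis neg_equal_0_iff_equal of_nat_0_eq_iff less_irrefl)+
  have "orthogonal_to_torsion q e1 e2 e3 (int n) d2 d3 \<longleftrightarrow>
    sign_of_bit ((\<Sum>j<k. matA n p i j * y j) + lsym (- e1) (p i) * y i + lsym (- e1 * e3) (p i) * z i) = 1 \<and>
    sign_of_bit (lsym (- e1 * e2) (p i) * y i + (\<Sum>j<k. matA n p j i * z j) + lsym (- e1) (p i) * z i) = 1"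
    unfolding orthogonal_to_torsion_def factor sign_of_bit_add y_row z_row y[OF i] z[OF i] q_def[symmetric]
      diag[OF units(1)] diag[OF units(2)] diag[OF units(3)] by (simp only: mult.assoc)
  thus ?thesis unfolding sign_of_bit_eq_1_iff q_def .
qed

lemma Phi_in_Ker_iff:
  assumes d: "d1 dvd int n" "d2 dvd int n" "d3 dvd int n" "d2 > 0" "d3 mod 4 = 1" "is_square (d1 * d2 * d3)"
  shows "Phi k p (d1, d2, d3) \<in> Ker e1 e2 e3 n k p \<longleftrightarrow>
    (\<forall>i<k. twist_soluble (int n) (int (p i)) d1 d2 d3)"
proof -
  obtain y z where Phi: "Phi k p (d1, d2, d3) = (y, z)" by (cases "Phi k p (d1, d2, d3)")
  hence y: "\<And>j. j < k \<Longrightarrow> y j = of_nat (multiplicity (int (p j)) d2)"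
    and z: "\<And>j. j < k \<Longrightarrow> z j = of_nat (multiplicity (int (p j)) d3)"
    and outside: "\<forall>i\<ge>k. y i = 0 \<and> z i = 0" by (auto simp: Phi_def)
  have "twist_soluble (int n) (int (p i)) d1 d2 d3 \<longleftrightarrow>
      orthogonal_to_torsion (int (p i)) e1 e2 e3 (int n) d2 d3" if i: "i < k" for i
  proof -
    have "\<not> int (p i) dvd e1 * e2 * e3" using not_dvd_n[OF prime_int_p] p_dvd_n i by blast
    hence "\<not> int (p i) dvd e1" "\<not> int (p i) dvd e2" "\<not> int (p i) dvd e3" by auto
    thus ?thesis
      using locally_soluble_iff_orthogonal_to_torsion[OF prime_int_p p_gt_2 multiplicity_n e_sum]
        squarefree_divisor d i by blast
  qed
  thus ?thesis
    unfolding Phi Ker_def using outside orthogonal_to_torsion_iff_rows[OF d(2-5) _ y z] by simp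
qed

lemma abs_divisor_eqI:
  assumes "d dvd int n" "c dvd int n" "\<And>i. i < k \<Longrightarrow> int (p i) dvd d \<longleftrightarrow> int (p i) dvd c"
  shows "\<bar>d\<bar> = \<bar>c\<bar>"
proof (rule squarefree_eqI)
  have "d \<noteq> 0" "c \<noteq> 0" using odd_divisor[OF assms(1)] odd_divisor[OF assms(2)] by auto
  thus "\<bar>d\<bar> * \<bar>c\<bar> > 0" by simp
  show "q dvd \<bar>d\<bar> \<longleftrightarrow> q dvd \<bar>c\<bar>" if q: "prime q" for q
    using prime_dvd_n_iff[OF q] assms dvd_trans unfolding dvd_abs_iff by blast
qed (use assms(1,2) squarefree_divisor in simp_all)

lemma Phi_squarefree:
  assumes "squarefree d2" "squarefree d3"
  shows "Phi k p (d1, d2, d3) =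
    ((\<lambda>i. of_bool (i < k \<and> int (p i) dvd d2)), (\<lambda>i. of_bool (i < k \<and> int (p i) dvd d3)))"
  using assms prime_int_p by (auto simp: Phi_def bit_of_nat_eq squarefree_multiplicity fun_eq_iff)

abbreviation good_Sel2 :: "triple set" where
  "good_Sel2 \<equiv> {L \<in> Sel2 e1 e2 e3 (int n). good_rep n L}"

lemma Phi_inj: "inj_on (Phi k p) good_Sel2"
proof (rule inj_onI)
  fix L M
  assume LM: "L \<in> good_Sel2" "M \<in> good_Sel2" and Phi: "Phi k p L = Phi k p M"
  obtain d1 d2 d3 c1 c2 c3 where L: "L = (d1, d2, d3)" and M: "M = (c1, c2, c3)" by (cases L; cases M)
  have dvd: "d2 dvd int n" "d3 dvd int n" "c2 dvd int n" "c3 dvd int n"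
    and signs: "d2 > 0" "d3 mod 4 = 1" "c2 > 0" "c3 mod 4 = 1"
    using LM by (simp_all add: L M good_rep_def)
  have "Phi k p (d1, d2, d3) = Phi k p (c1, c2, c3)" using Phi by (simp only: L M)
  hence bits: "of_bool (i < k \<and> int (p i) dvd d2) = (of_bool (i < k \<and> int (p i) dvd c2) :: bit)"
    "of_bool (i < k \<and> int (p i) dvd d3) = (of_bool (i < k \<and> int (p i) dvd c3) :: bit)" for i
    unfolding Phi_squarefree[OF dvd(1,2)[THEN squarefree_divisor]] Phi_squarefree[OF dvd(3,4)[THEN squarefree_divisor]]
      prod.inject fun_eq_iff by blast+
  have "int (p i) dvd d2 \<longleftrightarrow> int (p i) dvd c2" "int (p i) dvd d3 \<longleftrightarrow> int (p i) dvd c3" if "i < k" for i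
    using bits[of i] that by (simp_all only: of_bool_eq_iff simp_thms)
  hence "\<bar>d2\<bar> = \<bar>c2\<bar>" "\<bar>d3\<bar> = \<bar>c3\<bar>" using abs_divisor_eqI dvd by blast+
  hence eq: "d2 = c2" "d3 = c3" using signs eq_if_abs_eq_mod_4 by auto
  have "d1 = squarefree_part (d2 * d3)" "c1 = squarefree_part (c2 * c3)"
    using LM Sel2_first_component[OF _ int_n_pos] by (simp_all only: L M mem_Collect_eq)
  thus "L = M" by (simp add: L M eq)
qed

lemma Phi_surj:
  assumes "(y, z) \<in> Ker e1 e2 e3 n k p"
  obtains L where "L \<in> Sel2 e1 e2 e3 (int n)" "good_rep n L" "Phi k p L = (y, z)"
proof -
  define d2 d3 where "d2 = prime_prod (\<lambda>j. of_bool (y j = 1))" and "d3 = star_prod (\<lambda>j. of_bool (z j = 1))"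
  define d1 where "d1 = squarefree_part (d2 * d3)"
  have d2: "d2 dvd int n" "d2 > 0"
    unfolding d2_def by (rule prime_prod_dvd_n prime_prod_pos; simp)+
  have "\<bar>d3\<bar> dvd int n" unfolding d3_def abs_star_prod by (rule prime_prod_dvd_n) simp
  hence d3: "d3 dvd int n" "d3 mod 4 = 1" by (simp_all add: d3_def star_prod_mod_4)
  have nz: "d2 \<noteq> 0" "d3 \<noteq> 0" using d2 d3 by auto
  have d1: "d1 dvd int n" unfolding d1_def using d2 d3 nz n_pos by (intro squarefree_part_dvd_mult) simp_all
  have "squarefree d1" unfolding d1_def using nz by simp
  hence "squarefree_part d1 = squarefree_part (d2 * d3)"
    using squarefree_part_of_squarefree by (simp add: d1_def)
  hence square: "is_square (d1 * d2 * d3)"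
    using nz \<open>squarefree d1\<close> by (subst (asm) squarefree_part_eq_iff) (auto simp: mult.assoc)
  have bits: "int (p i) dvd d2 \<longleftrightarrow> y i = 1" "int (p i) dvd d3 \<longleftrightarrow> z i = 1" if i: "i < k" for i
  proof -
    have dvd_iff: "int (p i) dvd prime_prod f \<longleftrightarrow> f i > 0" for f
      using prime_multiplicity_gt_zero_iff[of "int (p i)" "prime_prod f"] prime_imp_prime_elem[OF prime_int_p[OF i]]
        multiplicity_prime_prod[OF i, of f] prime_prod_pos[of f] by auto
    show "int (p i) dvd d2 \<longleftrightarrow> y i = 1" unfolding d2_def dvd_iff by simp
    have "int (p i) dvd d3 \<longleftrightarrow> int (p i) dvd \<bar>d3\<bar>" by simp
    thus "int (p i) dvd d3 \<longleftrightarrow> z i = 1" unfolding d3_def abs_star_prod dvd_iff by simp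
  qed
  have "y i = 0" "z i = 0" if "\<not> i < k" for i using assms that by (simp_all add: Ker_def)
  hence Phi: "Phi k p (d1, d2, d3) = (y, z)"
    using bits d2(1) d3(1) by (auto simp: Phi_squarefree squarefree_divisor fun_eq_iff of_bool_def)
  have "(d1, d2, d3) \<in> Sel2 e1 e2 e3 (int n)"
    using Phi_in_Ker_iff[OF d1 d2(1) d3(1) d2(2) d3(2) square] assms
    by (intro mem_Sel2_of_local_at_p d1 d2 d3 square) (simp add: Phi)
  moreover have "good_rep n (d1, d2, d3)" using d1 d2 d3 by (simp add: good_rep_def)
  ultimately show ?thesis using that Phi by blast
qed

lemma Phi_bij: "bij_betw (Phi k p) good_Sel2 (Ker e1 e2 e3 n k p)"
  unfolding bij_betw_def
proof (intro conjI Phi_inj subset_antisym subsetI)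
  fix w assume "w \<in> Phi k p ` good_Sel2"
  then obtain d1 d2 d3 where w: "w = Phi k p (d1, d2, d3)" and L: "(d1, d2, d3) \<in> Sel2 e1 e2 e3 (int n)"
    and good: "good_rep n (d1, d2, d3)" by auto
  have "\<forall>i<k. twist_soluble (int n) (int (p i)) d1 d2 d3" "is_square (d1 * d2 * d3)"
    using L int_n_pos prime_int_p by (simp_all add: Sel2_iff)
  thus "w \<in> Ker e1 e2 e3 n k p" using Phi_in_Ker_iff good w by (simp add: good_rep_def)
next
  fix w assume "w \<in> Ker e1 e2 e3 n k p"
  thus "w \<in> Phi k p ` good_Sel2"
    using Phi_surj by (cases w) (metis (mono_tags, lifting) image_eqI mem_Collect_eq)
qed

lemma good_rep_tmul_eq:
  assumes a: "good_rep n a" and b: "good_rep n b" and c: "good_rep n c"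
    and c_class: "c \<in> sel_class e1 e2 e3 (int n) (tmul a b)"
  shows "c = tmul a b"
proof -
  obtain a1 a2 a3 b1 b2 b3 where ab: "a = (a1, a2, a3)" "b = (b1, b2, b3)" by (cases a; cases b)
  have dvd: "a1 dvd int n" "a2 dvd int n" "a3 dvd int n" "b1 dvd int n" "b2 dvd int n" "b3 dvd int n"
    using a b by (simp_all add: ab good_rep_def)
  hence nz: "a1 * b1 \<noteq> 0" "a2 * b2 \<noteq> 0" "a3 * b3 \<noteq> 0" using odd_divisor by fastforce+
  define x1 x2 x3 where "x1 = sqf (a1 * b1)" and "x2 = sqf (a2 * b2)" and "x3 = sqf (a3 * b3)"
  have x: "squarefree x1" "squarefree x2" "squarefree x3"
    unfolding x1_def x2_def x3_def using nz by (simp_all add: sqf_eq_squarefree_part)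
  have tmul: "tmul a b = (x1, x2, x3)" by (simp add: ab tmul_def x1_def x2_def x3_def)
  have "tmul (x1, x2, x3) (1, 1, 1) = (x1, x2, x3)" by (rule tmul_one[OF x])
  hence "tmul a b \<in> sel_class e1 e2 e3 (int n) (tmul a b)"
    unfolding tmul sel_class_def Tors_def by (metis image_eqI insertI1)
  moreover have "odd_rep (tmul a b)"
    using dvd squarefree_divisor odd_divisor by (simp add: ab parity_tmul)
  moreover have "\<exists>!M. M \<in> sel_class e1 e2 e3 (int n) (tmul a b) \<and> odd_rep M"
    unfolding tmul using unique_odd_rep x odd_n by simp
  ultimately show ?thesis using c_class odd_rep_of_good_rep[OF c] by (metis (no_types, lifting))
qed

lemma Phi_hom:
  assumes a: "good_rep n a" and b: "good_rep n b" and c: "good_rep n c"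
    and c_class: "c \<in> sel_class e1 e2 e3 (int n) (tmul a b)"
  shows "Phi k p c = ((\<lambda>i. fst (Phi k p a) i + fst (Phi k p b) i), (\<lambda>i. snd (Phi k p a) i + snd (Phi k p b) i))"
proof -
  obtain a1 a2 a3 b1 b2 b3 where ab: "a = (a1, a2, a3)" "b = (b1, b2, b3)" by (cases a; cases b)
  have dvd: "a2 dvd int n" "a3 dvd int n" "b2 dvd int n" "b3 dvd int n"
    using a b by (simp_all add: ab good_rep_def)
  have "(of_nat (multiplicity (int (p i)) (sqf (x * y))) :: bit) =
      of_nat (multiplicity (int (p i)) x) + of_nat (multiplicity (int (p i)) y)"
    if "i < k" "x dvd int n" "y dvd int n" for i x y
  proof -
    have nz: "x \<noteq> 0" "y \<noteq> 0" using that odd_divisor by fastforce+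
    hence "(of_nat (multiplicity (int (p i)) (sqf (x * y))) :: bit) = of_nat (multiplicity (int (p i)) (x * y))"
      using prime_int_p[OF that(1)]
      by (simp add: bit_of_nat_eq sqf_eq_squarefree_part squarefree_multiplicity prime_dvd_squarefree_part_iff)
    thus ?thesis using nz prime_int_p[OF that(1)] by (simp only: prime_multiplicity_mult of_nat_add simp_thms)
  qed
  thus ?thesis
    unfolding good_rep_tmul_eq[OF a b c c_class] using dvd by (simp add: ab tmul_def Phi_def fun_eq_iff)
qed

end

theorem theorem4p5:
  fixes e1 e2 e3 :: int and n k :: nat and p :: "nat \<Rightarrow> nat"
  assumes "e1 \<noteq> 0" "e2 \<noteq> 0" "e3 \<noteq> 0" "e1 + e2 + e3 = 0"
    and "2 dvd e1" "\<not> 4 dvd e1" "2 dvd e2" "\<not> 4 dvd e2" "4 dvd e3"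
    and "\<forall>i<k. prime (p i)" "inj_on p {..<k}" "n = (\<Prod>i<k. p i)" "odd n"
    and "coprime (int n) (e1 * e2 * e3)"
    and "\<forall>i<k. \<forall>q::nat. prime q \<and> odd q \<and> int q dvd e1 * e2 * e3 \<longrightarrow> QuadRes (int q) (int (p i))"
    and "\<not> has_order4_point e1 e2 1" "\<not> has_order4_point e1 e2 (int n)"
    and "e3 > 0" "e1 < 0"
    and "\<forall>i<k. \<forall>q::nat. prime q \<and> odd q \<and> int q dvd e1 * e3 \<longrightarrow> Legendre (pstar (p i)) (int q) = 1"
    and "card (Sel2 e1 e2 e3 1) = 4"
  shows "(\<forall>L\<in>Sel2 e1 e2 e3 (int n). \<exists>!L'. L' \<in> sel_class e1 e2 e3 (int n) L \<and> good_rep n L')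
     \<and> bij_betw (Phi k p) {L \<in> Sel2 e1 e2 e3 (int n). good_rep n L} (Ker e1 e2 e3 n k p)
     \<and> (\<forall>a\<in>{L \<in> Sel2 e1 e2 e3 (int n). good_rep n L}. \<forall>b\<in>{L \<in> Sel2 e1 e2 e3 (int n). good_rep n L}.
          \<forall>c\<in>{L \<in> Sel2 e1 e2 e3 (int n). good_rep n L}.
            c \<in> sel_class e1 e2 e3 (int n) (tmul a b) \<longrightarrow>
            Phi k p c = ((\<lambda>i. fst (Phi k p a) i + fst (Phi k p b) i), (\<lambda>i. snd (Phi k p a) i + snd (Phi k p b) i)))"
proof -
  interpret quadratic_twist e1 e2 e3 n k p
    by unfold_locales (fact assms)+
  show ?thesis using unique_good_rep Phi_bij Phi_hom by blast
qed

end
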